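(* Let $\Omega \subset \mathbb{C}^n$ be a $C^\infty$-smooth, bounded pseudoconvex domain with boundary $b\Omega$. Then Property ($P$) holds on $b\Omega$ if and only if Property ($P$) holds on the support $S_{\mathfrak{C}(\mathcal{N})}$ of the Levi core of $b\Omega$.
   Context: **Property ($P$).** A compact set $K \subset \mathbb{C}^n$ satisfies Property ($P$) if for every $M>0$ there are a neighborhood $U$ of $K$ and a function $\lambda_M \in C^2(U)$ with $0 \le \lambda_M \le 1$ such that $\sum_{j,k=1}^n \frac{\partial^2 \lambda_M}{\partial z_j \partial \overline{z}_k}(z)\, w_j \overline{w}_k \ge M|w|^2$ for all $z \in U$, $w \in \mathbb{C}^n$. **Distributions and supports.** A complex distribution $\mathcal{D}=\{\mathcal{D}_p\}_{p\in b\Omega}$ on the smooth manifold $b\Omega$ assigns to each $p$ a complex linear subspace $\mathcal{D}_p$ of the complexified tangent space $\mathbb{C}T_p b\Omega$ (no constancy of dimension is required). Its support is $S_{\mathcal{D}}=\{p\in b\Omega : \dim \mathcal{D}_p>0\}$. **Levi null distribution.** $\mathcal{N}=\{\mathcal{N}_p\}_{p\in b\Omega}$, where $\mathcal{N}_p$ is the space of Levi null vectors at $p$, i.e. the vectors $X=\sum_{k=1}^n a_k\,\partial/\partial z_k|_p$ of type $(1,0)$ tangent to $b\Omega$ at $p$ that lie in the kernel of the Levi form of $b\Omega$ at $p$ (by pseudoconvexity, equivalently, those on which the Levi form vanishes). **$C^\infty$-Zariski tangent space.** For a subset $A$ of a smooth manifold $M$ and $p \in M$, $T_pA=\{X_p\in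 T_pM : X_pf=0 \text{ for all real-valued } f\in C^\infty(M) \text{ with } f|_A\equiv 0\}$, and $\mathbb{C}T_pA$ is its complexification. Here $M=b\Omega$. **Derived distributions and Levi core.** Define by transfinite recursion, for each $p \in b\Omega$: $\mathcal{N}^0_p=\mathcal{N}_p$; $\mathcal{N}^{\alpha}_p=\mathcal{N}^{\alpha-1}_p\cap \mathbb{C}T_pS_{\mathcal{N}^{\alpha-1}}$ if $\alpha$ is a successor ordinal; $\mathcal{N}^\alpha_p=\bigcap_{\beta<\alpha}\mathcal{N}^\beta_p$ if $\alpha$ is a limit ordinal. This sequence stabilizes: there is a countable ordinal $\gamma$ with $\mathcal{N}^\gamma=\mathcal{N}^\eta$ for all $\eta\ge\gamma$. The Levi core is $\mathfrak{C}(\mathcal{N})=\mathcal{N}^\gamma$, and $S_{\mathfrak{C}(\mathcal{N})}$ is its support, a compact subset of $b\Omega$. *)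

theory Defs
  imports "HOL-Analysis.Analysis"
begin

section \<open>Differentiability classes and Wirtinger calculus\<close>

text \<open>\<open>C_k_on k f S\<close> is used for open \<open>S\<close> only. All derivatives are over the reals, so on
  \<^typ>\<open>complex^'n\<close> this is regularity in the underlying real coordinates.\<close>

primrec C_k_on :: "nat \<Rightarrow> ('a::real_normed_vector \<Rightarrow> 'b::real_normed_vector) \<Rightarrow> 'a set \<Rightarrow> bool" where
  "C_k_on 0 f S \<longleftrightarrow> continuous_on S f"
| "C_k_on (Suc k) f S \<longleftrightarrow>
     (\<forall>x\<in>S. f differentiable (at x)) \<and>
     (\<forall>v. C_k_on k (\<lambda>x. frechet_derivative f (at x) v) S)"

definition smooth_on :: "('a::real_normed_vector \<Rightarrow> 'b::real_normed_vector) \<Rightarrow> 'a set \<Rightarrow> bool" where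
  "smooth_on f S \<longleftrightarrow> (\<forall>k. C_k_on k f S)"

text \<open>With \<open>z\<^sub>k = x\<^sub>k + i y\<^sub>k\<close>, the real directions \<open>\<partial>/\<partial>x\<^sub>k\<close> and \<open>\<partial>/\<partial>y\<^sub>k\<close>
  are \<^term>\<open>axis k 1 :: complex^'n\<close> and \<^term>\<open>axis k \<i> :: complex^'n\<close>.\<close>

definition wirtinger :: "'n::finite \<Rightarrow> (complex^'n \<Rightarrow> complex) \<Rightarrow> complex^'n \<Rightarrow> complex" where
  "wirtinger k f z =
     (frechet_derivative f (at z) (axis k 1) - \<i> * frechet_derivative f (at z) (axis k \<i>)) / 2"

definition wirtinger_bar :: "'n::finite \<Rightarrow> (complex^'n \<Rightarrow> complex) \<Rightarrow> complex^'n \<Rightarrow> complex" where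
  "wirtinger_bar k f z =
     (frechet_derivative f (at z) (axis k 1) + \<i> * frechet_derivative f (at z) (axis k \<i>)) / 2"

definition complex_hessian_form ::
    "(complex^'n::finite \<Rightarrow> real) \<Rightarrow> complex^'n \<Rightarrow> complex^'n \<Rightarrow> complex^'n \<Rightarrow> complex" where
  "complex_hessian_form f z a b =
     (\<Sum>j\<in>UNIV. \<Sum>k\<in>UNIV.
        wirtinger j (wirtinger_bar k (\<lambda>x. complex_of_real (f x))) z * a $ j * cnj (b $ k))"


section \<open>Property (P)\<close>

text \<open>The form is Hermitian for \<open>l\<close> of class \<open>C\<^sup>2\<close>, so its diagonal values are real
  and \<^const>\<open>Re\<close> is only a cast.\<close>

definition property_P :: "(complex^'n::finite) set \<Rightarrow> bool" where
  "property_P K \<longleftrightarrow>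
     (\<forall>M::real. M > 0 \<longrightarrow>
       (\<exists>U l. open U \<and> K \<subseteq> U \<and> C_k_on 2 l U \<and>
          (\<forall>z\<in>U. 0 \<le> l z \<and> l z \<le> 1) \<and>
          (\<forall>z\<in>U. \<forall>w. Re (complex_hessian_form l z w w) \<ge> M * (norm w)\<^sup>2)))"


section \<open>Smooth bounded pseudoconvex domains\<close>

definition local_defining_function ::
    "(complex^'n::finite) set \<Rightarrow> complex^'n \<Rightarrow> (complex^'n) set \<Rightarrow> (complex^'n \<Rightarrow> real) \<Rightarrow> bool" where
  "local_defining_function \<Omega> p U \<rho> \<longleftrightarrow>
     open U \<and> p \<in> U \<and> smooth_on \<rho> U \<and>
     (\<forall>z\<in>U. \<exists>v. frechet_derivative \<rho> (at z) v \<noteq> 0) \<and>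
     \<Omega> \<inter> U = {z \<in> U. \<rho> z < 0}"

definition smooth_bounded_domain :: "(complex^'n::finite) set \<Rightarrow> bool" where
  "smooth_bounded_domain \<Omega> \<longleftrightarrow>
     open \<Omega> \<and> connected \<Omega> \<and> \<Omega> \<noteq> {} \<and> bounded \<Omega> \<and>
     (\<forall>p\<in>frontier \<Omega>. \<exists>U \<rho>. local_defining_function \<Omega> p U \<rho>)"

text \<open>Coefficient vectors \<open>a\<close> of the (1,0) vectors \<open>\<Sum>\<^sub>k a\<^sub>k \<partial>/\<partial>z\<^sub>k\<close> at \<open>p\<close> that
  annihilate \<open>\<rho>\<close>.\<close>

definition tangential_coeffs :: "(complex^'n::finite \<Rightarrow> real) \<Rightarrow> complex^'n \<Rightarrow> (complex^'n) set" where
  "tangential_coeffs \<rho> p =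
     {a. (\<Sum>k\<in>UNIV. wirtinger k (\<lambda>x. complex_of_real (\<rho> x)) p * a $ k) = 0}"

text \<open>A change of local defining function multiplies the Levi form on the tangential (1,0)
  vectors by a positive factor. Hence whether one quantifies universally or existentially over
  local defining functions, here and below, makes no difference on a smooth boundary.\<close>

definition levi_pseudoconvex :: "(complex^'n::finite) set \<Rightarrow> bool" where
  "levi_pseudoconvex \<Omega> \<longleftrightarrow>
     (\<forall>p\<in>frontier \<Omega>. \<forall>U \<rho>. local_defining_function \<Omega> p U \<rho> \<longrightarrow>
        (\<forall>a\<in>tangential_coeffs \<rho> p. Re (complex_hessian_form \<rho> p a a) \<ge> 0))"


section \<open>Complexified tangent vectors and distributions\<close>

text \<open>A real tangent vector \<open>v\<close> of \<open>\<complex>\<^sup>n\<close> is the derivation \<open>f \<mapsto> df(v)\<close>.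
  The pair \<open>(x, y)\<close> represents the element \<open>x + i y\<close> of the complexified tangent space; the
  imaginary unit of the complexification is unrelated to the complex structure of \<open>\<complex>\<^sup>n\<close>.\<close>

type_synonym 'n ctvec = "(complex^'n) \<times> (complex^'n)"

type_synonym 'n distr = "complex^'n \<Rightarrow> 'n ctvec set"

definition ct_scale :: "complex \<Rightarrow> 'n::finite ctvec \<Rightarrow> 'n ctvec" where
  "ct_scale c X = (Re c *\<^sub>R fst X - Im c *\<^sub>R snd X, Im c *\<^sub>R fst X + Re c *\<^sub>R snd X)"

definition complexification :: "(complex^'n::finite) set \<Rightarrow> 'n ctvec set" where
  "complexification T = {(x, y). x \<in> T \<and> y \<in> T}"

text \<open>\<open>\<partial>/\<partial>z\<^sub>k = \<onehalf> (\<partial>/\<partial>x\<^sub>k - i \<partial>/\<partial>y\<^sub>k)\<close>\<close>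

definition d_dz :: "'n::finite \<Rightarrow> 'n ctvec" where
  "d_dz k = ((1/2) *\<^sub>R axis k 1, - (1/2) *\<^sub>R axis k \<i>)"

definition vec10 :: "complex^'n::finite \<Rightarrow> 'n ctvec" where
  "vec10 a = (\<Sum>k\<in>UNIV. ct_scale (a $ k) (d_dz k))"

text \<open>\<^const>\<open>dim\<close> is the real dimension, i.e.\ twice the complex dimension of a complex
  subspace.\<close>

definition support :: "(complex^'n::finite) set \<Rightarrow> 'n distr \<Rightarrow> (complex^'n) set" where
  "support \<Omega> D = {p \<in> frontier \<Omega>. dim (D p) > 0}"

definition levi_null :: "(complex^'n::finite) set \<Rightarrow> 'n distr" where
  "levi_null \<Omega> p =
     (if p \<in> frontier \<Omega> then
        {vec10 a | a. \<exists>U \<rho>. local_defining_function \<Omega> p U \<rho> \<and>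
           a \<in> tangential_coeffs \<rho> p \<and>
           (\<forall>b\<in>tangential_coeffs \<rho> p. complex_hessian_form \<rho> p a b = 0)}
      else {})"


section \<open>The smooth Zariski tangent space\<close>

definition boundary_tangent :: "(complex^'n::finite) set \<Rightarrow> complex^'n \<Rightarrow> (complex^'n) set" where
  "boundary_tangent \<Omega> p =
     {v. \<exists>U \<rho>. local_defining_function \<Omega> p U \<rho> \<and> frechet_derivative \<rho> (at p) v = 0}"

text \<open>\<open>F\<close> is a smooth local extension of \<open>f\<close>, given on \<open>M\<close>, to a neighbourhood \<open>V\<close> of
  \<open>p\<close> in the ambient space. A function on an embedded submanifold is smooth iff it has one at
  every point, and a tangent vector of the submanifold acts on it by differentiating any of
  them.\<close>

definition smooth_extension ::
    "(complex^'n::finite) set \<Rightarrow> (complex^'n \<Rightarrow> real) \<Rightarrow> complex^'n \<Rightarrow>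
     (complex^'n) set \<Rightarrow> (complex^'n \<Rightarrow> real) \<Rightarrow> bool" where
  "smooth_extension M f p V F \<longleftrightarrow>
     open V \<and> p \<in> V \<and> smooth_on F V \<and> (\<forall>z\<in>V \<inter> M. F z = f z)"

definition smooth_fun_on_submanifold ::
    "(complex^'n::finite) set \<Rightarrow> (complex^'n \<Rightarrow> real) \<Rightarrow> bool" where
  "smooth_fun_on_submanifold M f \<longleftrightarrow> (\<forall>q\<in>M. \<exists>V F. smooth_extension M f q V F)"

definition zariski_tangent ::
    "(complex^'n::finite) set \<Rightarrow> (complex^'n) set \<Rightarrow> complex^'n \<Rightarrow> (complex^'n) set" where
  "zariski_tangent \<Omega> A p =
     {v \<in> boundary_tangent \<Omega> p.
        \<forall>f. smooth_fun_on_submanifold (frontier \<Omega>) f \<and> (\<forall>q\<in>A. f q = 0) \<longrightarrow>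
          (\<forall>V F. smooth_extension (frontier \<Omega>) f p V F \<longrightarrow> frechet_derivative F (at p) v = 0)}"


section \<open>Derived distributions and the Levi core\<close>

definition derived :: "(complex^'n::finite) set \<Rightarrow> 'n distr \<Rightarrow> 'n distr" where
  "derived \<Omega> D p = D p \<inter> complexification (zariski_tangent \<Omega> (support \<Omega> D) p)"

text \<open>Ordinals are the elements of (the field of) a well-order \<open>r\<close>.\<close>

definition immediate_pred :: "'i rel \<Rightarrow> 'i \<Rightarrow> 'i \<Rightarrow> bool" where
  "immediate_pred r \<beta> \<alpha> \<longleftrightarrow> \<beta> \<in> underS r \<alpha> \<and> (\<forall>\<delta>\<in>underS r \<alpha>. (\<delta>, \<beta>) \<in> r)"

definition derived_seq ::
    "(complex^'n::finite) set \<Rightarrow> 'i rel \<Rightarrow> 'n distr \<Rightarrow> 'i \<Rightarrow> 'n distr" where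
  "derived_seq \<Omega> r D = wo_rel.worec r (\<lambda>N \<alpha>.
     if underS r \<alpha> = {} then D
     else if \<exists>\<beta>. immediate_pred r \<beta> \<alpha> then derived \<Omega> (N (THE \<beta>. immediate_pred r \<beta> \<alpha>))
     else (\<lambda>p. \<Inter>\<beta>\<in>underS r \<alpha>. N \<beta> p))"

lemma immediate_pred_unique:
  assumes "Well_order r" "immediate_pred r \<beta> \<alpha>" "immediate_pred r \<beta>' \<alpha>"
  shows "\<beta> = \<beta>'"
proof -
  have "antisym r" using assms(1) wo_rel.ANTISYM[of r] by (simp add: wo_rel_def)
  moreover have "(\<beta>, \<beta>') \<in> r" "(\<beta>', \<beta>) \<in> r"
    using assms(2,3) by (auto simp: immediate_pred_def)
  ultimately show ?thesis by (rule antisymD)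
qed

lemma immediate_pred_the:
  assumes "Well_order r" "immediate_pred r \<beta> \<alpha>"
  shows "(THE \<beta>. immediate_pred r \<beta> \<alpha>) = \<beta>"
proof (rule the_equality)
  show "immediate_pred r \<beta> \<alpha>" by (fact assms(2))
  show "\<beta>' = \<beta>" if "immediate_pred r \<beta>' \<alpha>" for \<beta>'
    using assms(1) that assms(2) by (rule immediate_pred_unique)
qed

lemma derived_seq_unfold:
  assumes "Well_order r"
  shows "derived_seq \<Omega> r D \<alpha> =
     (if underS r \<alpha> = {} then D
      else if \<exists>\<beta>. immediate_pred r \<beta> \<alpha>
        then derived \<Omega> (derived_seq \<Omega> r D (THE \<beta>. immediate_pred r \<beta> \<alpha>))
      else (\<lambda>p. \<Inter>\<beta>\<in>underS r \<alpha>. derived_seq \<Omega> r D \<beta> p))"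
proof -
  define H where "H = (\<lambda>(N :: 'a \<Rightarrow> 'b distr) \<alpha>.
     if underS r \<alpha> = {} then D
     else if \<exists>\<beta>. immediate_pred r \<beta> \<alpha> then derived \<Omega> (N (THE \<beta>. immediate_pred r \<beta> \<alpha>))
     else (\<lambda>p. \<Inter>\<beta>\<in>underS r \<alpha>. N \<beta> p))"
  have wo: "wo_rel r" using assms by (simp add: wo_rel_def)
  have "wo_rel.adm_wo r H"
    unfolding wo_rel.adm_wo_def[OF wo]
  proof (intro allI impI)
    fix f g :: "'a \<Rightarrow> 'b distr" and x
    assume eq: "\<forall>y\<in>underS r x. f y = g y"
    have "f (THE \<beta>. immediate_pred r \<beta> x) = g (THE \<beta>. immediate_pred r \<beta> x)"
      if "immediate_pred r \<beta> x" for \<beta>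
      using that eq immediate_pred_the[OF assms that] by (simp add: immediate_pred_def)
    then show "H f x = H g x" unfolding H_def using eq by auto
  qed
  then have "wo_rel.worec r H \<alpha> = H (wo_rel.worec r H) \<alpha>"
    by (rule fun_cong[OF wo_rel.worec_fixpoint[OF wo]])
  then show ?thesis unfolding derived_seq_def H_def .
qed

lemma derived_seq_zero:
  "Well_order r \<Longrightarrow> underS r \<alpha> = {} \<Longrightarrow> derived_seq \<Omega> r D \<alpha> = D"
  by (subst derived_seq_unfold) simp_all

lemma derived_seq_succ:
  assumes "Well_order r" "immediate_pred r \<beta> \<alpha>"
  shows "derived_seq \<Omega> r D \<alpha> = derived \<Omega> (derived_seq \<Omega> r D \<beta>)"
proof -
  have "underS r \<alpha> \<noteq> {}" using assms(2) by (auto simp: immediate_pred_def)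
  then show ?thesis
    using derived_seq_unfold[OF assms(1), of \<Omega> D \<alpha>] immediate_pred_the[OF assms] assms(2)
    by (metis (no_types, lifting))
qed

lemma derived_seq_limit:
  "Well_order r \<Longrightarrow> underS r \<alpha> \<noteq> {} \<Longrightarrow> \<nexists>\<beta>. immediate_pred r \<beta> \<alpha> \<Longrightarrow>
   derived_seq \<Omega> r D \<alpha> p = (\<Inter>\<beta>\<in>underS r \<alpha>. derived_seq \<Omega> r D \<beta> p)"
  by (subst derived_seq_unfold) simp_all

text \<open>\<open>omega1\<close> is a well-order of type \<open>\<omega>\<^sub>1\<close>; its elements stand for the countable ordinals.
  Since a stationary step is stationary forever, no larger ordinals are needed to say that the
  sequence has stabilized at \<open>\<gamma>\<close>.\<close>

definition omega1 :: "nat set rel" where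
  "omega1 = cardSuc natLeq"

definition levi_seq :: "(complex^'n::finite) set \<Rightarrow> nat set \<Rightarrow> 'n distr" where
  "levi_seq \<Omega> = derived_seq \<Omega> omega1 (levi_null \<Omega>)"

definition levi_core :: "(complex^'n::finite) set \<Rightarrow> 'n distr" where
  "levi_core \<Omega> = levi_seq \<Omega>
     (SOME \<gamma>. \<gamma> \<in> Field omega1 \<and> (\<forall>\<eta>. (\<gamma>, \<eta>) \<in> omega1 \<longrightarrow> levi_seq \<Omega> \<eta> = levi_seq \<Omega> \<gamma>))"

end

theory Submission
  imports Defs
begin

text \<open>
  The idea is to add to a bounded plurisubharmonic function, in as large a multiple as one likes,
  functions that vanish on the set under consideration: they contribute to the complex Hessian but
  not to the values.

  Let \<open>A\<close> be a subset of the boundary and \<open>p \<in> A\<close> a point at which no Levi null vector other than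
  \<open>0\<close> lies in the complexified Zariski tangent space of \<open>A\<close>. For a defining function \<open>\<rho>\<close>, the form
  of \<open>\<rho>\<close> at \<open>p\<close> is nonnegative on tangential vectors and vanishes there only on null vectors. Each
  nonzero null vector \<open>a\<close> is detected by a smooth \<open>F\<close> with \<open>F = 0\<close> on \<open>A\<close> and \<open>\<partial>F(a) \<noteq> 0\<close>, and the complex
  Hessian of \<open>F\<^sup>2\<close> at \<open>p\<close> is \<open>2 |\<partial>F(a)|\<^sup>2\<close>; the normal direction is handled by \<open>\<rho>\<^sup>2\<close> in the same way.
  By compactness of the unit sphere, \<open>\<rho>\<close> plus a multiple of finitely many squares is strictly
  plurisubharmonic at \<open>p\<close> and vanishes on \<open>A\<close> near \<open>p\<close> (\<open>strictly_psh_null_of_no_null_tangent\<close>).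
  A suitable cutoff turns it into a function on the whole space that vanishes on \<open>A\<close> and whose
  complex Hessian is nonnegative at every point of \<open>A\<close> and positive at \<open>p\<close>
  (\<open>strictly_psh_null_globalize\<close>).

  Now fix the constant \<open>M\<close> in Property (P). If \<open>L \<subseteq> K\<close> are compact, if all points of \<open>K - L\<close> are of the
  kind above with \<open>A = K\<close>, and if \<open>\<lambda>\<close> is a function for \<open>L\<close> with constant \<open>M\<close>, then cut \<open>\<lambda>\<close> off near \<open>L\<close>
  and add finitely many of these functions, multiplied by a large number. This gives a function
  for \<open>K\<close> with any prescribed constant \<open>M' < M\<close> (\<open>property_P_at_extend\<close>).

  This applies to \<open>L = S\<^bsub>N\<^sup>0\<^esub>\<close> in \<open>K = b\<Omega>\<close> and to \<open>L\<close> and \<open>K\<close> the supports of \<open>N\<^sup>\<alpha>\<close> and \<open>N\<^sup>\<delta>\<close>, where \<open>\<alpha>\<close> is the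
  successor of \<open>\<delta>\<close>: a Levi null vector that is tangent to \<open>S\<^bsub>N\<^sup>\<delta>\<^esub>\<close> is tangent to all earlier supports
  as well and has survived up to \<open>N\<^sup>\<delta>\<close>, so it belongs to \<open>N\<^sup>\<alpha>\<close>. At a limit ordinal, compactness shows
  that a neighbourhood of \<open>S\<^bsub>N\<^sup>\<alpha>\<^esub>\<close> contains some earlier support, so nothing is lost there. Going down
  from \<open>\<alpha>\<close> to \<open>b\<Omega>\<close> therefore consists of finitely many lossy steps, and transfinite induction yields: a
  function for \<open>S\<^bsub>N\<^sup>\<alpha>\<^esub>\<close> with constant \<open>M\<close> yields one for \<open>b\<Omega>\<close> with constant \<open>M'\<close>, for every \<open>M' < M\<close> and every
  index \<open>\<alpha>\<close> (\<open>property_P_at_frontier_from_derived_seq\<close>). The Levi core is one of the \<open>N\<^sup>\<alpha>\<close>.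

  Compactness of the supports needs that the Levi null distribution is closed, hence that the
  Levi form on tangential vectors is determined by \<open>\<Omega>\<close> up to a nonzero factor
  (\<open>levi_form_proportional\<close>).
\<close>

section \<open>Functions of class \<open>C\<^sup>k\<close>\<close>

lemma C_k_on_cong:
  assumes "open S" "C_k_on k f S" "\<And>x. x \<in> S \<Longrightarrow> f x = g x"
  shows "C_k_on k g S"
  using assms(2,3)
proof (induction k arbitrary: f g)
  case 0
  then show ?case by (auto cong: continuous_on_cong)
next
  case (Suc k)
  have diff: "f differentiable at x" if "x \<in> S" for x using Suc.prems that by auto
  have "g differentiable at x" if "x \<in> S" for x
    using has_derivative_transform_within_open[OF _ assms(1) that, of f _ UNIV g]
      diff[OF that] Suc.prems(2) unfolding differentiable_def by blast
  moreover have "C_k_on k (\<lambda>x. frechet_derivative g (at x) v) S" for v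
  proof (rule Suc.IH)
    show "C_k_on k (\<lambda>x. frechet_derivative f (at x) v) S" using Suc.prems by auto
    show "frechet_derivative f (at x) v = frechet_derivative g (at x) v" if "x \<in> S" for x
      using frechet_derivative_transform_within_open[OF diff[OF that] assms(1) that] Suc.prems(2) by metis
  qed
  ultimately show ?case by auto
qed

lemma C_k_on_subset: "C_k_on k f S \<Longrightarrow> T \<subseteq> S \<Longrightarrow> C_k_on k f T"
  by (induction k arbitrary: f) (auto intro: continuous_on_subset)

lemma C_k_on_Un:
  "open S \<Longrightarrow> open T \<Longrightarrow> C_k_on k f S \<Longrightarrow> C_k_on k f T \<Longrightarrow> C_k_on k f (S \<union> T)"
  by (induction k arbitrary: f) (auto intro: continuous_on_open_Un)

lemma C_k_on_SucD: "C_k_on (Suc k) f S \<Longrightarrow> C_k_on k f S"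
proof (induction k arbitrary: f)
  case 0
  then show ?case
    by (auto intro!: continuous_at_imp_continuous_on differentiable_imp_continuous_within)
qed simp

lemma C_k_on_imp_continuous_on: "C_k_on k f S \<Longrightarrow> continuous_on S f"
proof (induction k)
  case (Suc k)
  then show ?case using C_k_on_SucD by blast
qed simp

lemma C_k_on_const: "C_k_on k (\<lambda>_. c) S"
  by (induction k arbitrary: c) auto

lemma C_k_on_has_derivativeI:
  assumes "open S" "\<And>x. x \<in> S \<Longrightarrow> (f has_derivative f' x) (at x)"
    and "\<And>v. C_k_on k (\<lambda>x. f' x v) S"
  shows "C_k_on (Suc k) f S"
proof -
  have "frechet_derivative f (at x) = f' x" if "x \<in> S" for x
    using frechet_derivative_at[OF assms(2)[OF that]] by simp
  then show ?thesis using assms by (auto simp: differentiable_def intro!: C_k_on_cong[OF assms(1,3)])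
qed

lemma C_k_on_has_derivative:
  "C_k_on (Suc k) f S \<Longrightarrow> x \<in> S \<Longrightarrow> (f has_derivative frechet_derivative f (at x)) (at x)"
  by (simp add: frechet_derivative_works)

lemma C_k_on_bounded_linear:
  assumes "open S" "bounded_linear L" "C_k_on k f S"
  shows "C_k_on k (\<lambda>x. L (f x)) S"
  using assms(3)
proof (induction k arbitrary: f)
  case 0
  then show ?case
    using bounded_linear.continuous_on[OF assms(2)] by simp
next
  case (Suc k)
  show ?case
  proof (rule C_k_on_has_derivativeI[OF assms(1)])
    show "((\<lambda>x. L (f x)) has_derivative (\<lambda>v. L (frechet_derivative f (at x) v))) (at x)" if "x \<in> S" for x
      using bounded_linear.has_derivative[OF assms(2) C_k_on_has_derivative[OF Suc.prems that]] .
    show "C_k_on k (\<lambda>x. L (frechet_derivative f (at x) v)) S" for v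
      using Suc.prems by (intro Suc.IH) auto
  qed
qed

lemma C_k_on_linear:
  assumes "open S" "bounded_linear L"
  shows "C_k_on k L S"
proof (cases k)
  case 0
  then show ?thesis using linear_continuous_on[OF assms(2)] by simp
next
  case (Suc m)
  show ?thesis unfolding Suc
    by (rule C_k_on_has_derivativeI[OF assms(1), where f'="\<lambda>_. L"])
       (auto intro: bounded_linear_imp_has_derivative assms C_k_on_const)
qed

lemma C_k_on_add:
  assumes "open S" "C_k_on k f S" "C_k_on k g S"
  shows "C_k_on k (\<lambda>x. f x + g x) S"
  using assms(2,3)
proof (induction k arbitrary: f g)
  case 0
  then show ?case by (auto intro: continuous_on_add)
next
  case (Suc k)
  show ?case
    by (rule C_k_on_has_derivativeI[OF assms(1) has_derivative_add])
       (use Suc in \<open>auto simp: frechet_derivative_works\<close>)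
qed

lemma C_k_on_mult:
  fixes f g :: "'a::real_normed_vector \<Rightarrow> 'b::real_normed_algebra"
  assumes "open S" "C_k_on k f S" "C_k_on k g S"
  shows "C_k_on k (\<lambda>x. f x * g x) S"
  using assms(2,3)
proof (induction k arbitrary: f g)
  case 0
  then show ?case by (auto intro: continuous_on_mult)
next
  case (Suc k)
  note lower = C_k_on_SucD[OF Suc.prems(1)] C_k_on_SucD[OF Suc.prems(2)]
  show ?case
  proof (rule C_k_on_has_derivativeI[OF assms(1)])
    show "((\<lambda>x. f x * g x) has_derivative
        (\<lambda>v. f x * frechet_derivative g (at x) v + frechet_derivative f (at x) v * g x)) (at x)"
      if "x \<in> S" for x
      using has_derivative_mult C_k_on_has_derivative Suc.prems that by blast
    show "C_k_on k (\<lambda>x. f x * frechet_derivative g (at x) v + frechet_derivative f (at x) v * g x) S" for v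
      using Suc.prems lower by (intro C_k_on_add[OF assms(1)] Suc.IH) simp_all
  qed
qed

lemma C_k_on_sum:
  assumes "open S" "\<And>i. i \<in> I \<Longrightarrow> C_k_on k (f i) S"
  shows "C_k_on k (\<lambda>x. \<Sum>i\<in>I. f i x) S"
  using assms(2)
  by (induction I rule: infinite_finite_induct) (simp_all add: C_k_on_const C_k_on_add[OF assms(1)])

lemma C_k_on_cmult:
  fixes f :: "'a::real_normed_vector \<Rightarrow> 'b::real_normed_algebra"
  assumes "open S" "C_k_on k f S" shows "C_k_on k (\<lambda>x. c * f x) S"
  using C_k_on_mult[OF assms(1) C_k_on_const assms(2)] .

lemma C_k_on_diff:
  assumes "open S" "C_k_on k f S" "C_k_on k g S"
  shows "C_k_on k (\<lambda>x. f x - g x) S"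
  using C_k_on_add[OF assms(1,2) C_k_on_bounded_linear[OF assms(1) bounded_linear_minus[OF bounded_linear_ident] assms(3)]]
  by simp

lemma C_k_on_power:
  fixes f :: "'a::real_normed_vector \<Rightarrow> 'b::real_normed_field"
  assumes "open S" "C_k_on k f S" shows "C_k_on k (\<lambda>x. f x ^ n) S"
  by (induction n) (simp_all add: C_k_on_const C_k_on_mult assms)

lemma C_k_on_compose_real:
  assumes "open S" "\<And>x. (\<phi> has_real_derivative \<phi>' x) (at x)"
    and u: "C_k_on (Suc k) u S" and "C_k_on k (\<lambda>x. \<phi>' (u x)) S"
  shows "C_k_on (Suc k) (\<lambda>x. \<phi> (u x)) S"
proof (rule C_k_on_has_derivativeI[OF assms(1)])
  show "((\<lambda>x. \<phi> (u x)) has_derivative (\<lambda>v. frechet_derivative u (at x) v * \<phi>' (u x))) (at x)" if "x \<in> S" for x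
    by (rule DERIV_compose_FDERIV[OF assms(2) C_k_on_has_derivative[OF u that]])
  show "C_k_on k (\<lambda>x. frechet_derivative u (at x) v * \<phi>' (u x)) S" for v
    using u by (intro C_k_on_mult assms) auto
qed

text \<open>An exponent of at least \<open>2\<close> makes the two one-sided derivatives at \<open>0\<close> agree.\<close>

lemma DERIV_pos_part_power:
  fixes x :: real
  shows "((\<lambda>x. max 0 x ^ Suc (Suc n)) has_real_derivative of_nat (Suc (Suc n)) * max 0 x ^ Suc n) (at x)"
proof (cases x "0::real" rule: linorder_cases)
  case less
  have "((\<lambda>_. 0) has_real_derivative 0) (at x)" by simp
  then have "((\<lambda>x. max 0 x ^ Suc (Suc n)) has_real_derivative 0) (at x)"
    by (rule has_field_derivative_transform_within_open[where S="{..<0}"]) (use less in auto)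
  then show ?thesis using less by simp
next
  case greater
  have "((\<lambda>x. x ^ Suc (Suc n)) has_real_derivative of_nat (Suc (Suc n)) * x ^ Suc n) (at x)"
    using DERIV_pow[of "Suc (Suc n)" x] by simp
  then have "((\<lambda>x. max 0 x ^ Suc (Suc n)) has_real_derivative of_nat (Suc (Suc n)) * x ^ Suc n) (at x)"
    by (rule has_field_derivative_transform_within_open[where S="{0<..}"]) (use greater in auto)
  then show ?thesis using greater by simp
next
  case equal
  have "((\<lambda>h::real. max 0 h ^ Suc (Suc n) / h) \<longlongrightarrow> 0) (at 0)"
  proof (rule Lim_null_comparison)
    show "\<forall>\<^sub>F h::real in at 0. norm (max 0 h ^ Suc (Suc n) / h) \<le> \<bar>h\<bar> ^ Suc n"
      by (rule always_eventually) (auto simp: max_def abs_mult mult_nonpos_nonneg)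
    have "((\<lambda>h::real. \<bar>h\<bar> ^ Suc n) \<longlongrightarrow> \<bar>0\<bar> ^ Suc n) (at 0)" by (intro tendsto_intros)
    then show "((\<lambda>h::real. \<bar>h\<bar> ^ Suc n) \<longlongrightarrow> 0) (at 0)" by simp
  qed
  then show ?thesis using equal by (simp add: DERIV_def)
qed

text \<open>The cube is the lowest integral power of the positive part that is of class \<open>C\<^sup>2\<close>. All cutoff
  functions below are built from it, which keeps their construction elementary.\<close>

lemma C_2_pos_part_cube:
  fixes u :: "'a::real_normed_vector \<Rightarrow> real"
  assumes "open S" "C_k_on 2 u S"
  shows "C_k_on 2 (\<lambda>x. max 0 (u x) ^ 3) S"
proof -
  note u = assms(2)[unfolded numeral_2_eq_2]
  have "C_k_on 0 (\<lambda>x. max 0 (u x)) S"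
    using C_k_on_imp_continuous_on[OF u] by (auto intro!: continuous_on_max continuous_on_const)
  then have "C_k_on (Suc 0) (\<lambda>x. max 0 (u x) ^ 2) S"
    using DERIV_pos_part_power[of 0]
    by (intro C_k_on_compose_real[where \<phi>="\<lambda>x. max 0 x ^ 2" and \<phi>'="\<lambda>x. 2 * max 0 x", OF assms(1)]
         C_k_on_cmult C_k_on_SucD[OF u] assms(1)) (auto simp: numeral_2_eq_2)
  then show ?thesis
    using DERIV_pos_part_power[of 1] unfolding numeral_2_eq_2
    by (intro C_k_on_compose_real[where \<phi>="\<lambda>x. max 0 x ^ 3" and \<phi>'="\<lambda>x. 3 * max 0 x ^ 2", OF assms(1)]
         C_k_on_cmult u assms(1)) (auto simp: numeral_2_eq_2 numeral_3_eq_3)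
qed

text \<open>Off \<open>C\<close> the product is locally zero whatever values \<open>f\<close> takes, so a function on \<open>U\<close> times a cutoff
  is a global function without any redefinition outside \<open>U\<close>.\<close>

lemma C_k_on_mult_cutoff:
  fixes f \<theta> :: "'a::real_normed_vector \<Rightarrow> 'b::real_normed_algebra"
  assumes "open U" "C_k_on k f U" "C_k_on k \<theta> UNIV" "closed C" "C \<subseteq> U" "\<And>x. x \<notin> C \<Longrightarrow> \<theta> x = 0"
  shows "C_k_on k (\<lambda>x. \<theta> x * f x) UNIV"
proof -
  have "C_k_on k (\<lambda>x. \<theta> x * f x) U"
    using assms by (intro C_k_on_mult C_k_on_subset[OF assms(3)]) auto
  moreover have "C_k_on k (\<lambda>x. \<theta> x * f x) (- C)"
    using assms by (intro C_k_on_cong[OF _ C_k_on_const[of k 0]]) auto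
  ultimately have "C_k_on k (\<lambda>x. \<theta> x * f x) (U \<union> - C)"
    using assms by (intro C_k_on_Un) auto
  moreover have "U \<union> - C = UNIV" using assms(5) by auto
  ultimately show ?thesis by simp
qed

lemma C_2_bump:
  fixes p :: "'a::real_inner"
  assumes "r > 0"
  shows "\<exists>\<eta> :: 'a \<Rightarrow> real. C_k_on 2 \<eta> UNIV \<and> (\<forall>x. \<eta> x \<ge> 0) \<and> \<eta> p > 0 \<and>
    (\<forall>x. x \<notin> cball p r \<longrightarrow> \<eta> x = 0)"
proof (intro exI conjI allI impI)
  define u where "u = (\<lambda>x. r\<^sup>2 - (x - p) \<bullet> (x - p))"
  have lin: "C_k_on 1 (\<lambda>x. - (2 * ((x - p) \<bullet> v))) UNIV" for v
  proof -
    have "C_k_on 1 (\<lambda>x. (- 2) * (x \<bullet> v) + 2 * (p \<bullet> v)) UNIV"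
      by (intro C_k_on_add C_k_on_cmult C_k_on_const C_k_on_linear bounded_linear_inner_left open_UNIV)
    then show ?thesis by (simp add: algebra_simps del: C_k_on.simps One_nat_def)
  qed
  have "C_k_on (Suc 1) u UNIV"
  proof (rule C_k_on_has_derivativeI[OF open_UNIV _ lin])
    show "(u has_derivative (\<lambda>v. - (2 * ((x - p) \<bullet> v)))) (at x)" for x
      unfolding u_def by (auto intro!: derivative_eq_intros simp: inner_commute)
  qed
  then show "C_k_on 2 (\<lambda>x. max 0 (u x) ^ 3) UNIV"
    by (intro C_2_pos_part_cube) (simp_all only: open_UNIV numeral_2_eq_2 One_nat_def)
  show "max 0 (u x) ^ 3 \<ge> 0" for x by simp
  show "max 0 (u p) ^ 3 > 0" using assms by (simp add: u_def)
  show "max 0 (u x) ^ 3 = 0" if "x \<notin> cball p r" for x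
  proof -
    have "r < norm (x - p)" using that by (simp add: dist_norm norm_minus_commute)
    then have "r\<^sup>2 < (norm (x - p))\<^sup>2" using assms by (simp add: power_strict_mono)
    then show ?thesis by (simp add: u_def power2_norm_eq_inner)
  qed
qed

text \<open>If \<open>g\<close> is a finite sum of bumps supported in \<open>U\<close> with \<open>g > m > 0\<close> on \<open>L\<close>, then
  \<open>1 - max 0 (1 - g / m)\<^sup>3\<close> is \<open>1\<close> where \<open>g > m\<close> and \<open>0\<close> where all the bumps vanish.\<close>

lemma C_2_cutoff:
  fixes L U :: "'a::euclidean_space set"
  assumes "compact L" "open U" "L \<subseteq> U"
  obtains \<theta> :: "'a \<Rightarrow> real" and C W where "C_k_on 2 \<theta> UNIV" "\<forall>x. 0 \<le> \<theta> x \<and> \<theta> x \<le> 1"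
    "closed C" "C \<subseteq> U" "\<forall>x. x \<notin> C \<longrightarrow> \<theta> x = 0" "open W" "L \<subseteq> W" "\<forall>x\<in>W. \<theta> x = 1"
proof -
  have "\<exists>r \<eta>. r > 0 \<and> cball p r \<subseteq> U \<and> C_k_on 2 \<eta> UNIV \<and> (\<forall>x. \<eta> x \<ge> (0::real)) \<and> \<eta> p > 0 \<and>
      (\<forall>x. x \<notin> cball p r \<longrightarrow> \<eta> x = 0)" if p: "p \<in> L" for p
  proof -
    obtain r where r: "r > 0" "cball p r \<subseteq> U"
      using open_contains_cball_eq[OF assms(2)] assms(3) p by blast
    with C_2_bump[OF r(1), of p] show ?thesis by blast
  qed
  then obtain r \<eta> where *: "\<And>p. p \<in> L \<Longrightarrow> r p > (0::real) \<and> cball p (r p) \<subseteq> U \<and> C_k_on 2 (\<eta> p) UNIV \<and>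
      (\<forall>x. \<eta> p x \<ge> (0::real)) \<and> \<eta> p p > 0 \<and> (\<forall>x. x \<notin> cball p (r p) \<longrightarrow> \<eta> p x = 0)" by metis
  have cont: "continuous_on UNIV (\<eta> p)" if "p \<in> L" for p
    using C_k_on_imp_continuous_on * that by blast
  obtain J where J: "J \<subseteq> L" "finite J" "L \<subseteq> (\<Union>p\<in>J. {x. \<eta> p x > 0})"
  proof (rule compactE_image[OF assms(1), of L "\<lambda>p. {x. \<eta> p x > 0}"])
    show "open {x. 0 < \<eta> p x}" if "p \<in> L" for p
      using cont[OF that] by (intro open_Collect_less) (auto intro: continuous_on_const)
    show "L \<subseteq> (\<Union>p\<in>L. {x. 0 < \<eta> p x})" using * by blast
  qed
  define g where "g = (\<lambda>x. \<Sum>p\<in>J. \<eta> p x)"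
  have g0: "g x \<ge> 0" for x unfolding g_def using * J(1) by (intro sum_nonneg) auto
  have gpos: "g x > 0" if x: "x \<in> L" for x
  proof -
    obtain p where "p \<in> J" "\<eta> p x > 0" using J(3) x by auto
    then show ?thesis unfolding g_def using J * by (intro sum_pos2[of J p]) auto
  qed
  have gC2: "C_k_on 2 g UNIV" unfolding g_def using * J(1) by (intro C_k_on_sum) auto
  have gcont: "continuous_on UNIV g" by (rule C_k_on_imp_continuous_on[OF gC2])
  obtain m where m: "m > 0" "\<And>x. x \<in> L \<Longrightarrow> m < g x"
  proof (cases "L = {}")
    case True then show ?thesis using that[of 1] by auto
  next
    case False
    obtain x0 where "x0 \<in> L" "\<And>x. x \<in> L \<Longrightarrow> g x0 \<le> g x"
      using continuous_attains_inf[OF assms(1) False continuous_on_subset[OF gcont]] by auto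
    then show ?thesis using that[of "g x0 / 2"] gpos by force
  qed
  define \<theta> where "\<theta> = (\<lambda>x. 1 - max 0 (1 + (- 1 / m) * g x) ^ 3)"
  show thesis
  proof
    show "C_k_on 2 \<theta> UNIV" unfolding \<theta>_def
      by (intro C_k_on_diff C_2_pos_part_cube C_k_on_add C_k_on_cmult C_k_on_const gC2 open_UNIV)
    show "\<forall>x. 0 \<le> \<theta> x \<and> \<theta> x \<le> 1"
    proof
      fix x
      show "0 \<le> \<theta> x \<and> \<theta> x \<le> 1"
        using power_le_one[of "max 0 (1 + (- 1 / m) * g x)" 3] g0[of x] m(1) by (simp add: \<theta>_def)
    qed
    show "closed (\<Union>p\<in>J. cball p (r p))" using J by auto
    show "(\<Union>p\<in>J. cball p (r p)) \<subseteq> U" using * J(1) by auto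
    show "\<forall>x. x \<notin> (\<Union>p\<in>J. cball p (r p)) \<longrightarrow> \<theta> x = 0"
    proof (intro allI impI)
      fix x assume "x \<notin> (\<Union>p\<in>J. cball p (r p))"
      then have "g x = 0" unfolding g_def using * J(1) by (intro sum.neutral) auto
      then show "\<theta> x = 0" by (simp add: \<theta>_def)
    qed
    show "open {x. m < g x}" using gcont by (intro open_Collect_less) auto
    show "L \<subseteq> {x. m < g x}" using m by auto
    show "\<forall>x\<in>{x. m < g x}. \<theta> x = 1"
      using m(1) by (simp add: \<theta>_def field_simps)
  qed
qed

text \<open>Two applications of the mean value theorem, first in direction \<open>v\<close> and then in direction \<open>w\<close>, to a
  second difference that is symmetric in \<open>v\<close> and \<open>w\<close>.\<close>

lemma second_difference_mean_value:
  fixes f :: "'a::real_normed_vector \<Rightarrow> real"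
  assumes "open S" "C_k_on 2 f S" "cball p R \<subseteq> S" "t > 0" "t * (norm v + norm w) \<le> R"
  shows "\<exists>\<xi>\<in>cball p (t * (norm v + norm w)).
    f (p + t *\<^sub>R v + t *\<^sub>R w) - f (p + t *\<^sub>R v) - f (p + t *\<^sub>R w) + f p
      = t\<^sup>2 * frechet_derivative (\<lambda>x. frechet_derivative f (at x) v) (at \<xi>) w"
proof -
  define g where "g = (\<lambda>x. frechet_derivative f (at x) v)"
  have C: "C_k_on (Suc (Suc 0)) f S" using assms(2) by (simp add: numeral_2_eq_2)
  have df: "(f has_derivative frechet_derivative f (at x)) (at x)" if "x \<in> S" for x
    using C_k_on_has_derivative[OF C that] .
  have dg: "(g has_derivative frechet_derivative g (at x)) (at x)" if "x \<in> S" for x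
    using C that by (intro C_k_on_has_derivative[of 0]) (auto simp: g_def)
  have inc: "p + (s * t) *\<^sub>R v + (s' * t) *\<^sub>R w \<in> cball p (t * (norm v + norm w))"
    if "0 \<le> s" "s \<le> 1" "0 \<le> s'" "s' \<le> 1" for s s'
  proof -
    have "norm ((s * t) *\<^sub>R v + (s' * t) *\<^sub>R w) \<le> s * t * norm v + s' * t * norm w"
      using that assms(4) by (intro order_trans[OF norm_triangle_ineq]) (auto simp: abs_mult)
    also have "\<dots> \<le> t * norm v + t * norm w"
      using that assms(4) by (intro add_mono mult_right_mono) (auto simp: mult_left_le_one_le)
    finally show ?thesis by (simp add: dist_norm algebra_simps norm_minus_commute)
  qed
  have inS: "p + (s * t) *\<^sub>R v + (s' * t) *\<^sub>R w \<in> S"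
    if "0 \<le> s" "s \<le> 1" "0 \<le> s'" "s' \<le> 1" for s s'
    using inc[OF that] assms(3,5) by force
  have inS0: "p + (s * t) *\<^sub>R v \<in> S" "p + (s * t) *\<^sub>R v + t *\<^sub>R w \<in> S" if "0 \<le> s" "s \<le> 1" for s
    using inS[OF that, of 0] inS[OF that, of 1] by auto
  define \<phi> where "\<phi> = (\<lambda>s. f (p + (s * t) *\<^sub>R v + t *\<^sub>R w) - f (p + (s * t) *\<^sub>R v))"
  have lin: "frechet_derivative f (at x) (c *\<^sub>R v) = c * g x" if "x \<in> S" for x c
    using linear_scale[OF has_derivative_linear[OF df[OF that]]] by (simp add: g_def)
  have "(\<phi> has_real_derivative t * (g (p + (s * t) *\<^sub>R v + t *\<^sub>R w) - g (p + (s * t) *\<^sub>R v))) (at s)"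
    if "0 \<le> s" "s \<le> 1" for s
  proof -
    have "((\<lambda>s. p + (s * t) *\<^sub>R v + t *\<^sub>R w) has_derivative (\<lambda>h. (h * t) *\<^sub>R v)) (at s)"
      by (auto intro!: derivative_eq_intros)
    then have 1: "((\<lambda>s. f (p + (s * t) *\<^sub>R v + t *\<^sub>R w)) has_derivative
        (\<lambda>h. frechet_derivative f (at (p + (s * t) *\<^sub>R v + t *\<^sub>R w)) ((h * t) *\<^sub>R v))) (at s)"
      by (rule has_derivative_compose) (rule df[OF inS0(2)[OF that]])
    have "((\<lambda>s. p + (s * t) *\<^sub>R v) has_derivative (\<lambda>h. (h * t) *\<^sub>R v)) (at s)"
      by (auto intro!: derivative_eq_intros)
    then have 2: "((\<lambda>s. f (p + (s * t) *\<^sub>R v)) has_derivative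
        (\<lambda>h. frechet_derivative f (at (p + (s * t) *\<^sub>R v)) ((h * t) *\<^sub>R v))) (at s)"
      by (rule has_derivative_compose) (rule df[OF inS0(1)[OF that]])
    show ?thesis unfolding has_field_derivative_def \<phi>_def
      by (rule has_derivative_eq_rhs[OF has_derivative_diff[OF 1 2]])
         (use lin inS0[OF that] in \<open>auto simp: algebra_simps fun_eq_iff\<close>)
  qed
  then obtain s where s: "0 < s" "s < 1"
    "\<phi> 1 - \<phi> 0 = (1 - 0) * (t * (g (p + (s * t) *\<^sub>R v + t *\<^sub>R w) - g (p + (s * t) *\<^sub>R v)))"
    using MVT2[of 0 1 \<phi> "\<lambda>s. t * (g (p + (s * t) *\<^sub>R v + t *\<^sub>R w) - g (p + (s * t) *\<^sub>R v))"] by auto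
  define q where "q = p + (s * t) *\<^sub>R v"
  have qS: "q + (s' * t) *\<^sub>R w \<in> S" if "0 \<le> s'" "s' \<le> 1" for s'
    using inS[of s s'] s that by (simp add: q_def)
  have "((\<lambda>s'. g (q + (s' * t) *\<^sub>R w)) has_real_derivative
      t * frechet_derivative g (at (q + (s' * t) *\<^sub>R w)) w) (at s')" if "0 \<le> s'" "s' \<le> 1" for s'
  proof -
    have "((\<lambda>s'. q + (s' * t) *\<^sub>R w) has_derivative (\<lambda>h. (h * t) *\<^sub>R w)) (at s')"
      by (auto intro!: derivative_eq_intros)
    then have 1: "((\<lambda>s'. g (q + (s' * t) *\<^sub>R w)) has_derivative
        (\<lambda>h. frechet_derivative g (at (q + (s' * t) *\<^sub>R w)) ((h * t) *\<^sub>R w))) (at s')"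
      by (rule has_derivative_compose) (rule dg[OF qS[OF that]])
    show ?thesis unfolding has_field_derivative_def
      by (rule has_derivative_eq_rhs[OF 1])
        (use linear_scale[OF has_derivative_linear[OF dg[OF qS[OF that]]]] in \<open>auto simp: algebra_simps fun_eq_iff\<close>)
  qed
  then obtain s' where s': "0 < s'" "s' < 1"
    "g (q + (1 * t) *\<^sub>R w) - g (q + (0 * t) *\<^sub>R w) = (1 - 0) * (t * frechet_derivative g (at (q + (s' * t) *\<^sub>R w)) w)"
    using MVT2[of 0 1 "\<lambda>s'. g (q + (s' * t) *\<^sub>R w)" "\<lambda>s'. t * frechet_derivative g (at (q + (s' * t) *\<^sub>R w)) w"] by auto
  show ?thesis
  proof
    show "p + (s * t) *\<^sub>R v + (s' * t) *\<^sub>R w \<in> cball p (t * (norm v + norm w))"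
      using s s' by (intro inc) auto
    show "f (p + t *\<^sub>R v + t *\<^sub>R w) - f (p + t *\<^sub>R v) - f (p + t *\<^sub>R w) + f p
      = t\<^sup>2 * frechet_derivative (\<lambda>x. frechet_derivative f (at x) v) (at (p + (s * t) *\<^sub>R v + (s' * t) *\<^sub>R w)) w"
      using s(3) s'(3) by (simp add: \<phi>_def g_def q_def power2_eq_square algebra_simps)
  qed
qed

text \<open>Schwarz's theorem: by the previous lemma the symmetric second difference, divided by \<open>t\<^sup>2\<close>, is a value
  of either mixed derivative at a point that tends to \<open>p\<close> as \<open>t\<close> tends to \<open>0\<close>.\<close>

lemma second_derivative_symmetric:
  fixes f :: "'a::real_normed_vector \<Rightarrow> real"
  assumes "open S" "C_k_on 2 f S" "p \<in> S"
  shows "frechet_derivative (\<lambda>x. frechet_derivative f (at x) v) (at p) w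
       = frechet_derivative (\<lambda>x. frechet_derivative f (at x) w) (at p) v"
proof -
  define D where "D = (\<lambda>v w x. frechet_derivative (\<lambda>x. frechet_derivative f (at x) v) (at x) w)"
  have cont: "continuous_on S (D v w)" for v w
    using assms(2) by (simp add: numeral_2_eq_2 D_def)
  obtain R where R: "R > 0" "cball p R \<subseteq> S" using assms open_contains_cball by blast
  have "\<bar>D v w p - D w v p\<bar> \<le> e" if "e > 0" for e
  proof -
    have near: "\<exists>d>0. \<forall>x. dist x p < d \<longrightarrow> \<bar>D v w x - D v w p\<bar> < e / 2" for v w
    proof -
      have "isCont (D v w) p"
        using cont assms(1,3) by (simp add: continuous_on_eq_continuous_at)
      then show ?thesis
        using \<open>e > 0\<close> half_gt_zero[of e] unfolding continuous_at_eps_delta dist_real_def by blast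
    qed
    obtain d1 where d1: "d1 > 0" "\<And>x. dist x p < d1 \<Longrightarrow> \<bar>D v w x - D v w p\<bar> < e / 2" using near by blast
    obtain d2 where d2: "d2 > 0" "\<And>x. dist x p < d2 \<Longrightarrow> \<bar>D w v x - D w v p\<bar> < e / 2" using near by blast
    define \<delta> where "\<delta> = min R (min d1 d2) / 2"
    have \<delta>: "\<delta> > 0" "\<delta> < d1" "\<delta> < d2" "\<delta> \<le> R" using R(1) d1(1) d2(1) by (auto simp: \<delta>_def)
    define t where "t = \<delta> / (norm v + norm w + 1)"
    have t: "t > 0" using \<delta> by (auto simp: t_def intro!: divide_pos_pos add_nonneg_pos)
    have "t * (norm v + norm w) \<le> t * (norm v + norm w + 1)" using t by (intro mult_left_mono) auto
    also have "\<dots> = \<delta>"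
      using norm_ge_zero[of v] norm_ge_zero[of w] unfolding t_def by (subst times_divide_eq_left, subst nonzero_mult_div_cancel_right) linarith+
    finally have tb: "t * (norm v + norm w) \<le> \<delta>" .
    obtain \<xi> where \<xi>: "dist p \<xi> \<le> \<delta>" "f (p + t *\<^sub>R v + t *\<^sub>R w) - f (p + t *\<^sub>R v) - f (p + t *\<^sub>R w) + f p = t\<^sup>2 * D v w \<xi>"
      using second_difference_mean_value[OF assms(1,2) R(2) t, of v w] tb \<delta>(4) unfolding D_def by force
    obtain \<zeta> where \<zeta>: "dist p \<zeta> \<le> \<delta>" "f (p + t *\<^sub>R w + t *\<^sub>R v) - f (p + t *\<^sub>R w) - f (p + t *\<^sub>R v) + f p = t\<^sup>2 * D w v \<zeta>"
      using second_difference_mean_value[OF assms(1,2) R(2) t, of w v] tb \<delta>(4) unfolding D_def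
      by (force simp: add.commute)
    have "t\<^sup>2 * D v w \<xi> = t\<^sup>2 * D w v \<zeta>" using \<xi>(2) \<zeta>(2) by (simp add: algebra_simps)
    then have "D v w \<xi> = D w v \<zeta>" using t by simp
    moreover have "\<bar>D v w \<xi> - D v w p\<bar> < e / 2" using \<xi>(1) \<delta> by (intro d1(2)) (simp add: dist_commute)
    moreover have "\<bar>D w v \<zeta> - D w v p\<bar> < e / 2" using \<zeta>(1) \<delta> by (intro d2(2)) (simp add: dist_commute)
    ultimately show ?thesis by linarith
  qed
  then have "D v w p = D w v p" using field_le_epsilon[of "\<bar>D v w p - D w v p\<bar>" 0] by auto
  then show ?thesis by (simp add: D_def)
qed

section \<open>Calculus of the complex Hessian\<close>

lemma frechet_derivative_cong_open:
  assumes "open S" "z \<in> S" "\<And>x. x \<in> S \<Longrightarrow> f x = g x"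
  shows "frechet_derivative f (at z) = frechet_derivative g (at z)"
proof -
  have "(f has_derivative D) (at z) \<longleftrightarrow> (g has_derivative D) (at z)" for D
    using has_derivative_transform_within_open[OF _ assms(1,2), of f D UNIV g]
      has_derivative_transform_within_open[OF _ assms(1,2), of g D UNIV f] assms(3) by auto
  then show ?thesis by (simp add: frechet_derivative_def)
qed

lemma wirtinger_cong_open:
  assumes "open S" "z \<in> S" "\<And>x. x \<in> S \<Longrightarrow> F x = G x"
  shows "wirtinger k F z = wirtinger k G z" "wirtinger_bar k F z = wirtinger_bar k G z"
  using frechet_derivative_cong_open[OF assms] by (auto simp: wirtinger_def wirtinger_bar_def)

lemma complex_hessian_form_cong_open:
  assumes "open S" "z \<in> S" "\<And>x. x \<in> S \<Longrightarrow> f x = g x"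
  shows "complex_hessian_form f z a b = complex_hessian_form g z a b"
proof -
  have "wirtinger_bar k (\<lambda>x. complex_of_real (f x)) x = wirtinger_bar k (\<lambda>x. complex_of_real (g x)) x"
    if "x \<in> S" for x k
    by (rule wirtinger_cong_open(2)[OF assms(1) that]) (simp add: assms(3))
  then show ?thesis unfolding complex_hessian_form_def
    using wirtinger_cong_open(1)[OF assms(1,2), of "wirtinger_bar k (\<lambda>x. complex_of_real (f x))" "wirtinger_bar k (\<lambda>x. complex_of_real (g x))" for k]
    by simp
qed

lemma wirtinger_const: "wirtinger k (\<lambda>_. c) z = 0" "wirtinger_bar k (\<lambda>_. c) z = 0"
  by (auto simp: wirtinger_def wirtinger_bar_def)

lemma complex_hessian_form_const: "complex_hessian_form (\<lambda>_. c) z a b = 0"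
  unfolding complex_hessian_form_def
  by (simp add: wirtinger_const(1) wirtinger_const(2)[abs_def])

lemma wirtinger_add:
  assumes "F differentiable at z" "G differentiable at z"
  shows "wirtinger k (\<lambda>x. F x + G x) z = wirtinger k F z + wirtinger k G z"
    "wirtinger_bar k (\<lambda>x. F x + G x) z = wirtinger_bar k F z + wirtinger_bar k G z"
proof -
  have "frechet_derivative (\<lambda>x. F x + G x) (at z) = (\<lambda>v. frechet_derivative F (at z) v + frechet_derivative G (at z) v)"
    by (rule frechet_derivative_at[symmetric], rule has_derivative_add)
       (use assms in \<open>auto simp: frechet_derivative_works\<close>)
  then show "wirtinger k (\<lambda>x. F x + G x) z = wirtinger k F z + wirtinger k G z"
    "wirtinger_bar k (\<lambda>x. F x + G x) z = wirtinger_bar k F z + wirtinger_bar k G z"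
    by (auto simp: wirtinger_def wirtinger_bar_def field_simps)
qed

lemma wirtinger_mult:
  assumes "F differentiable at z" "G differentiable at z"
  shows "wirtinger k (\<lambda>x. F x * G x) z = F z * wirtinger k G z + G z * wirtinger k F z"
    "wirtinger_bar k (\<lambda>x. F x * G x) z = F z * wirtinger_bar k G z + G z * wirtinger_bar k F z"
proof -
  have "frechet_derivative (\<lambda>x. F x * G x) (at z) =
      (\<lambda>v. F z * frechet_derivative G (at z) v + frechet_derivative F (at z) v * G z)"
    by (rule frechet_derivative_at[symmetric], rule has_derivative_mult)
       (use assms in \<open>auto simp: frechet_derivative_works\<close>)
  then show "wirtinger k (\<lambda>x. F x * G x) z = F z * wirtinger k G z + G z * wirtinger k F z"
    "wirtinger_bar k (\<lambda>x. F x * G x) z = F z * wirtinger_bar k G z + G z * wirtinger_bar k F z"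
    by (auto simp: wirtinger_def wirtinger_bar_def field_simps)
qed

lemma C_k_on_wirtinger:
  assumes "open S" "C_k_on (Suc k) F S"
  shows "C_k_on k (wirtinger j F) S" "C_k_on k (wirtinger_bar j F) S"
proof -
  have D: "C_k_on k (\<lambda>x. frechet_derivative F (at x) v) S" for v using assms(2) by simp
  have "C_k_on k (\<lambda>x. (1 / 2) * (frechet_derivative F (at x) (axis j 1) - \<i> * frechet_derivative F (at x) (axis j \<i>))) S"
    by (intro C_k_on_cmult C_k_on_diff assms(1) D)
  then show "C_k_on k (wirtinger j F) S" by (simp add: wirtinger_def[abs_def])
  have "C_k_on k (\<lambda>x. (1 / 2) * (frechet_derivative F (at x) (axis j 1) + \<i> * frechet_derivative F (at x) (axis j \<i>))) S"
    by (intro C_k_on_cmult C_k_on_add assms(1) D)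
  then show "C_k_on k (wirtinger_bar j F) S" by (simp add: wirtinger_bar_def[abs_def])
qed

lemma C_k_on_of_real:
  "open S \<Longrightarrow> C_k_on k f S \<Longrightarrow> C_k_on k (\<lambda>x. complex_of_real (f x)) S"
  by (rule C_k_on_bounded_linear[OF _ bounded_linear_of_real])

lemma C_2_differentiable:
  assumes "open S" "C_k_on 2 f S" "z \<in> S"
  shows "f differentiable at z" "(\<lambda>x. complex_of_real (f x)) differentiable at z"
    "wirtinger k (\<lambda>x. complex_of_real (f x)) differentiable at z"
    "wirtinger_bar k (\<lambda>x. complex_of_real (f x)) differentiable at z"
proof -
  have C: "C_k_on (Suc (Suc 0)) (\<lambda>x. complex_of_real (f x)) S"
    using C_k_on_of_real[OF assms(1,2)] by (simp add: numeral_2_eq_2)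
  then show "(\<lambda>x. complex_of_real (f x)) differentiable at z" using assms(3) by simp
  show "f differentiable at z" using assms(2,3) by (simp add: numeral_2_eq_2)
  show "wirtinger k (\<lambda>x. complex_of_real (f x)) differentiable at z"
    "wirtinger_bar k (\<lambda>x. complex_of_real (f x)) differentiable at z"
    using C_k_on_wirtinger[OF assms(1) C] assms(3) by auto
qed

lemma frechet_derivative_of_real:
  assumes "f differentiable at z"
  shows "frechet_derivative (\<lambda>x. complex_of_real (f x)) (at z) v = complex_of_real (frechet_derivative f (at z) v)"
proof -
  have "((\<lambda>x. complex_of_real (f x)) has_derivative (\<lambda>v. complex_of_real (frechet_derivative f (at z) v))) (at z)"
    using bounded_linear.has_derivative[OF bounded_linear_of_real] assms by (simp add: frechet_derivative_works)
  from frechet_derivative_at[OF this, symmetric] show ?thesis by simp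
qed

lemma wirtinger_of_real:
  assumes "f differentiable at z"
  shows "wirtinger k (\<lambda>x. complex_of_real (f x)) z =
      (complex_of_real (frechet_derivative f (at z) (axis k 1))
        - \<i> * complex_of_real (frechet_derivative f (at z) (axis k \<i>))) / 2"
    "wirtinger_bar k (\<lambda>x. complex_of_real (f x)) z =
      cnj (wirtinger k (\<lambda>x. complex_of_real (f x)) z)"
  by (auto simp: wirtinger_def wirtinger_bar_def frechet_derivative_of_real[OF assms])

lemma linear_complex_coordinates:
  fixes T :: "complex^'n::finite \<Rightarrow> 'b::real_vector"
  assumes "linear T"
  shows "T a = (\<Sum>k\<in>UNIV. Re (a $ k) *\<^sub>R T (axis k 1) + Im (a $ k) *\<^sub>R T (axis k \<i>))"
proof -
  have "a = (\<Sum>k\<in>UNIV. Re (a $ k) *\<^sub>R axis k 1 + Im (a $ k) *\<^sub>R axis k \<i>)"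
  proof (subst vec_eq_iff, intro allI)
    fix i
    have "(\<Sum>k\<in>UNIV. Re (a $ k) *\<^sub>R axis k 1 + Im (a $ k) *\<^sub>R axis k \<i>) $ i
      = (\<Sum>k\<in>UNIV. if k = i then Re (a $ k) *\<^sub>R 1 + Im (a $ k) *\<^sub>R \<i> else 0)"
      unfolding sum_component by (rule sum.cong) (auto simp: axis_def)
    also have "\<dots> = a $ i" by (simp add: complex_eq_iff)
    finally show "a $ i = (\<Sum>k\<in>UNIV. Re (a $ k) *\<^sub>R axis k 1 + Im (a $ k) *\<^sub>R axis k \<i>) $ i" by simp
  qed
  from arg_cong[OF this, of T] show ?thesis
    using assms by (simp add: linear_sum linear_add linear_scale)
qed

text \<open>The (1,0)-part of the differential of \<open>F\<close> is its complex linear part.\<close>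

lemma wirtinger_sum:
  fixes F :: "complex^'n::finite \<Rightarrow> complex"
  assumes "F differentiable at z"
  shows "(\<Sum>k\<in>UNIV. wirtinger k F z * a $ k) =
    (frechet_derivative F (at z) a - \<i> * frechet_derivative F (at z) (\<i> *s a)) / 2"
proof -
  define T where "T = frechet_derivative F (at z)"
  have T: "linear T" using linear_frechet_derivative[OF assms] by (simp add: T_def)
  have "wirtinger k F z * a $ k = (1/2) * ((Re (a $ k) *\<^sub>R T (axis k 1) + Im (a $ k) *\<^sub>R T (axis k \<i>))
     - \<i> * (Re ((\<i> *s a) $ k) *\<^sub>R T (axis k 1) + Im ((\<i> *s a) $ k) *\<^sub>R T (axis k \<i>)))" for k
    by (simp add: wirtinger_def T_def complex_eq_iff field_simps)
  then have "(\<Sum>k\<in>UNIV. wirtinger k F z * a $ k) = (1/2) * (T a - \<i> * T (\<i> *s a))"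
    unfolding linear_complex_coordinates[OF T, of a] linear_complex_coordinates[OF T, of "\<i> *s a"]
    by (simp only: sum_subtractf[symmetric] sum_distrib_left)
  then show ?thesis by (simp add: T_def)
qed

text \<open>The form \<open>\<partial>f\<close> at \<open>z\<close>, applied to the (1,0) vector with coefficients \<open>a\<close>. Its kernel for a defining
  function is \<^const>\<open>tangential_coeffs\<close>.\<close>

definition complex_differential :: "(complex^'n::finite \<Rightarrow> real) \<Rightarrow> complex^'n \<Rightarrow> complex^'n \<Rightarrow> complex" where
  "complex_differential f z a = (\<Sum>k\<in>UNIV. wirtinger k (\<lambda>x. complex_of_real (f x)) z * a $ k)"

lemma tangential_coeffs_iff: "a \<in> tangential_coeffs \<rho> p \<longleftrightarrow> complex_differential \<rho> p a = 0"
  by (simp add: tangential_coeffs_def complex_differential_def)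

lemma complex_differential_eq:
  assumes "f differentiable at z"
  shows "complex_differential f z a = (complex_of_real (frechet_derivative f (at z) a)
    - \<i> * complex_of_real (frechet_derivative f (at z) (\<i> *s a))) / 2"
proof -
  have "(\<lambda>x. complex_of_real (f x)) differentiable at z"
    using assms bounded_linear.has_derivative[OF bounded_linear_of_real]
    unfolding differentiable_def by blast
  from wirtinger_sum[OF this] show ?thesis
    unfolding complex_differential_def frechet_derivative_of_real[OF assms] .
qed

lemma complex_differential_eq_0_iff:
  assumes "f differentiable at z"
  shows "complex_differential f z a = 0 \<longleftrightarrow>
    frechet_derivative f (at z) a = 0 \<and> frechet_derivative f (at z) (\<i> *s a) = 0"
  by (auto simp: complex_differential_eq[OF assms] complex_eq_iff)

lemma complex_hessian_form_add:
  assumes S: "open S" "C_k_on 2 f S" "C_k_on 2 g S" "z \<in> S"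
  shows "complex_hessian_form (\<lambda>x. f x + g x) z a b = complex_hessian_form f z a b + complex_hessian_form g z a b"
proof -
  note df = C_2_differentiable[OF S(1,2)] and dg = C_2_differentiable[OF S(1,3)]
  have "wirtinger j (wirtinger_bar k (\<lambda>x. complex_of_real (f x + g x))) z
    = wirtinger j (\<lambda>x. wirtinger_bar k (\<lambda>x. complex_of_real (f x)) x + wirtinger_bar k (\<lambda>x. complex_of_real (g x)) x) z" for j k
    by (rule wirtinger_cong_open(1)[OF S(1,4)]) (simp add: wirtinger_add df dg)
  then have "wirtinger j (wirtinger_bar k (\<lambda>x. complex_of_real (f x + g x))) z
    = wirtinger j (wirtinger_bar k (\<lambda>x. complex_of_real (f x))) z + wirtinger j (wirtinger_bar k (\<lambda>x. complex_of_real (g x))) z" for j k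
    using df dg S(4) by (simp add: wirtinger_add)
  then show ?thesis
    by (simp add: complex_hessian_form_def ring_distribs sum.distrib)
qed

lemma complex_hessian_form_mult:
  assumes S: "open S" "C_k_on 2 f S" "C_k_on 2 g S" "z \<in> S"
  shows "complex_hessian_form (\<lambda>x. f x * g x) z a b =
    f z * complex_hessian_form g z a b + g z * complex_hessian_form f z a b
    + complex_differential f z a * cnj (complex_differential g z b)
    + complex_differential g z a * cnj (complex_differential f z b)"
proof -
  define F where "F = (\<lambda>x. complex_of_real (f x))"
  define G where "G = (\<lambda>x. complex_of_real (g x))"
  note df = C_2_differentiable[OF S(1,2), folded F_def] and dg = C_2_differentiable[OF S(1,3), folded G_def]
  have bar: "wirtinger_bar k F z = cnj (wirtinger k F z)" "wirtinger_bar k G z = cnj (wirtinger k G z)" for k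
    using wirtinger_of_real(2) df(1)[OF S(4)] dg(1)[OF S(4)] by (auto simp: F_def G_def)
  have "wirtinger j (wirtinger_bar k (\<lambda>x. complex_of_real (f x * g x))) z
    = wirtinger j (\<lambda>x. F x * wirtinger_bar k G x + G x * wirtinger_bar k F x) z" for j k
    by (rule wirtinger_cong_open(1)[OF S(1,4)]) (simp add: wirtinger_mult df dg F_def[symmetric] G_def[symmetric]
      F_def[THEN fun_cong, symmetric] G_def[THEN fun_cong, symmetric])
  also have "wirtinger j (\<lambda>x. F x * wirtinger_bar k G x + G x * wirtinger_bar k F x) z
    = F z * wirtinger j (wirtinger_bar k G) z + cnj (wirtinger k G z) * wirtinger j F z
    + (G z * wirtinger j (wirtinger_bar k F) z + cnj (wirtinger k F z) * wirtinger j G z)" for j k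
    using df[OF S(4)] dg[OF S(4)] by (simp add: wirtinger_add wirtinger_mult differentiable_mult bar)
  finally have h: "wirtinger j (wirtinger_bar k (\<lambda>x. complex_of_real (f x * g x))) z
    = F z * wirtinger j (wirtinger_bar k G) z + cnj (wirtinger k G z) * wirtinger j F z
    + (G z * wirtinger j (wirtinger_bar k F) z + cnj (wirtinger k F z) * wirtinger j G z)" for j k .
  have prod: "(\<Sum>j\<in>UNIV. \<Sum>k\<in>UNIV. (u j * a $ j) * (cnj (v k) * cnj (b $ k)))
    = (\<Sum>j\<in>UNIV. u j * a $ j) * cnj (\<Sum>k\<in>UNIV. v k * b $ k)" for u v :: "'a \<Rightarrow> complex"
    by (simp add: sum_product)
  have "complex_hessian_form (\<lambda>x. f x * g x) z a b =
    (\<Sum>j\<in>UNIV. \<Sum>k\<in>UNIV. F z * (wirtinger j (wirtinger_bar k G) z * a $ j * cnj (b $ k))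
      + G z * (wirtinger j (wirtinger_bar k F) z * a $ j * cnj (b $ k))
      + (wirtinger j F z * a $ j) * (cnj (wirtinger k G z) * cnj (b $ k))
      + (wirtinger j G z * a $ j) * (cnj (wirtinger k F z) * cnj (b $ k)))"
    unfolding complex_hessian_form_def h by (intro sum.cong refl) (simp add: algebra_simps)
  also have "\<dots> = F z * complex_hessian_form g z a b + G z * complex_hessian_form f z a b
    + complex_differential f z a * cnj (complex_differential g z b)
    + complex_differential g z a * cnj (complex_differential f z b)"
    unfolding sum.distrib prod complex_hessian_form_def complex_differential_def
    by (simp only: sum_distrib_left F_def G_def)
  finally show ?thesis by (simp add: F_def G_def)
qed

lemma complex_hessian_form_cmult:
  assumes S: "open S" "C_k_on 2 f S" "z \<in> S"
  shows "complex_hessian_form (\<lambda>x. c * f x) z a b = c * complex_hessian_form f z a b"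
  using complex_hessian_form_mult[OF S(1) C_k_on_const[of _ c] S(2,3)]
  by (simp add: complex_hessian_form_const complex_differential_def wirtinger_const)

lemma complex_hessian_form_sum:
  assumes S: "open S" "\<And>i. i \<in> I \<Longrightarrow> C_k_on 2 (f i) S" "z \<in> S"
  shows "complex_hessian_form (\<lambda>x. \<Sum>i\<in>I. f i x) z a b = (\<Sum>i\<in>I. complex_hessian_form (f i) z a b)"
  using S(2)
proof (induction I rule: infinite_finite_induct)
  case (insert i I)
  have "C_k_on 2 (\<lambda>x. \<Sum>i\<in>I. f i x) S" using insert.prems by (intro C_k_on_sum S(1)) auto
  then have "complex_hessian_form (\<lambda>x. f i x + (\<Sum>i\<in>I. f i x)) z a b
    = complex_hessian_form (f i) z a b + complex_hessian_form (\<lambda>x. \<Sum>i\<in>I. f i x) z a b"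
    using insert.prems by (intro complex_hessian_form_add[OF S(1) _ _ S(3)]) auto
  then show ?case using insert by simp
qed (auto simp: complex_hessian_form_const)

text \<open>The square of a function that vanishes at \<open>z\<close> contributes positively in every direction in which
  its (1,0)-differential is nonzero. All positivity that is added later comes from this.\<close>

lemma complex_hessian_form_power2:
  assumes S: "open S" "C_k_on 2 f S" "z \<in> S" and "f z = 0"
  shows "complex_hessian_form (\<lambda>x. (f x)\<^sup>2) z a a = of_real (2 * (cmod (complex_differential f z a))\<^sup>2)"
  using complex_hessian_form_mult[OF S(1,2,2,3), of a a] assms(4)
  by (simp add: power2_eq_square complex_norm_square[symmetric] flip: power2_eq_square complex_norm_square)

lemma complex_differential_mult:
  assumes "f differentiable at z" "g differentiable at z"
  shows "complex_differential (\<lambda>x. f x * g x) z a =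
    f z * complex_differential g z a + g z * complex_differential f z a"
proof -
  have d: "(\<lambda>x. complex_of_real (f x)) differentiable at z" "(\<lambda>x. complex_of_real (g x)) differentiable at z"
    using assms bounded_linear.has_derivative[OF bounded_linear_of_real]
    unfolding differentiable_def by blast+
  show ?thesis unfolding complex_differential_def of_real_mult wirtinger_mult(1)[OF d]
    by (simp add: ring_distribs sum.distrib sum_distrib_left mult.assoc)
qed

text \<open>Interchanging \<open>a\<close> and \<open>b\<close> interchanges the order of the two derivatives, so this is Schwarz's theorem.\<close>

lemma complex_hessian_form_hermitian:
  assumes S: "open S" "C_k_on 2 f S" "z \<in> S"
  shows "complex_hessian_form f z b a = cnj (complex_hessian_form f z a b)"
proof -
  define D where "D = (\<lambda>v w. frechet_derivative (\<lambda>x. frechet_derivative f (at x) v) (at z) w)"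
  have sym: "D v w = D w v" for v w using second_derivative_symmetric[OF S] by (simp add: D_def)
  have dD: "((\<lambda>x. frechet_derivative f (at x) v) has_derivative D v) (at z)" for v
    unfolding D_def using S(2,3) by (auto simp: numeral_2_eq_2 simp flip: frechet_derivative_works)
  define h where "h = (\<lambda>j k. wirtinger j (wirtinger_bar k (\<lambda>x. complex_of_real (f x))) z)"
  have h: "h j k = (D (axis k 1) (axis j 1) + D (axis k \<i>) (axis j \<i>)
      + \<i> * (D (axis k \<i>) (axis j 1) - D (axis k 1) (axis j \<i>))) / 4" for j k
  proof -
    define B where "B = (\<lambda>x. (complex_of_real (frechet_derivative f (at x) (axis k 1))
      + \<i> * complex_of_real (frechet_derivative f (at x) (axis k \<i>))) / 2)"
    have "h j k = wirtinger j B z"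
      unfolding h_def
      by (rule wirtinger_cong_open(1)[OF S(1,3)])
         (simp add: wirtinger_of_real C_2_differentiable(1)[OF S(1,2)] B_def)
    moreover have "(B has_derivative (\<lambda>v. (complex_of_real (D (axis k 1) v) + \<i> * complex_of_real (D (axis k \<i>) v)) / 2)) (at z)"
      unfolding B_def
      by (intro bounded_linear.has_derivative[OF bounded_linear_divide] has_derivative_add
        bounded_linear.has_derivative[OF bounded_linear_mult_right] has_derivative_of_real dD)
    from frechet_derivative_at[OF this, symmetric]
    have "wirtinger j B z = ((D (axis k 1) (axis j 1) + \<i> * D (axis k \<i>) (axis j 1)) / 2
      - \<i> * ((D (axis k 1) (axis j \<i>) + \<i> * D (axis k \<i>) (axis j \<i>)) / 2)) / 2"
      by (simp add: wirtinger_def)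
    ultimately show ?thesis by (simp add: complex_eq_iff)
  qed
  have hh: "h k j = cnj (h j k)" for j k
    unfolding h using sym by (simp add: complex_eq_iff)
  have "complex_hessian_form f z b a = (\<Sum>j\<in>UNIV. \<Sum>k\<in>UNIV. h j k * b $ j * cnj (a $ k))"
    by (simp add: complex_hessian_form_def h_def)
  also have "\<dots> = (\<Sum>k\<in>UNIV. \<Sum>j\<in>UNIV. cnj (h k j * a $ k * cnj (b $ j)))"
    by (subst sum.swap) (simp add: hh[symmetric] mult_ac)
  also have "\<dots> = cnj (complex_hessian_form f z a b)"
    by (simp add: complex_hessian_form_def h_def)
  finally show ?thesis .
qed

lemma complex_hessian_form_lin:
  "complex_hessian_form f z (a + b) c = complex_hessian_form f z a c + complex_hessian_form f z b c"
  "complex_hessian_form f z c (a + b) = complex_hessian_form f z c a + complex_hessian_form f z c b"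
  "complex_hessian_form f z (s *s a) b = s * complex_hessian_form f z a b"
  "complex_hessian_form f z a (s *s b) = cnj s * complex_hessian_form f z a b"
  by (simp_all add: complex_hessian_form_def algebra_simps sum.distrib sum_distrib_left)

lemma complex_hessian_form_scaleR:
  "complex_hessian_form f z (s *\<^sub>R a) (s *\<^sub>R a) = of_real (s\<^sup>2) * complex_hessian_form f z a a"
proof -
  have "s *\<^sub>R a = complex_of_real s *s a"
    unfolding vec_eq_iff vector_smult_component vector_scaleR_component by (simp add: scaleR_conv_of_real)
  then show ?thesis by (simp only: complex_hessian_form_lin) (simp add: power2_eq_square)
qed

lemma complex_differential_lin:
  "complex_differential f z (a + b) = complex_differential f z a + complex_differential f z b"
  "complex_differential f z (s *s a) = s * complex_differential f z a"
  by (simp_all add: complex_differential_def ring_distribs sum.distrib sum_distrib_left mult_ac)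

lemma continuous_on_complex_hessian_form:
  assumes "open S" "C_k_on 2 f S"
  shows "continuous_on (S \<times> UNIV) (\<lambda>x. complex_hessian_form f (fst x) (snd x) (snd x))"
proof -
  have "C_k_on (Suc (Suc 0)) (\<lambda>x. complex_of_real (f x)) S"
    using C_k_on_of_real[OF assms] by (simp add: numeral_2_eq_2)
  then have "continuous_on S (wirtinger j (wirtinger_bar k (\<lambda>x. complex_of_real (f x))))" for j k
    using C_k_on_wirtinger assms(1) by (metis C_k_on.simps(1))
  then have "continuous_on (S \<times> UNIV) (\<lambda>x. wirtinger j (wirtinger_bar k (\<lambda>x. complex_of_real (f x))) (fst x))" for j k
    by (rule continuous_on_compose2[where g="wirtinger j (wirtinger_bar k (\<lambda>x. complex_of_real (f x)))"])
       (auto intro: continuous_on_fst continuous_on_id)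
  then show ?thesis unfolding complex_hessian_form_def by (intro continuous_intros)
qed

lemma continuous_on_complex_differential:
  assumes "open S" "C_k_on 1 f S"
  shows "continuous_on (S \<times> UNIV) (\<lambda>x. complex_differential f (fst x) (snd x))"
proof -
  have "C_k_on (Suc 0) (\<lambda>x. complex_of_real (f x)) S"
    using C_k_on_of_real[OF assms] by simp
  then have "continuous_on S (wirtinger j (\<lambda>x. complex_of_real (f x)))" for j
    using C_k_on_wirtinger assms(1) by (metis C_k_on.simps(1))
  then have "continuous_on (S \<times> UNIV) (\<lambda>x. wirtinger j (\<lambda>x. complex_of_real (f x)) (fst x))" for j
    by (rule continuous_on_compose2[where g="wirtinger j (\<lambda>x. complex_of_real (f x))"])
       (auto intro: continuous_on_fst continuous_on_id)
  then show ?thesis unfolding complex_differential_def by (intro continuous_intros)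
qed

text \<open>The Cauchy-Schwarz argument: a vector on which a semidefinite Hermitian form vanishes lies in its
  kernel.\<close>

lemma null_vector_of_semidefinite:
  assumes S: "open S" "C_k_on 2 f S" "z \<in> S"
    and W: "\<And>a b. a \<in> W \<Longrightarrow> b \<in> W \<Longrightarrow> a + b \<in> W" "\<And>s a. a \<in> W \<Longrightarrow> s *s a \<in> W"
    and nonneg: "\<And>a. a \<in> W \<Longrightarrow> Re (complex_hessian_form f z a a) \<ge> 0"
    and a: "a \<in> W" "Re (complex_hessian_form f z a a) = 0" and b: "b \<in> W"
  shows "complex_hessian_form f z a b = 0"
proof -
  define c where "c = complex_hessian_form f z a b"
  define B where "B = Re (complex_hessian_form f z b b)"
  have B: "B \<ge> 0" using nonneg b by (simp add: B_def)
  \<comment> \<open>With \<open>c\<close> the value of the form at \<open>(a, b)\<close>, the form at \<open>a - t c b\<close> equals \<open>t |c|\<^sup>2 (t B - 2)\<close>, which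
    is negative for this \<open>t\<close> unless \<open>c = 0\<close>.\<close>
  define t where "t = 1 / (B + 1)"
  have t: "t > 0" "t * B < 1" using B by (auto simp: t_def field_simps)
  define s where "s = - (of_real t * c)"
  have "0 \<le> Re (complex_hessian_form f z (a + s *s b) (a + s *s b))"
    using nonneg W a b by blast
  also have "complex_hessian_form f z (a + s *s b) (a + s *s b) =
      complex_hessian_form f z a a + cnj s * c + s * cnj c + s * cnj s * complex_hessian_form f z b b"
    unfolding c_def complex_hessian_form_hermitian[OF S, of b a, symmetric]
    by (simp add: complex_hessian_form_lin algebra_simps)
  also have "Re \<dots> = - 2 * t * (cmod c)\<^sup>2 + t\<^sup>2 * (cmod c)\<^sup>2 * B"
  proof -
    have "cnj s * c + s * cnj c = of_real (- 2 * t * (cmod c)\<^sup>2)"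
      unfolding of_real_mult complex_norm_square by (simp add: s_def complex_norm_square mult_ac)
    moreover have "s * cnj s = of_real (t\<^sup>2 * (cmod c)\<^sup>2)"
    proof -
      have "s * cnj s = of_real (t\<^sup>2) * (c * cnj c)" by (simp add: s_def power2_eq_square mult_ac)
      then show ?thesis by (simp only: complex_norm_square[symmetric] of_real_mult)
    qed
    ultimately have "complex_hessian_form f z a a + cnj s * c + s * cnj c + s * cnj s * complex_hessian_form f z b b
      = complex_hessian_form f z a a + of_real (- 2 * t * (cmod c)\<^sup>2) + of_real (t\<^sup>2 * (cmod c)\<^sup>2) * complex_hessian_form f z b b"
      by (simp add: add.assoc)
    moreover have "Re (X + of_real u + of_real v * Y) = Re X + u + v * Re Y" for X Y u v by simp
    ultimately show ?thesis using a(2) by (simp only: B_def)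
  qed
  also have "\<dots> = t * (cmod c)\<^sup>2 * (t * B - 2)" by (simp add: algebra_simps power2_eq_square)
  finally have "(cmod c)\<^sup>2 \<le> 0"
    using t by (smt (verit) mult_pos_neg mult_pos_pos zero_le_power2)
  then show ?thesis by (simp add: c_def)
qed

text \<open>The real and the imaginary part of the vector \<open>\<Sum> a\<^sub>k \<partial>/\<partial>z\<^sub>k\<close>.\<close>

lemma vec10_eq: "vec10 a = ((1/2) *\<^sub>R a, - (1/2) *\<^sub>R (\<i> *s a))"
proof -
  have "fst (vec10 a) = (1/2) *\<^sub>R a"
  proof (subst vec_eq_iff, intro allI)
    fix i
    have "fst (vec10 a) $ i = (\<Sum>k\<in>UNIV. if k = i then (1/2) *\<^sub>R a $ i else 0)"
      unfolding vec10_def fst_sum sum_component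
      by (rule sum.cong) (auto simp: ct_scale_def d_dz_def axis_def complex_eq_iff)
    then show "fst (vec10 a) $ i = ((1/2) *\<^sub>R a) $ i" by simp
  qed
  moreover have "snd (vec10 a) = - (1/2) *\<^sub>R (\<i> *s a)"
  proof (subst vec_eq_iff, intro allI)
    fix i
    have "snd (vec10 a) $ i = (\<Sum>k\<in>UNIV. if k = i then - (1/2) *\<^sub>R (\<i> * a $ i) else 0)"
      unfolding vec10_def snd_sum sum_component
      by (rule sum.cong) (auto simp: ct_scale_def d_dz_def axis_def complex_eq_iff)
    then show "snd (vec10 a) $ i = (- (1/2) *\<^sub>R (\<i> *s a)) $ i" by simp
  qed
  ultimately show ?thesis by (simp add: prod_eq_iff)
qed

section \<open>Gluing with functions that vanish on the set\<close>

text \<open>Property (P) for a single constant \<open>M\<close>. The induction over ordinals runs at this level, because a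
  single function for one \<open>M\<close> lives on a neighbourhood of the set and so serves all sets close to it.\<close>

definition property_P_at :: "real \<Rightarrow> (complex^'n::finite) set \<Rightarrow> bool" where
  "property_P_at M K \<longleftrightarrow>
     (\<exists>U l. open U \<and> K \<subseteq> U \<and> C_k_on 2 l U \<and>
          (\<forall>z\<in>U. 0 \<le> l z \<and> l z \<le> 1) \<and>
          (\<forall>z\<in>U. \<forall>w. Re (complex_hessian_form l z w w) \<ge> M * (norm w)\<^sup>2))"

lemma property_P_iff: "property_P K \<longleftrightarrow> (\<forall>M>0. property_P_at M K)"
  by (simp add: property_P_def property_P_at_def)

lemma property_P_at_subset: "property_P_at M K \<Longrightarrow> L \<subseteq> K \<Longrightarrow> property_P_at M L"
  unfolding property_P_at_def by blast

text \<open>Multiplying such a \<open>\<Psi>\<close> by a large constant makes its complex Hessian at \<open>p\<close> as large as desired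
  without changing its values on \<open>K\<close>.\<close>

definition strictly_psh_null :: "(complex^'n::finite) set \<Rightarrow> complex^'n \<Rightarrow> bool" where
  "strictly_psh_null K p \<longleftrightarrow>
     (\<exists>V \<Psi>. open V \<and> p \<in> V \<and> C_k_on 2 \<Psi> V \<and> (\<forall>z\<in>K \<inter> V. \<Psi> z = 0) \<and>
        (\<forall>t. t \<noteq> 0 \<longrightarrow> Re (complex_hessian_form \<Psi> p t t) > 0))"

text \<open>On the compact set where \<open>h \<le> 0\<close>, finitely many of the \<open>g i\<close> have a sum that is bounded below by a
  positive number; a large multiple of that sum outweighs the minimum of \<open>h\<close>, and elsewhere it does no
  harm because the \<open>g i\<close> are nonnegative. The lemma is used twice: on the unit sphere at one point, to
  make a function strictly plurisubharmonic there, and on \<open>K\<close> times the unit sphere.\<close>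

lemma compact_positive_combination:
  fixes h :: "'a::topological_space \<Rightarrow> real"
  assumes S: "compact S" and h: "continuous_on S h"
    and g: "\<And>i. i \<in> I \<Longrightarrow> continuous_on S (g i)" "\<And>i x. i \<in> I \<Longrightarrow> x \<in> S \<Longrightarrow> g i x \<ge> (0::real)"
    and pos: "\<And>x. x \<in> S \<Longrightarrow> h x > 0 \<or> (\<exists>i\<in>I. g i x > 0)"
  obtains J C where "finite J" "J \<subseteq> I" "C \<ge> 0" "\<forall>x\<in>S. h x + C * (\<Sum>i\<in>J. g i x) > 0"
proof -
  have "\<exists>T. open T \<and> T \<inter> S = {x\<in>S. h x > 0}"
    using h[unfolded continuous_on_open_invariant, rule_format, of "{0<..}"] by (auto 4 3 simp: vimage_def)
  then obtain H where H: "open H" "H \<inter> S = {x\<in>S. h x > 0}" by blast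
  have "\<exists>T. open T \<and> T \<inter> S = {x\<in>S. g i x > 0}" if "i \<in> I" for i
    using g(1)[OF that, unfolded continuous_on_open_invariant, rule_format, of "{0<..}"] by (auto 4 3 simp: vimage_def)
  then obtain G where G: "\<And>i. i \<in> I \<Longrightarrow> open (G i)" "\<And>i. i \<in> I \<Longrightarrow> G i \<inter> S = {x\<in>S. g i x > 0}" by metis
  have T: "compact (S - H)" using S H(1) by (rule compact_diff)
  have cov: "S - H \<subseteq> (\<Union>i\<in>I. G i)" using pos H(2) G(2) by blast
  obtain J where J: "J \<subseteq> I" "finite J" "S - H \<subseteq> (\<Union>i\<in>J. G i)"
    using compactE_image[OF T G(1) cov] by blast
  define s where "s = (\<lambda>x. \<Sum>i\<in>J. g i x)"
  have s0: "s x \<ge> 0" if "x \<in> S" for x unfolding s_def using g(2) J(1) that by (intro sum_nonneg) auto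
  have spos: "s x > 0" if x: "x \<in> S - H" for x
  proof -
    obtain i where i: "i \<in> J" "x \<in> G i" using J(3) x by blast
    then have "g i x > 0" using G(2)[of i] J(1) x by blast
    then show ?thesis unfolding s_def using i J g(2) x by (intro sum_pos2[of J i]) auto
  qed
  have scont: "continuous_on S s" unfolding s_def using g(1) J(1) by (intro continuous_on_sum) auto
  show thesis
  proof (cases "S - H = {}")
    case True
    have "h x + 0 * (\<Sum>i\<in>J. g i x) > 0" if "x \<in> S" for x using True H(2) that by auto
    then show thesis using that[OF J(2,1), of 0] by simp
  next
    case False
    obtain x0 where x0: "x0 \<in> S - H" "\<And>x. x \<in> S - H \<Longrightarrow> s x0 \<le> s x"
      using continuous_attains_inf[OF T False continuous_on_subset[OF scont]] by auto
    obtain x1 where x1: "x1 \<in> S - H" "\<And>x. x \<in> S - H \<Longrightarrow> h x1 \<le> h x"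
      using continuous_attains_inf[OF T False continuous_on_subset[OF h]] by auto
    define C where "C = (\<bar>h x1\<bar> + 1) / s x0"
    have m: "s x0 > 0" using spos x0(1) .
    have C: "C \<ge> 0" using m by (simp add: C_def)
    have "h x + C * s x > 0" if "x \<in> S" for x
    proof (cases "x \<in> H")
      case True
      then have "h x > 0" using H(2) that by blast
      then show ?thesis using C s0[OF that] by (simp add: add_pos_nonneg)
    next
      case False
      then have x: "x \<in> S - H" using that by blast
      have "\<bar>h x1\<bar> + 1 = C * s x0" using m by (simp add: C_def)
      also have "\<dots> \<le> C * s x" using x0(2)[OF x] C by (rule mult_left_mono)
      finally show ?thesis using x1(2)[OF x] by linarith
    qed
    then show thesis using that[OF J(2,1) C] by (simp add: s_def)
  qed
qed

lemma unit_sphere_nonempty: "sphere (0::complex^'n::finite) 1 \<noteq> {}"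
proof -
  have "axis undefined 1 \<in> sphere (0::complex^'n) 1" by (simp add: norm_eq_sqrt_inner inner_axis_axis)
  then show ?thesis by blast
qed

lemma form_bound_from_unit_sphere:
  assumes "\<And>t. t \<in> sphere 0 1 \<Longrightarrow> m \<le> Re (complex_hessian_form f q t t)"
  shows "m * (norm t)\<^sup>2 \<le> Re (complex_hessian_form f q t t)"
proof (cases "t = 0")
  case True
  then show ?thesis by (simp add: complex_hessian_form_def)
next
  case False
  define u where "u = (1 / norm t) *\<^sub>R t"
  have t: "t = norm t *\<^sub>R u" using False by (simp add: u_def)
  have "m \<le> Re (complex_hessian_form f q u u)" using False by (intro assms) (simp add: u_def)
  then have "(norm t)\<^sup>2 * m \<le> (norm t)\<^sup>2 * Re (complex_hessian_form f q u u)" by (intro mult_left_mono) auto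
  also have "\<dots> = Re (complex_hessian_form f q t t)"
    using complex_hessian_form_scaleR[of f q "norm t" u, folded t] by (simp flip: of_real_power)
  finally show ?thesis by (simp add: mult.commute)
qed

text \<open>The form is uniformly continuous on a closed ball around \<open>p\<close> times the compact unit sphere, so a
  strict bound at \<open>p\<close> holds near \<open>p\<close> for all unit vectors at once.\<close>

lemma form_bound_persists:
  assumes V: "open V" "C_k_on 2 f V" "p \<in> V"
    and m: "\<And>t. t \<in> sphere 0 1 \<Longrightarrow> m < Re (complex_hessian_form f p t t)"
  obtains r where "r > 0" "cball p r \<subseteq> V"
    "\<And>q t. q \<in> cball p r \<Longrightarrow> t \<in> sphere 0 1 \<Longrightarrow> m < Re (complex_hessian_form f q t t)"
proof -
  define g where "g = (\<lambda>x. Re (complex_hessian_form f (fst x) (snd x) (snd x)))"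
  have g: "continuous_on (V \<times> UNIV) g"
    unfolding g_def using continuous_on_complex_hessian_form[OF V(1,2)] by (rule continuous_on_Re)
  obtain R where R: "R > 0" "cball p R \<subseteq> V" using open_contains_cball V(1,3) by blast
  have "compact (cball p R \<times> sphere (0::complex^'a) 1)" by (intro compact_Times) auto
  then have u: "uniformly_continuous_on (cball p R \<times> sphere 0 1) g"
    using R by (intro compact_uniformly_continuous continuous_on_subset[OF g]) auto
  have "continuous_on (sphere 0 1) (\<lambda>t. g (p, t))"
    using V(3) by (intro continuous_on_compose2[OF g] continuous_intros) auto
  then obtain t0 where t0: "t0 \<in> sphere 0 1" "\<And>t. t \<in> sphere 0 1 \<Longrightarrow> g (p, t0) \<le> g (p, t)"
    using continuous_attains_inf[OF compact_sphere unit_sphere_nonempty] by blast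
  define e where "e = g (p, t0) - m"
  have e: "e > 0" using m[OF t0(1)] by (simp add: e_def g_def)
  obtain d where d: "d > 0"
    "\<And>x y. x \<in> cball p R \<times> sphere 0 1 \<Longrightarrow> y \<in> cball p R \<times> sphere 0 1 \<Longrightarrow> dist y x < d \<Longrightarrow> dist (g y) (g x) < e"
    using u e unfolding uniformly_continuous_on_def by meson
  show thesis
  proof (rule that[of "min R (d / 2)"])
    show "min R (d / 2) > 0" using R d by simp
    show "cball p (min R (d / 2)) \<subseteq> V" using R(2) by auto
    show "m < Re (complex_hessian_form f q t t)" if "q \<in> cball p (min R (d / 2))" "t \<in> sphere 0 1" for q t
    proof -
      have "dist (g (q, t)) (g (p, t)) < e"
        using that d(1) R by (intro d(2)) (auto simp: dist_Pair_Pair dist_commute)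
      then show ?thesis using t0(2)[OF that(2)] by (simp add: dist_real_def e_def g_def)
    qed
  qed
qed

text \<open>With a bump \<open>\<eta>\<close> at \<open>p\<close>, take \<open>\<Phi> = \<eta>\<^sup>4 \<Psi> + D (\<eta> \<Psi>)\<^sup>2\<close>. At points where \<open>\<Psi> = 0\<close> its form at a unit vector \<open>t\<close>
  is \<open>\<eta>\<^sup>2 (\<eta>\<^sup>2 P + 8 \<eta> R + 2 D X\<^sup>2)\<close>, where \<open>P\<close> is the form of \<open>\<Psi>\<close>, \<open>X = |\<partial>\<Psi>(t)|\<close>, and the cross term satisfies
  \<open>|R| \<le> E X\<close> with a bound \<open>E\<close> for \<open>|\<partial>\<eta>(t)|\<close>. The powers of \<open>\<eta>\<close> are chosen so that the bracket is bounded below by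
  a quadratic form in \<open>\<eta>\<close> and \<open>X\<close>, which is positive definite for large \<open>D\<close>. So the cutoff does not spoil nonnegativity
  even where \<open>\<eta>\<close> becomes small.\<close>

lemma strictly_psh_null_globalize:
  assumes "strictly_psh_null K p" "p \<in> K"
  shows "\<exists>\<Phi>. C_k_on 2 \<Phi> UNIV \<and> (\<forall>z\<in>K. \<Phi> z = 0) \<and>
    (\<forall>z\<in>K. \<forall>t. Re (complex_hessian_form \<Phi> z t t) \<ge> 0) \<and>
    (\<forall>t\<in>sphere 0 1. Re (complex_hessian_form \<Phi> p t t) > 0)"
proof -
  obtain V \<Psi> where V: "open V" "p \<in> V" "C_k_on 2 \<Psi> V" and zero: "\<And>z. z \<in> K \<Longrightarrow> z \<in> V \<Longrightarrow> \<Psi> z = 0"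
    and pos: "\<And>t. t \<noteq> 0 \<Longrightarrow> Re (complex_hessian_form \<Psi> p t t) > 0"
    using assms(1) unfolding strictly_psh_null_def by blast
  have "continuous_on (sphere 0 1) (\<lambda>t. Re (complex_hessian_form \<Psi> p t t))"
  proof -
    have "continuous_on (sphere 0 1) (\<lambda>t. complex_hessian_form \<Psi> (fst (p, t)) (snd (p, t)) (snd (p, t)))"
      by (rule continuous_on_compose2[OF continuous_on_complex_hessian_form[OF V(1,3)]])
         (use V(2) in \<open>auto intro!: continuous_on_Pair continuous_on_const continuous_on_id\<close>)
    then show ?thesis by (intro continuous_on_Re) simp
  qed
  then obtain t0 where t0: "t0 \<in> sphere 0 1"
    "\<And>t. t \<in> sphere 0 1 \<Longrightarrow> Re (complex_hessian_form \<Psi> p t0 t0) \<le> Re (complex_hessian_form \<Psi> p t t)"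
    using continuous_attains_inf[OF compact_sphere unit_sphere_nonempty] by blast
  \<comment> \<open>One quarter of the minimum at \<open>p\<close>: the form is at least \<open>2 c\<close> near \<open>p\<close>, one \<open>c\<close> absorbs the cross term
    and the other remains.\<close>
  define c where "c = Re (complex_hessian_form \<Psi> p t0 t0) / 4"
  have "t0 \<noteq> 0" using t0(1) by auto
  then have c: "c > 0" using pos[of t0] by (simp add: c_def)
  have "2 * c < Re (complex_hessian_form \<Psi> p t t)" if "t \<in> sphere 0 1" for t
    using t0(2)[OF that] c by (simp add: c_def)
  from form_bound_persists[OF V(1,3,2) this]
  obtain r where r: "r > 0" "cball p r \<subseteq> V"
    and P: "\<And>q t. q \<in> cball p r \<Longrightarrow> t \<in> sphere 0 1 \<Longrightarrow> 2 * c < Re (complex_hessian_form \<Psi> q t t)" by blast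
  obtain \<eta> :: "complex^'a \<Rightarrow> real" where \<eta>: "C_k_on 2 \<eta> UNIV" "\<And>x. \<eta> x \<ge> 0" "\<eta> p > 0"
    "\<And>x. x \<notin> cball p r \<Longrightarrow> \<eta> x = 0"
  proof -
    obtain \<eta> :: "complex^'a \<Rightarrow> real" where "C_k_on 2 \<eta> UNIV \<and> (\<forall>x. \<eta> x \<ge> 0) \<and> \<eta> p > 0 \<and>
      (\<forall>x. x \<notin> cball p r \<longrightarrow> \<eta> x = 0)" using C_2_bump[OF r(1)] by (rule exE)
    then show thesis using that[of \<eta>] by simp
  qed
  have "C_k_on 1 \<eta> UNIV" using \<eta>(1) C_k_on_SucD by (metis Suc_1)
  then have "continuous_on (cball p r \<times> sphere 0 1) (\<lambda>x. complex_differential \<eta> (fst x) (snd x))"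
    by (intro continuous_on_subset[OF continuous_on_complex_differential[OF open_UNIV]]) auto
  then have "bounded ((\<lambda>x. complex_differential \<eta> (fst x) (snd x)) ` (cball p r \<times> sphere 0 1))"
    by (intro compact_imp_bounded compact_continuous_image compact_Times compact_cball compact_sphere)
  then obtain E where E: "E > 0" "\<And>q t. q \<in> cball p r \<Longrightarrow> t \<in> sphere 0 1 \<Longrightarrow> cmod (complex_differential \<eta> q t) \<le> E"
    unfolding bounded_pos by auto
  \<comment> \<open>Chosen so that \<open>c\<close> times the bracket contains the perfect square \<open>(c \<eta> - 4 E X)\<^sup>2\<close>.\<close>
  define D where "D = 8 * E\<^sup>2 / c"
  have cD: "c * D = 8 * E\<^sup>2" using c by (simp add: D_def)
  define g where "g = (\<lambda>x. \<eta> x * \<Psi> x)"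
  have gC: "C_k_on 2 g UNIV"
    unfolding g_def by (rule C_k_on_mult_cutoff[OF V(1,3) \<eta>(1) closed_cball r(2) \<eta>(4)])
  define \<Phi> where "\<Phi> = (\<lambda>x. \<eta> x * (\<eta> x * \<eta> x) * g x + D * (g x)\<^sup>2)"
  have e3: "C_k_on 2 (\<lambda>x. \<eta> x * (\<eta> x * \<eta> x)) UNIV" by (intro C_k_on_mult \<eta>(1) open_UNIV)
  have \<Phi>C: "C_k_on 2 \<Phi> UNIV" unfolding \<Phi>_def
    by (intro C_k_on_mult C_k_on_add C_k_on_cmult C_k_on_power e3 gC \<eta>(1) open_UNIV)
  have lower: "Re (complex_hessian_form \<Phi> q t t) \<ge> c * \<eta> q ^ 4"
    if q: "q \<in> K" "q \<in> cball p r" and t: "t \<in> sphere 0 1" for q t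
  proof -
    have qV: "q \<in> V" using q r by blast
    have \<Psi>0: "\<Psi> q = 0" using zero q qV by blast
    have g0: "g q = 0" by (simp add: g_def \<Psi>0)
    define X where "X = cmod (complex_differential \<Psi> q t)"
    define R where "R = Re (complex_differential \<eta> q t * cnj (complex_differential \<Psi> q t))"
    define P where "P = Re (complex_hessian_form \<Psi> q t t)"
    define e where "e = \<eta> q"
    have e: "e \<ge> 0" using \<eta>(2) by (simp add: e_def)
    have "\<bar>R\<bar> \<le> cmod (complex_differential \<eta> q t) * X"
      unfolding R_def X_def using abs_Re_le_cmod[of "complex_differential \<eta> q t * cnj (complex_differential \<Psi> q t)"]
      by (simp add: norm_mult)
    also have "\<dots> \<le> E * X" using E(2)[OF q(2) t] by (intro mult_right_mono) (auto simp: X_def)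
    finally have R: "\<bar>R\<bar> \<le> E * X" .
    have dPsi: "\<Psi> differentiable at q" and d\<eta>: "\<eta> differentiable at q" and dg: "g differentiable at q"
      using C_2_differentiable(1) V(1,3) qV \<eta>(1) gC open_UNIV by blast+
    have \<eta>V: "C_k_on 2 \<eta> V" using C_k_on_subset[OF \<eta>(1)] by blast
    have swap: "Re (u * cnj w) = Re (w * cnj u)" for u w :: complex by simp
    have "complex_hessian_form g q t t = of_real e * complex_hessian_form \<Psi> q t t
      + complex_differential \<eta> q t * cnj (complex_differential \<Psi> q t)
      + complex_differential \<Psi> q t * cnj (complex_differential \<eta> q t)"
      unfolding g_def complex_hessian_form_mult[OF V(1) \<eta>V V(3) qV] by (simp add: \<Psi>0 e_def)
    then have Hg: "Re (complex_hessian_form g q t t) = e * P + 2 * R"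
      using swap[of "complex_differential \<Psi> q t" "complex_differential \<eta> q t"] by (simp add: P_def R_def)
    have dg_eq: "complex_differential g q t = of_real e * complex_differential \<Psi> q t"
      unfolding g_def complex_differential_mult[OF d\<eta> dPsi] by (simp add: \<Psi>0 e_def)
    have de3: "complex_differential (\<lambda>x. \<eta> x * (\<eta> x * \<eta> x)) q t = of_real (3 * e\<^sup>2) * complex_differential \<eta> q t"
      using d\<eta> by (simp add: complex_differential_mult differentiable_mult e_def power2_eq_square algebra_simps)
    have "complex_hessian_form (\<lambda>x. \<eta> x * (\<eta> x * \<eta> x) * g x) q t t =
      of_real (e ^ 3) * complex_hessian_form g q t t
      + of_real (3 * e ^ 3) * (complex_differential \<eta> q t * cnj (complex_differential \<Psi> q t))
      + of_real (3 * e ^ 3) * (complex_differential \<Psi> q t * cnj (complex_differential \<eta> q t))"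
      unfolding complex_hessian_form_mult[OF open_UNIV e3 gC UNIV_I] de3 dg_eq
      by (simp add: g0 e_def power2_eq_square power3_eq_cube mult_ac)
    moreover have "Re (of_real a * u + of_real b * v + of_real b * w) = a * Re u + b * Re v + b * Re w"
      for a b u v w by simp
    ultimately have H1: "Re (complex_hessian_form (\<lambda>x. \<eta> x * (\<eta> x * \<eta> x) * g x) q t t)
        = e ^ 3 * (e * P + 2 * R) + 3 * e ^ 3 * R + 3 * e ^ 3 * R"
      using swap[of "complex_differential \<Psi> q t" "complex_differential \<eta> q t"] by (simp only: Hg R_def)
    have "complex_hessian_form (\<lambda>x. D * (g x)\<^sup>2) q t t = of_real D * of_real (2 * (e * X)\<^sup>2)"
      using complex_hessian_form_cmult[OF open_UNIV C_k_on_power[OF open_UNIV gC] UNIV_I]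
        complex_hessian_form_power2[OF open_UNIV gC UNIV_I g0] e
      by (simp add: dg_eq norm_mult X_def)
    then have H2: "Re (complex_hessian_form (\<lambda>x. D * (g x)\<^sup>2) q t t) = D * (2 * (e * X)\<^sup>2)"
      by (simp flip: of_real_mult of_real_power)
    have "complex_hessian_form \<Phi> q t t = complex_hessian_form (\<lambda>x. \<eta> x * (\<eta> x * \<eta> x) * g x) q t t
        + complex_hessian_form (\<lambda>x. D * (g x)\<^sup>2) q t t"
      unfolding \<Phi>_def
      by (rule complex_hessian_form_add[OF open_UNIV]) (intro C_k_on_mult C_k_on_cmult C_k_on_power e3 gC open_UNIV UNIV_I)+
    then have "Re (complex_hessian_form \<Phi> q t t) = e\<^sup>2 * (e\<^sup>2 * P + 8 * e * R + 2 * D * X\<^sup>2)"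
      by (simp add: H1 H2) (simp add: power2_eq_square power3_eq_cube algebra_simps)
    also have "\<dots> \<ge> e\<^sup>2 * (c * e\<^sup>2)"
    proof (rule mult_left_mono)
      have PP: "2 * c \<le> P" using P[OF q(2) t] by (simp add: P_def)
      have "c * (c * e\<^sup>2) \<le> c * (c * e\<^sup>2) + (c * e - 4 * E * X)\<^sup>2" by simp
      also have "\<dots> = c * (e\<^sup>2 * (2 * c) - 8 * e * (E * X)) + 2 * (c * D) * X\<^sup>2"
        unfolding cD by (simp add: power2_eq_square algebra_simps)
      also have "\<dots> = c * (e\<^sup>2 * (2 * c) + 8 * e * (- (E * X)) + 2 * D * X\<^sup>2)" by (simp add: algebra_simps)
      also have "\<dots> \<le> c * (e\<^sup>2 * P + 8 * e * R + 2 * D * X\<^sup>2)"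
        using PP R c e by (intro mult_left_mono add_mono order_refl) auto
      finally show "c * e\<^sup>2 \<le> e\<^sup>2 * P + 8 * e * R + 2 * D * X\<^sup>2" using c by simp
    qed simp
    finally show ?thesis by (simp add: e_def power2_eq_square power4_eq_xxxx mult_ac)
  qed
  show ?thesis
  proof (intro exI conjI ballI allI)
    show "C_k_on 2 \<Phi> UNIV" by (rule \<Phi>C)
    show "\<Phi> z = 0" if "z \<in> K" for z
    proof (cases "z \<in> cball p r")
      case True
      then have "\<Psi> z = 0" using zero r that by blast
      then show ?thesis by (simp add: \<Phi>_def g_def)
    next
      case False
      then show ?thesis using \<eta>(4) by (simp add: \<Phi>_def g_def)
    qed
    show "0 \<le> Re (complex_hessian_form \<Phi> z t t)" if z: "z \<in> K" for z t
    proof (cases "z \<in> cball p r")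
      case True
      have "0 \<le> Re (complex_hessian_form \<Phi> z u u)" if "u \<in> sphere 0 1" for u
        using order_trans[OF _ lower[OF z True that]] c \<eta>(2) by simp
      from form_bound_from_unit_sphere[OF this] show ?thesis by simp
    next
      case False
      have "complex_hessian_form \<Phi> z t t = complex_hessian_form (\<lambda>_. 0) z t t"
        by (rule complex_hessian_form_cong_open[of "- cball p r"])
           (use False \<eta>(4) in \<open>auto simp: \<Phi>_def g_def\<close>)
      then show ?thesis by (simp add: complex_hessian_form_const)
    qed
    show "0 < Re (complex_hessian_form \<Phi> p t t)" if "t \<in> sphere 0 1" for t
    proof -
      have "0 < c * \<eta> p ^ 4" using c \<eta>(3) by simp
      then show ?thesis using lower[OF assms(2) _ that] r by force
    qed
  qed
qed

text \<open>The strict bounds on \<open>K\<close> persist on a neighbourhood. There \<open>v\<close> may leave \<open>[0, 1]\<close> by a small \<open>\<epsilon>\<close>, and the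
  slack between \<open>M'\<close> and \<open>M\<close> pays for rescaling it back.\<close>

lemma property_P_at_of_strict_bound:
  fixes K :: "(complex^'n::finite) set"
  assumes v: "C_k_on 2 v UNIV" "\<And>z. z \<in> K \<Longrightarrow> 0 \<le> v z \<and> v z \<le> 1"
    and H: "\<And>z t. z \<in> K \<Longrightarrow> t \<in> sphere 0 1 \<Longrightarrow> M < Re (complex_hessian_form v z t t)"
    and M': "0 < M'" "M' < M"
  shows "property_P_at M' K"
proof -
  have "\<exists>r>0. \<forall>q\<in>cball p r. \<forall>t\<in>sphere 0 1. M < Re (complex_hessian_form v q t t)" if p: "p \<in> K" for p
    using form_bound_persists[OF open_UNIV v(1) UNIV_I H[OF p]] by metis
  then obtain r where r: "\<And>p. p \<in> K \<Longrightarrow> r p > 0"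
    "\<And>p q t. p \<in> K \<Longrightarrow> q \<in> cball p (r p) \<Longrightarrow> t \<in> sphere 0 1 \<Longrightarrow> M < Re (complex_hessian_form v q t t)" by metis
  \<comment> \<open>Mapping \<open>[-\<epsilon>, 1 + \<epsilon>]\<close> onto \<open>[0, 1]\<close> then multiplies Hessians by exactly \<open>M' / M\<close>.\<close>
  define \<epsilon> where "\<epsilon> = (M / M' - 1) / 2"
  have \<epsilon>: "\<epsilon> > 0" "1 + 2 * \<epsilon> = M / M'" using M' by (auto simp: \<epsilon>_def field_simps)
  define U where "U = {z. - \<epsilon> < v z} \<inter> {z. v z < 1 + \<epsilon>} \<inter> (\<Union>p\<in>K. ball p (r p))"
  define l where "l = (\<lambda>z. (M' / M) * (\<epsilon> + v z))"
  have vc: "continuous_on UNIV v" by (rule C_k_on_imp_continuous_on[OF v(1)])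
  show ?thesis unfolding property_P_at_def
  proof (intro exI conjI ballI allI)
    show "open U" unfolding U_def
      using vc by (intro open_Int open_Collect_less continuous_on_const) auto
    show "K \<subseteq> U" using v(2) r(1) \<epsilon>(1) by (force simp: U_def)
    show "C_k_on 2 l U" unfolding l_def
      by (rule C_k_on_subset[of _ _ UNIV]) (intro C_k_on_cmult C_k_on_add C_k_on_const v(1) open_UNIV, simp)
    show "0 \<le> l z" if "z \<in> U" for z using that M' by (auto simp: l_def U_def)
    show "l z \<le> 1" if "z \<in> U" for z
    proof -
      have "\<epsilon> + v z \<le> M / M'" using that \<epsilon>(2) by (auto simp: U_def)
      then have "(M' / M) * (\<epsilon> + v z) \<le> (M' / M) * (M / M')" using M' by (intro mult_left_mono) auto
      then show ?thesis using M' by (simp add: l_def)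
    qed
    show "M' * (norm w)\<^sup>2 \<le> Re (complex_hessian_form l z w w)" if z: "z \<in> U" for z w
    proof -
      obtain p where p: "p \<in> K" "z \<in> cball p (r p)" using z by (auto simp: U_def)
      have "complex_hessian_form l z t t = of_real (M' / M) * complex_hessian_form v z t t" for t
        unfolding l_def complex_hessian_form_cmult[OF open_UNIV C_k_on_add[OF open_UNIV C_k_on_const v(1)] UNIV_I]
          complex_hessian_form_add[OF open_UNIV C_k_on_const v(1) UNIV_I]
        by (simp add: complex_hessian_form_const)
      then have R: "Re (complex_hessian_form l z t t) = (M' / M) * Re (complex_hessian_form v z t t)" for t
        by (simp only: Re_complex_of_real times_complex.simps Im_complex_of_real mult_zero_left diff_zero)
      show ?thesis
      proof (rule form_bound_from_unit_sphere)
        fix t :: "complex^'n" assume t: "t \<in> sphere 0 1"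
        have "M' = (M' / M) * M" using M' by simp
        also have "\<dots> \<le> (M' / M) * Re (complex_hessian_form v z t t)"
          using r(2)[OF p t] M' by (intro mult_left_mono) auto
        finally show "M' \<le> Re (complex_hessian_form l z t t)" by (simp only: R)
      qed
    qed
  qed
qed

text \<open>The gluing step. Near \<open>L\<close> the given function \<open>l\<close> has a large Hessian; it is cut off to a global function
  \<open>\<theta> l\<close>, whose Hessian is spoiled away from \<open>L\<close>. At each such point of \<open>K\<close> some globalized null function is
  strictly plurisubharmonic, and these functions are nonnegative contributions at all points of \<open>K\<close>, so
  a large multiple of finitely many of them repairs the Hessian on \<open>K\<close> while the values on \<open>K\<close> are still
  those of \<open>\<theta> l\<close>.\<close>

lemma property_P_at_extend:
  fixes K :: "(complex^'n::finite) set"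
  assumes K: "compact K" "compact L" "L \<subseteq> K"
    and null: "\<And>p. p \<in> K - L \<Longrightarrow> strictly_psh_null K p"
    and P: "property_P_at M L" and M': "0 < M'" "M' < M"
  shows "property_P_at M' K"
proof -
  obtain U l where U: "open U" "L \<subseteq> U" "C_k_on 2 l U" "\<And>z. z \<in> U \<Longrightarrow> 0 \<le> l z \<and> l z \<le> 1"
    "\<And>z w. z \<in> U \<Longrightarrow> Re (complex_hessian_form l z w w) \<ge> M * (norm w)\<^sup>2"
    using P unfolding property_P_at_def by blast
  obtain \<theta> :: "complex^'n \<Rightarrow> real" and C W where \<theta>: "C_k_on 2 \<theta> UNIV" "\<And>x. 0 \<le> \<theta> x" "\<And>x. \<theta> x \<le> 1"
    "closed C" "C \<subseteq> U" "\<And>x. x \<notin> C \<Longrightarrow> \<theta> x = 0" "open W" "L \<subseteq> W" "\<And>x. x \<in> W \<Longrightarrow> \<theta> x = 1"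
    using C_2_cutoff[OF K(2) U(1,2)] by metis
  have WU: "W \<subseteq> U" using \<theta>(5,6,9) by fastforce
  define u where "u = (\<lambda>z. \<theta> z * l z)"
  have uC: "C_k_on 2 u UNIV" unfolding u_def
    by (rule C_k_on_mult_cutoff[OF U(1,3) \<theta>(1,4,5,6)])
  define M1 where "M1 = (M + M') / 2"
  have M1: "M' < M1" "M1 < M" using M' by (auto simp: M1_def)
  have "\<forall>p\<in>K - L. \<exists>\<Phi>. C_k_on 2 \<Phi> UNIV \<and> (\<forall>z\<in>K. \<Phi> z = 0) \<and>
      (\<forall>z\<in>K. \<forall>t. Re (complex_hessian_form \<Phi> z t t) \<ge> 0) \<and>
      (\<forall>t\<in>sphere 0 1. Re (complex_hessian_form \<Phi> p t t) > 0)"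
    using strictly_psh_null_globalize[OF null] by simp
  from bchoice[OF this] obtain \<Phi> where *: "\<forall>p\<in>K - L. C_k_on 2 (\<Phi> p) UNIV \<and> (\<forall>z\<in>K. \<Phi> p z = 0) \<and>
      (\<forall>z\<in>K. \<forall>t. Re (complex_hessian_form (\<Phi> p) z t t) \<ge> 0) \<and>
      (\<forall>t\<in>sphere 0 1. Re (complex_hessian_form (\<Phi> p) p t t) > 0)" by (rule exE)
  have \<Phi>: "p \<in> K - L \<Longrightarrow> C_k_on 2 (\<Phi> p) UNIV"
    "p \<in> K - L \<Longrightarrow> z \<in> K \<Longrightarrow> \<Phi> p z = 0"
    "p \<in> K - L \<Longrightarrow> z \<in> K \<Longrightarrow> Re (complex_hessian_form (\<Phi> p) z t t) \<ge> 0"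
    "p \<in> K - L \<Longrightarrow> t \<in> sphere 0 1 \<Longrightarrow> Re (complex_hessian_form (\<Phi> p) p t t) > 0" for p z t
    using * by simp_all
  define S where "S = K \<times> sphere (0::complex^'n) 1"
  have cont: "continuous_on S (\<lambda>x. Re (complex_hessian_form f (fst x) (snd x) (snd x)))"
    if "C_k_on 2 f UNIV" for f
    by (intro continuous_on_Re continuous_on_subset[OF continuous_on_complex_hessian_form[OF open_UNIV that]]) auto
  obtain J B where J: "finite J" "J \<subseteq> K - L" "B \<ge> 0"
    "\<forall>x\<in>S. Re (complex_hessian_form u (fst x) (snd x) (snd x)) - M1
      + B * (\<Sum>p\<in>J. Re (complex_hessian_form (\<Phi> p) (fst x) (snd x) (snd x))) > 0"
  proof (rule compact_positive_combination[of S "\<lambda>x. Re (complex_hessian_form u (fst x) (snd x) (snd x)) - M1" "K - L"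
      "\<lambda>p x. Re (complex_hessian_form (\<Phi> p) (fst x) (snd x) (snd x))"])
    show "compact S" unfolding S_def using K(1) by (intro compact_Times) auto
    show "continuous_on S (\<lambda>x. Re (complex_hessian_form u (fst x) (snd x) (snd x)) - M1)"
      by (intro continuous_on_diff cont uC continuous_on_const)
    show "continuous_on S (\<lambda>x. Re (complex_hessian_form (\<Phi> p) (fst x) (snd x) (snd x)))" if "p \<in> K - L" for p
      by (rule cont[OF \<Phi>(1)[OF that]])
    show "0 \<le> Re (complex_hessian_form (\<Phi> p) (fst x) (snd x) (snd x))" if "p \<in> K - L" "x \<in> S" for p x
      using \<Phi>(3) that by (auto simp: S_def)
    show "0 < Re (complex_hessian_form u (fst x) (snd x) (snd x)) - M1 \<or>
       (\<exists>p\<in>K - L. 0 < Re (complex_hessian_form (\<Phi> p) (fst x) (snd x) (snd x)))" if xS: "x \<in> S" for x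
    proof -
      obtain q t where x: "x = (q, t)" "q \<in> K" "t \<in> sphere 0 1" using xS by (auto simp: S_def)
      show ?thesis
      proof (cases "q \<in> W")
        case True
        have "complex_hessian_form u q t t = complex_hessian_form l q t t"
          by (rule complex_hessian_form_cong_open[OF \<theta>(7) True]) (simp add: u_def \<theta>(9))
        then show ?thesis using U(5)[of q t] True WU x M1 by auto
      next
        case False
        then have "q \<in> K - L" using x \<theta>(8) by blast
        then show ?thesis using \<Phi>(4) x by auto
      qed
    qed
  qed blast
  define v where "v = (\<lambda>z. u z + B * (\<Sum>p\<in>J. \<Phi> p z))"
  have sC: "C_k_on 2 (\<lambda>z. \<Sum>p\<in>J. \<Phi> p z) UNIV" using \<Phi>(1) J(2) by (intro C_k_on_sum) auto
  show ?thesis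
  proof (rule property_P_at_of_strict_bound[OF _ _ _ M'(1) M1(1)])
    show "C_k_on 2 v UNIV" unfolding v_def by (intro C_k_on_add C_k_on_cmult uC sC open_UNIV)
    show "0 \<le> v z \<and> v z \<le> 1" if "z \<in> K" for z
    proof -
      have "v z = \<theta> z * l z" using \<Phi>(2) J(2) that by (auto simp: v_def u_def intro!: sum.neutral)
      moreover have "0 \<le> \<theta> z * l z \<and> \<theta> z * l z \<le> 1"
      proof (cases "z \<in> U")
        case True
        then show ?thesis using U(4) \<theta>(2,3) by (simp add: mult_le_one)
      next
        case False
        then have "\<theta> z = 0" using \<theta>(5,6) by blast
        then show ?thesis by simp
      qed
      ultimately show ?thesis by simp
    qed
    show "M1 < Re (complex_hessian_form v z t t)" if "z \<in> K" "t \<in> sphere 0 1" for z t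
    proof -
      have "complex_hessian_form v z t t = complex_hessian_form u z t t
          + of_real B * (\<Sum>p\<in>J. complex_hessian_form (\<Phi> p) z t t)"
        unfolding v_def complex_hessian_form_add[OF open_UNIV uC C_k_on_cmult[OF open_UNIV sC] UNIV_I]
          complex_hessian_form_cmult[OF open_UNIV sC UNIV_I]
        using complex_hessian_form_sum[OF open_UNIV, of J \<Phi> z t t] \<Phi>(1) J(2) by (simp add: subset_iff)
      then have "Re (complex_hessian_form v z t t) = Re (complex_hessian_form u z t t)
          + B * (\<Sum>p\<in>J. Re (complex_hessian_form (\<Phi> p) z t t))" by simp
      then show ?thesis using J(4)[rule_format, of "(z, t)"] that by (simp add: S_def)
    qed
  qed
qed

section \<open>The boundary and its defining functions\<close>

lemma smooth_on_C_k_on: "smooth_on f S \<Longrightarrow> C_k_on k f S"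
  by (simp add: smooth_on_def)

lemma local_defining_functionD:
  assumes "local_defining_function \<Omega> p U \<rho>"
  shows "open U" "p \<in> U" "C_k_on k \<rho> U" "\<Omega> \<inter> U = {z \<in> U. \<rho> z < 0}"
    "z \<in> U \<Longrightarrow> \<exists>v. frechet_derivative \<rho> (at z) v \<noteq> 0"
    "z \<in> U \<Longrightarrow> \<rho> differentiable (at z)"
proof -
  show "open U" "p \<in> U" "C_k_on k \<rho> U" "\<Omega> \<inter> U = {z \<in> U. \<rho> z < 0}"
    "z \<in> U \<Longrightarrow> \<exists>v. frechet_derivative \<rho> (at z) v \<noteq> 0"
    using assms smooth_on_C_k_on unfolding local_defining_function_def by blast+
  have "C_k_on (Suc 0) \<rho> U" using assms smooth_on_C_k_on unfolding local_defining_function_def by blast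
  then show "z \<in> U \<Longrightarrow> \<rho> differentiable (at z)" by simp
qed

lemma local_defining_function_move:
  "local_defining_function \<Omega> p U \<rho> \<Longrightarrow> q \<in> U \<Longrightarrow> local_defining_function \<Omega> q U \<rho>"
  by (simp add: local_defining_function_def)

lemma directional_derivative:
  assumes "f differentiable (at q)"
  shows "((\<lambda>t. f (q + t *\<^sub>R v)) has_real_derivative frechet_derivative f (at q) v) (at 0)"
proof -
  have "((\<lambda>t. q + t *\<^sub>R v) has_derivative (\<lambda>t. t *\<^sub>R v)) (at (0::real))"
    by (auto intro!: derivative_eq_intros)
  moreover have "(f has_derivative frechet_derivative f (at q)) (at (q + 0 *\<^sub>R v))"
    using assms by (simp add: frechet_derivative_works)
  ultimately have "((\<lambda>t. f (q + t *\<^sub>R v)) has_derivative (\<lambda>t. frechet_derivative f (at q) (t *\<^sub>R v))) (at 0)"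
    by (rule has_derivative_compose)
  then show ?thesis
    unfolding has_field_derivative_def
    by (rule has_derivative_eq_rhs)
       (simp add: fun_eq_iff linear_scale[OF linear_frechet_derivative[OF assms]] mult.commute)
qed

text \<open>A point where \<open>\<rho>\<close> vanishes is a limit of points of \<open>\<Omega>\<close>, since \<open>\<rho>\<close> decreases strictly in some direction.\<close>

lemma frontier_iff_defining_function_zero:
  assumes "open \<Omega>" and ldf: "local_defining_function \<Omega> p U \<rho>" and "q \<in> U"
  shows "q \<in> frontier \<Omega> \<longleftrightarrow> \<rho> q = 0"
proof
  note U = local_defining_functionD[OF ldf]
  have cont: "continuous_on U \<rho>" using U(3)[of 0] by simp
  assume q: "q \<in> frontier \<Omega>"
  then have "q \<notin> \<Omega>" using assms(1) by (simp add: frontier_def interior_open)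
  then have "\<rho> q \<ge> 0" using U(4) assms(3) by (metis (mono_tags, lifting) IntD1 mem_Collect_eq not_le)
  moreover have "\<not> \<rho> q > 0"
  proof
    assume pos: "\<rho> q > 0"
    define P where "P = U \<inter> \<rho> -` {0<..}"
    have "open P" unfolding P_def using cont U(1) by (intro continuous_open_preimage) auto
    moreover have "q \<in> P" using pos assms(3) by (simp add: P_def)
    moreover have "q \<in> closure \<Omega>" using q by (simp add: frontier_def)
    ultimately have "\<Omega> \<inter> P \<noteq> {}" using open_Int_closure_eq_empty by blast
    then obtain z where "z \<in> \<Omega> \<inter> U" "\<rho> z > 0" unfolding P_def by auto
    then show False unfolding U(4) by simp
  qed
  ultimately show "\<rho> q = 0" by simp
next
  note U = local_defining_functionD[OF ldf]
  assume zero: "\<rho> q = 0"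
  have "q \<notin> \<Omega>" using U(4) assms(3) zero by (metis (mono_tags, lifting) IntI mem_Collect_eq less_irrefl)
  moreover have "q \<in> closure \<Omega>"
  proof -
    obtain v0 where v0: "frechet_derivative \<rho> (at q) v0 \<noteq> 0" using U(5)[OF assms(3)] by blast
    note lin = linear_frechet_derivative[OF U(6)[OF assms(3)]]
    obtain v where v: "frechet_derivative \<rho> (at q) v < 0"
    proof (cases "frechet_derivative \<rho> (at q) v0 < 0")
      case False
      then have "frechet_derivative \<rho> (at q) (- v0) < 0" using v0 linear_neg[OF lin] by simp
      then show ?thesis using that by blast
    qed (use that in blast)
    obtain d where d: "d > 0" "\<And>h. h > 0 \<Longrightarrow> h < d \<Longrightarrow> \<rho> (q + h *\<^sub>R v) < 0"
      using DERIV_neg_dec_right[OF directional_derivative[OF U(6)[OF assms(3)]] v] zero by auto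
    have "((\<lambda>h. q + h *\<^sub>R v) \<longlongrightarrow> q + 0 *\<^sub>R v) (at_right 0)" by (intro tendsto_intros)
    then have lim: "((\<lambda>h. q + h *\<^sub>R v) \<longlongrightarrow> q) (at_right 0)" by simp
    have "\<forall>\<^sub>F h in at_right 0. q + h *\<^sub>R v \<in> U" using lim U(1) assms(3) by (rule topological_tendstoD)
    moreover have "\<forall>\<^sub>F h in at_right 0. \<rho> (q + h *\<^sub>R v) < 0"
      using d by (auto simp: eventually_at_right_field intro!: exI[of _ d])
    ultimately have "\<forall>\<^sub>F h in at_right 0. q + h *\<^sub>R v \<in> \<Omega>"
    proof eventually_elim
      case (elim h)
      then have "q + h *\<^sub>R v \<in> {z \<in> U. \<rho> z < 0}" by simp
      then show ?case unfolding U(4)[symmetric] by simp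
    qed
    then have "\<forall>\<^sub>F h in at_right 0. q + h *\<^sub>R v \<in> closure \<Omega>"
      by eventually_elim (use closure_subset in blast)
    then show ?thesis using lim by (intro Lim_in_closed_set[OF closed_closure]) auto
  qed
  ultimately show "q \<in> frontier \<Omega>" using assms(1) by (simp add: frontier_def interior_open)
qed

text \<open>For small \<open>e\<close> and much smaller \<open>t\<close>, \<open>\<rho>\<close> has opposite signs at \<open>q + t (v + e w)\<close> and \<open>q + t (v - e w)\<close>, so the
  intermediate value theorem gives a zero of \<open>\<rho>\<close> at \<open>q + t (v + s w)\<close> with \<open>|s| \<le> e\<close>. As \<open>G\<close> vanishes there,
  \<open>D v\<close> is of order \<open>e\<close>. This replaces a curve in the boundary with velocity \<open>v\<close>.\<close>

lemma derivative_vanishes_on_tangent: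
  fixes G :: "'a::real_normed_vector \<Rightarrow> 'b::real_normed_vector" and \<rho> :: "'a \<Rightarrow> real"
  assumes U: "open U" "q \<in> U" "continuous_on U \<rho>" "\<rho> differentiable (at q)" "\<rho> q = 0"
    and w: "frechet_derivative \<rho> (at q) w > 0"
    and G: "(G has_derivative D) (at q)" "\<And>z. z \<in> U \<Longrightarrow> \<rho> z = 0 \<Longrightarrow> G z = 0"
    and v: "frechet_derivative \<rho> (at q) v = 0"
  shows "D v = 0"
proof -
  note lin\<rho> = linear_frechet_derivative[OF U(4)]
  have linD: "linear D" using G(1) by (rule has_derivative_linear)
  define B where "B = norm v + norm w + norm (D w) + 1"
  have B: "B > 0" by (auto simp: B_def intro!: add_nonneg_pos)
  have "norm (D v) \<le> e * B" if e: "0 < e" "e < 1" for e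
  proof -
    have "frechet_derivative \<rho> (at q) (v + e *\<^sub>R w) > 0" "frechet_derivative \<rho> (at q) (v - e *\<^sub>R w) < 0"
      using e w v by (simp_all add: linear_add[OF lin\<rho>] linear_diff[OF lin\<rho>] linear_scale[OF lin\<rho>])
    note dir = DERIV_pos_inc_right[OF directional_derivative[OF U(4)] this(1)]
      DERIV_neg_dec_right[OF directional_derivative[OF U(4)] this(2)]
    obtain d1 where d1: "d1 > 0" "\<And>t. t > 0 \<Longrightarrow> t < d1 \<Longrightarrow> \<rho> (q + t *\<^sub>R (v + e *\<^sub>R w)) > 0"
      using dir(1) U(5) by auto
    obtain d2 where d2: "d2 > 0" "\<And>t. t > 0 \<Longrightarrow> t < d2 \<Longrightarrow> \<rho> (q + t *\<^sub>R (v - e *\<^sub>R w)) < 0"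
      using dir(2) U(5) by auto
    obtain d3 where d3: "d3 > 0" "ball q d3 \<subseteq> U" using U(1,2) open_contains_ball by blast
    obtain d4 where d4: "d4 > 0" "\<And>y. norm (y - q) < d4 \<Longrightarrow> norm (G y - G q - D (y - q)) \<le> e * norm (y - q)"
      using G(1) e(1) unfolding has_derivative_at_alt by blast
    define m where "m = min (min d1 d2) (min d3 d4)"
    have m: "m > 0" using d1(1) d2(1) d3(1) d4(1) by (simp add: m_def)
    define t where "t = m / (2 * B)"
    have t: "t > 0" using m B by (simp add: t_def)
    have tB: "t * B < m" using m B by (simp add: t_def)
    have "1 \<le> B" by (simp add: B_def)
    then have "t \<le> t * B" using t by simp
    then have tm: "t < m" using tB by simp
    have small: "norm (t *\<^sub>R (v + s *\<^sub>R w)) < m" if "\<bar>s\<bar> \<le> e" for s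
    proof -
      have "norm (v + s *\<^sub>R w) \<le> norm v + \<bar>s\<bar> * norm w"
        using norm_triangle_ineq[of v "s *\<^sub>R w"] by simp
      also have "\<dots> \<le> norm v + 1 * norm w" using that e by (intro add_left_mono mult_right_mono) auto
      also have "\<dots> \<le> B" by (simp add: B_def)
      finally have "t * norm (v + s *\<^sub>R w) \<le> t * B" using t by (intro mult_left_mono) auto
      then have "t * norm (v + s *\<^sub>R w) < m" using tB by linarith
      then show ?thesis using t by simp
    qed
    have inU: "q + t *\<^sub>R (v + s *\<^sub>R w) \<in> U" if "\<bar>s\<bar> \<le> e" for s
      using small[OF that] d3(2) by (auto simp: m_def dist_norm subset_iff)
    have "continuous_on {-e..e} (\<lambda>s. \<rho> (q + t *\<^sub>R (v + s *\<^sub>R w)))"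
      by (rule continuous_on_compose2[OF U(3)]) (use inU in \<open>auto intro!: continuous_intros\<close>)
    moreover have "\<rho> (q + t *\<^sub>R (v + (- e) *\<^sub>R w)) \<le> 0" using d2(2)[of t] t tm by (simp add: m_def)
    moreover have "0 \<le> \<rho> (q + t *\<^sub>R (v + e *\<^sub>R w))" using d1(2)[of t] t tm by (simp add: m_def)
    ultimately obtain s where s: "-e \<le> s" "s \<le> e" "\<rho> (q + t *\<^sub>R (v + s *\<^sub>R w)) = 0"
      using IVT'[of "\<lambda>s. \<rho> (q + t *\<^sub>R (v + s *\<^sub>R w))" "-e" 0 e] e by auto
    then have se: "\<bar>s\<bar> \<le> e" by auto
    have "G (q + t *\<^sub>R (v + s *\<^sub>R w)) = 0" "G q = 0" using G(2) inU[OF se] s(3) U(2,5) by auto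
    then have "norm (D (t *\<^sub>R (v + s *\<^sub>R w))) \<le> e * norm (t *\<^sub>R (v + s *\<^sub>R w))"
      using d4(2)[of "q + t *\<^sub>R (v + s *\<^sub>R w)"] small[OF se] by (simp add: m_def)
    then have "t * norm (D (v + s *\<^sub>R w)) \<le> t * (e * norm (v + s *\<^sub>R w))"
      using t by (simp add: linear_scale[OF linD] mult_ac)
    then have 1: "norm (D (v + s *\<^sub>R w)) \<le> e * norm (v + s *\<^sub>R w)" using t by simp
    have "norm (v + s *\<^sub>R w) \<le> norm v + \<bar>s\<bar> * norm w" using norm_triangle_ineq[of v "s *\<^sub>R w"] by simp
    also have "\<dots> \<le> norm v + 1 * norm w" using se e by (intro add_left_mono mult_right_mono) auto
    finally have 2: "e * norm (v + s *\<^sub>R w) \<le> e * (norm v + norm w)" using e by simp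
    have "D v = D (v + s *\<^sub>R w) - s *\<^sub>R D w" by (simp add: linear_add[OF linD] linear_scale[OF linD])
    then have "norm (D v) \<le> norm (D (v + s *\<^sub>R w)) + \<bar>s\<bar> * norm (D w)"
      using norm_triangle_ineq4[of "D (v + s *\<^sub>R w)" "s *\<^sub>R D w"] by simp
    also have "\<dots> \<le> e * (norm v + norm w) + e * norm (D w)"
      using 1 2 se by (intro add_mono mult_right_mono) auto
    also have "\<dots> \<le> e * B" using e by (simp add: B_def algebra_simps)
    finally show ?thesis .
  qed
  then have *: "norm (D v) \<le> e * B" if "0 < e" "e < 1" for e using that by blast
  have "norm (D v) \<le> 0"
  proof (rule field_le_epsilon)
    fix \<epsilon> :: real assume \<epsilon>: "\<epsilon> > 0"
    have "min (\<epsilon> / B) (1 / 2) * B \<le> (\<epsilon> / B) * B" using B by (intro mult_right_mono) auto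
    moreover have "min (\<epsilon> / B) (1 / 2) < 1" by (simp add: min_less_iff_disj)
    ultimately show "norm (D v) \<le> 0 + \<epsilon>" using *[of "min (\<epsilon> / B) (1 / 2)"] \<epsilon> B by simp
  qed
  then show ?thesis by simp
qed

lemma derivative_vanishes_on_boundary_tangent:
  fixes G :: "complex^'n::finite \<Rightarrow> 'b::real_normed_vector"
  assumes ldf: "local_defining_function \<Omega> p U \<rho>" and q: "q \<in> U" "\<rho> q = 0"
    and V: "open V" "q \<in> V" and G: "(G has_derivative D) (at q)" "\<And>z. z \<in> U \<inter> V \<Longrightarrow> \<rho> z = 0 \<Longrightarrow> G z = 0"
    and v: "frechet_derivative \<rho> (at q) v = 0"
  shows "D v = 0"
proof -
  note U = local_defining_functionD[OF ldf]
  obtain w0 where w0: "frechet_derivative \<rho> (at q) w0 \<noteq> 0" using U(5)[OF q(1)] by blast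
  have "\<exists>w. frechet_derivative \<rho> (at q) w > 0"
  proof (cases "frechet_derivative \<rho> (at q) w0 > 0")
    case False
    then have "frechet_derivative \<rho> (at q) (- w0) > 0"
      using w0 linear_neg[OF linear_frechet_derivative[OF U(6)[OF q(1)]]] by simp
    then show ?thesis by blast
  qed blast
  then obtain w where w: "frechet_derivative \<rho> (at q) w > 0" by blast
  have "continuous_on (U \<inter> V) \<rho>" using C_k_on_imp_continuous_on[OF U(3)] continuous_on_subset by blast
  then show ?thesis
    using derivative_vanishes_on_tangent[of "U \<inter> V" q \<rho> w G D v] U(1,6) q V w G v by auto
qed

text \<open>Each of the two defining functions vanishes where the other one does, so their differentials at a
  boundary point have the same kernel.\<close>

lemma defining_function_derivatives_proportional:
  fixes \<Omega> :: "(complex^'n::finite) set"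
  assumes "open \<Omega>" and 1: "local_defining_function \<Omega> p U1 \<rho>1" and 2: "local_defining_function \<Omega> p' U2 \<rho>2"
    and q: "q \<in> U1" "q \<in> U2" "q \<in> frontier \<Omega>"
  obtains h where "h \<noteq> 0" "\<forall>v. frechet_derivative \<rho>2 (at q) v = h * frechet_derivative \<rho>1 (at q) v"
proof -
  note U1 = local_defining_functionD[OF 1] and U2 = local_defining_functionD[OF 2]
  have \<rho>1q: "\<rho>1 q = 0" using frontier_iff_defining_function_zero[OF assms(1) 1 q(1)] q(3) by simp
  have 3: "(\<rho>2 has_derivative frechet_derivative \<rho>2 (at q)) (at q)"
    using U2(6)[OF q(2)] by (simp add: frechet_derivative_works)
  have 4: "\<rho>2 z = 0" if "z \<in> U1 \<inter> U2" "\<rho>1 z = 0" for z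
    using that frontier_iff_defining_function_zero[OF assms(1) 1] frontier_iff_defining_function_zero[OF assms(1) 2] by auto
  have ker: "frechet_derivative \<rho>2 (at q) v = 0" if "frechet_derivative \<rho>1 (at q) v = 0" for v
    by (rule derivative_vanishes_on_boundary_tangent[OF 1 q(1) \<rho>1q U2(1) q(2) 3 4 that])
  note lin1 = linear_frechet_derivative[OF U1(6)[OF q(1)]] and lin2 = linear_frechet_derivative[OF U2(6)[OF q(2)]]
  obtain w where w: "frechet_derivative \<rho>1 (at q) w \<noteq> 0" using U1(5)[OF q(1)] by blast
  define h where "h = frechet_derivative \<rho>2 (at q) w / frechet_derivative \<rho>1 (at q) w"
  have h: "frechet_derivative \<rho>2 (at q) v = h * frechet_derivative \<rho>1 (at q) v" for v
  proof -
    define c where "c = frechet_derivative \<rho>1 (at q) v / frechet_derivative \<rho>1 (at q) w"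
    have "frechet_derivative \<rho>1 (at q) (v - c *\<^sub>R w) = 0"
      using w by (simp add: linear_diff[OF lin1] linear_scale[OF lin1] c_def)
    from ker[OF this] show ?thesis
      by (simp add: linear_diff[OF lin2] linear_scale[OF lin2] c_def h_def)
  qed
  have "h \<noteq> 0" using h U2(5)[OF q(2)] by auto
  then show thesis by (rule that) (simp add: h)
qed

lemma tangential_coeffs_independent:
  assumes "open \<Omega>" "p \<in> frontier \<Omega>" and 1: "local_defining_function \<Omega> p U1 \<rho>1" and 2: "local_defining_function \<Omega> p U2 \<rho>2"
  shows "tangential_coeffs \<rho>1 p = tangential_coeffs \<rho>2 p"
proof -
  note U1 = local_defining_functionD[OF 1] and U2 = local_defining_functionD[OF 2]
  obtain h where "h \<noteq> 0" "\<forall>v. frechet_derivative \<rho>2 (at p) v = h * frechet_derivative \<rho>1 (at p) v"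
    using defining_function_derivatives_proportional[OF assms(1) 1 2 U1(2) U2(2) assms(2)] .
  then show ?thesis
    by (simp add: set_eq_iff tangential_coeffs_iff complex_differential_eq_0_iff U1(6)[OF U1(2)] U2(6)[OF U2(2)])
qed

text \<open>For a fixed direction \<open>w\<close> transversal at \<open>p\<close>, put \<open>\<alpha>\<^sub>i = d\<rho>\<^sub>i(w)\<close> and \<open>\<sigma> = \<alpha>\<^sub>1 \<rho>\<^sub>2 - \<alpha>\<^sub>2 \<rho>\<^sub>1\<close>. Since \<open>d\<rho>\<^sub>2 = h d\<rho>\<^sub>1\<close> on the
  boundary, \<open>d\<sigma>\<close> vanishes along the whole boundary near \<open>p\<close>, and differentiating once more in tangential
  directions shows that the form of \<open>\<sigma>\<close> vanishes on tangential vectors. By the product rule this says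
  that \<open>\<alpha>\<^sub>1\<close> times the form of \<open>\<rho>\<^sub>2\<close> equals \<open>\<alpha>\<^sub>2\<close> times the form of \<open>\<rho>\<^sub>1\<close>. Working with \<open>\<sigma>\<close> avoids dividing \<open>\<rho>\<^sub>2\<close> by \<open>\<rho>\<^sub>1\<close>.\<close>

lemma levi_form_proportional:
  fixes \<Omega> :: "(complex^'n::finite) set"
  assumes \<Omega>: "open \<Omega>" and p: "p \<in> frontier \<Omega>"
    and 1: "local_defining_function \<Omega> p U1 \<rho>1" and 2: "local_defining_function \<Omega> p U2 \<rho>2"
  obtains h :: complex where "h \<noteq> 0" "\<forall>a\<in>tangential_coeffs \<rho>1 p. \<forall>b\<in>tangential_coeffs \<rho>1 p.
    complex_hessian_form \<rho>2 p a b = h * complex_hessian_form \<rho>1 p a b"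
proof -
  note U1 = local_defining_functionD[OF 1] and U2 = local_defining_functionD[OF 2]
  define U where "U = U1 \<inter> U2"
  have U: "open U" "p \<in> U" "U \<subseteq> U1" "U \<subseteq> U2" using U1 U2 by (auto simp: U_def)
  obtain w where w: "frechet_derivative \<rho>1 (at p) w \<noteq> 0" using U1(5)[OF U1(2)] by blast
  define \<alpha>1 where "\<alpha>1 = (\<lambda>z. frechet_derivative \<rho>1 (at z) w)"
  define \<alpha>2 where "\<alpha>2 = (\<lambda>z. frechet_derivative \<rho>2 (at z) w)"
  define \<sigma> where "\<sigma> = (\<lambda>z. \<alpha>1 z * \<rho>2 z + (-1) * (\<alpha>2 z * \<rho>1 z))"
  have C: "C_k_on 2 \<rho>1 U" "C_k_on 2 \<rho>2 U" "C_k_on 2 \<alpha>1 U" "C_k_on 2 \<alpha>2 U"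
    using C_k_on_subset[OF U1(3) U(3)] C_k_on_subset[OF U2(3) U(4)]
      C_k_on_subset[OF U1(3)[of "Suc 2"] U(3)] C_k_on_subset[OF U2(3)[of "Suc 2"] U(4)]
    unfolding \<alpha>1_def \<alpha>2_def C_k_on.simps(2) by blast+
  note CM = C_k_on_mult[OF U(1) C(3,2)] C_k_on_mult[OF U(1) C(4,1)]
  have \<sigma>C: "C_k_on 2 \<sigma> U" unfolding \<sigma>_def by (intro C_k_on_add C_k_on_cmult CM U(1))
  have zero: "\<rho>1 z = 0 \<and> \<rho>2 z = 0 \<and> z \<in> frontier \<Omega>" if "z \<in> U" "\<rho>1 z = 0" for z
    using frontier_iff_defining_function_zero[OF \<Omega> 1] frontier_iff_defining_function_zero[OF \<Omega> 2] that U(3,4) by blast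
  have \<sigma>0: "frechet_derivative \<sigma> (at z) v = 0" if z: "z \<in> U" "\<rho>1 z = 0" for z v
  proof -
    note d = C_2_differentiable(1)[OF U(1) C(1) z(1)] C_2_differentiable(1)[OF U(1) C(2) z(1)]
      C_2_differentiable(1)[OF U(1) C(3) z(1)] C_2_differentiable(1)[OF U(1) C(4) z(1)]
    obtain h where h: "\<forall>v. frechet_derivative \<rho>2 (at z) v = h * frechet_derivative \<rho>1 (at z) v"
      using defining_function_derivatives_proportional[OF \<Omega> 1 2, of z] z U(3,4) zero[OF z] by blast
    have "(\<sigma> has_derivative (\<lambda>v. \<alpha>1 z * frechet_derivative \<rho>2 (at z) v - \<alpha>2 z * frechet_derivative \<rho>1 (at z) v)) (at z)"
      unfolding \<sigma>_def using d[unfolded frechet_derivative_works] zero[OF z]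
      by (auto intro!: derivative_eq_intros)
    from frechet_derivative_at[OF this, symmetric] show ?thesis
      using h by (simp add: \<alpha>1_def \<alpha>2_def)
  qed
  have p0: "\<rho>1 p = 0" "\<rho>2 p = 0"
    using frontier_iff_defining_function_zero[OF \<Omega> 1 U1(2)] frontier_iff_defining_function_zero[OF \<Omega> 2 U2(2)] p by auto
  obtain h where h: "h \<noteq> 0" "\<forall>v. frechet_derivative \<rho>2 (at p) v = h * frechet_derivative \<rho>1 (at p) v"
    using defining_function_derivatives_proportional[OF \<Omega> 1 2 U1(2) U2(2) p] .
  have "complex_hessian_form \<rho>2 p a b = h * complex_hessian_form \<rho>1 p a b"
    if a: "a \<in> tangential_coeffs \<rho>1 p" and b: "b \<in> tangential_coeffs \<rho>1 p" for a b
  proof -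
    have t1: "complex_differential \<rho>1 p a = 0" "complex_differential \<rho>1 p b = 0"
      using a b by (auto simp: tangential_coeffs_iff)
    have t2: "complex_differential \<rho>2 p a = 0" "complex_differential \<rho>2 p b = 0"
      using a b tangential_coeffs_independent[OF \<Omega> p 1 2] by (auto simp: tangential_coeffs_iff)
    have "(\<Sum>j\<in>UNIV. wirtinger j (wirtinger_bar k (\<lambda>x. complex_of_real (\<sigma> x))) p * a $ j) = 0" for k
    proof -
      define G where "G = wirtinger_bar k (\<lambda>x. complex_of_real (\<sigma> x))"
      have dG: "G differentiable at p" unfolding G_def by (rule C_2_differentiable(4)[OF U(1) \<sigma>C U(2)])
      have G0: "G z = 0" if "z \<in> U1 \<inter> U" "\<rho>1 z = 0" for z
        using that \<sigma>0[of z] C_2_differentiable(1)[OF U(1) \<sigma>C] by (simp add: G_def wirtinger_of_real)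
      have "frechet_derivative G (at p) v = 0" if "frechet_derivative \<rho>1 (at p) v = 0" for v
        using derivative_vanishes_on_boundary_tangent[OF 1 U1(2) p0(1) U(1,2) _ G0 that] dG
        by (simp add: frechet_derivative_works)
      then show ?thesis
        using wirtinger_sum[OF dG, of a] t1(1)[unfolded complex_differential_eq_0_iff[OF U1(6)[OF U1(2)]]]
        by (simp add: G_def)
    qed
    then have "0 = (\<Sum>k\<in>UNIV. (\<Sum>j\<in>UNIV. wirtinger j (wirtinger_bar k (\<lambda>x. complex_of_real (\<sigma> x))) p * a $ j) * cnj (b $ k))"
      by simp
    also have "\<dots> = complex_hessian_form \<sigma> p a b"
      unfolding complex_hessian_form_def sum_distrib_right by (rule sum.swap)
    also have "\<dots> = \<alpha>1 p * complex_hessian_form \<rho>2 p a b - \<alpha>2 p * complex_hessian_form \<rho>1 p a b"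
      unfolding \<sigma>_def complex_hessian_form_add[OF U(1) CM(1) C_k_on_cmult[OF U(1) CM(2)] U(2)]
        complex_hessian_form_cmult[OF U(1) CM(2) U(2)]
        complex_hessian_form_mult[OF U(1) C(3,2) U(2)] complex_hessian_form_mult[OF U(1) C(4,1) U(2)]
      by (simp add: t1 t2 p0)
    finally have "complex_of_real (\<alpha>1 p) * complex_hessian_form \<rho>2 p a b
        = complex_of_real (\<alpha>1 p) * (h * complex_hessian_form \<rho>1 p a b)"
      using h(2) by (simp add: \<alpha>1_def \<alpha>2_def mult_ac)
    then show ?thesis using w by (simp add: \<alpha>1_def)
  qed
  then show thesis by (intro that[of "complex_of_real h"]) (simp_all add: h(1))
qed

section \<open>The Levi null distribution\<close>

lemma vec10_coefficients: "a = 2 *\<^sub>R fst (vec10 a)"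
  by (simp add: vec10_eq)

text \<open>Independence of the defining function gives one direction. Conversely, by pseudoconvexity the
  form is semidefinite on tangential vectors, so a vector on which it vanishes lies in its kernel. In
  contrast to the definition, the right-hand side is a closed condition in \<open>(p, a)\<close>.\<close>

lemma levi_null_iff:
  fixes \<Omega> :: "(complex^'n::finite) set"
  assumes \<Omega>: "open \<Omega>" "levi_pseudoconvex \<Omega>" and p: "p \<in> frontier \<Omega>"
    and ldf: "local_defining_function \<Omega> p U \<rho>"
  shows "vec10 a \<in> levi_null \<Omega> p \<longleftrightarrow>
    complex_differential \<rho> p a = 0 \<and> Re (complex_hessian_form \<rho> p a a) = 0"
proof
  assume "vec10 a \<in> levi_null \<Omega> p"
  then obtain a' V \<tau> where a': "vec10 a = vec10 a'" and \<tau>: "local_defining_function \<Omega> p V \<tau>"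
    "a' \<in> tangential_coeffs \<tau> p" "\<forall>b\<in>tangential_coeffs \<tau> p. complex_hessian_form \<tau> p a' b = 0"
    using p unfolding levi_null_def by auto
  have [simp]: "a' = a" using vec10_coefficients[of a] vec10_coefficients[of a'] a' by simp
  have a: "a \<in> tangential_coeffs \<rho> p"
    using \<tau>(2) tangential_coeffs_independent[OF \<Omega>(1) p \<tau>(1) ldf] by simp
  obtain h where h: "h \<noteq> 0" "\<forall>a\<in>tangential_coeffs \<rho> p. \<forall>b\<in>tangential_coeffs \<rho> p.
      complex_hessian_form \<tau> p a b = h * complex_hessian_form \<rho> p a b"
    using levi_form_proportional[OF \<Omega>(1) p ldf \<tau>(1)] .
  have "h * complex_hessian_form \<rho> p a a = complex_hessian_form \<tau> p a a" using h(2) a by simp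
  also have "\<dots> = 0" using \<tau>(2,3) by simp
  finally have "h * complex_hessian_form \<rho> p a a = 0" .
  then show "complex_differential \<rho> p a = 0 \<and> Re (complex_hessian_form \<rho> p a a) = 0"
    using h(1) a by (simp add: tangential_coeffs_iff)
next
  note U = local_defining_functionD[OF ldf]
  assume a: "complex_differential \<rho> p a = 0 \<and> Re (complex_hessian_form \<rho> p a a) = 0"
  have "complex_hessian_form \<rho> p a b = 0" if "b \<in> tangential_coeffs \<rho> p" for b
  proof (rule null_vector_of_semidefinite[OF U(1,3,2), where W="tangential_coeffs \<rho> p"])
    show "0 \<le> Re (complex_hessian_form \<rho> p a a)" if "a \<in> tangential_coeffs \<rho> p" for a
      using \<Omega>(2) p ldf that unfolding levi_pseudoconvex_def by blast
  qed (use a that in \<open>auto simp: tangential_coeffs_iff complex_differential_lin\<close>)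
  moreover have "a \<in> tangential_coeffs \<rho> p" using a by (simp add: tangential_coeffs_iff)
  ultimately show "vec10 a \<in> levi_null \<Omega> p"
    using p ldf unfolding levi_null_def by auto
qed

lemma levi_null_eq_vec10: "X \<in> levi_null \<Omega> p \<Longrightarrow> X = vec10 (2 *\<^sub>R fst X)"
  unfolding levi_null_def by (auto simp flip: vec10_coefficients split: if_splits)

definition total_space :: "(complex^'n::finite) set \<Rightarrow> 'n distr \<Rightarrow> ((complex^'n) \<times> 'n ctvec) set" where
  "total_space \<Omega> D = {(p, X). p \<in> frontier \<Omega> \<and> X \<in> D p}"

lemma continuous_vec10: "continuous_on UNIV (vec10 :: complex^'n::finite \<Rightarrow> _)"
proof -
  have "continuous_on UNIV (\<lambda>a::complex^'n. \<i> *s a)"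
    unfolding vector_scalar_mult_def by (intro continuous_intros)
  then show ?thesis unfolding vec10_eq[abs_def] by (intro continuous_intros)
qed

text \<open>Near a limit point a single defining function may be used for all points of the sequence, and the
  two equations of \<open>levi_null_iff\<close> pass to the limit.\<close>

lemma closed_total_space_levi_null:
  fixes \<Omega> :: "(complex^'n::finite) set"
  assumes \<Omega>: "smooth_bounded_domain \<Omega>" "levi_pseudoconvex \<Omega>"
  shows "closed (total_space \<Omega> (levi_null \<Omega>))"
  unfolding closed_sequential_limits
proof (intro allI impI)
  fix x :: "nat \<Rightarrow> (complex^'n) \<times> 'n ctvec" and l
  assume "(\<forall>n. x n \<in> total_space \<Omega> (levi_null \<Omega>)) \<and> x \<longlonglongrightarrow> l"
  then have x: "\<And>n. fst (x n) \<in> frontier \<Omega>" "\<And>n. snd (x n) \<in> levi_null \<Omega> (fst (x n))" and lim: "x \<longlonglongrightarrow> l"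
    by (auto simp: total_space_def case_prod_unfold)
  have op: "open \<Omega>" using \<Omega>(1) by (simp add: smooth_bounded_domain_def)
  define p where "p = fst l"
  define a where "a = (\<lambda>n. 2 *\<^sub>R fst (snd (x n)))"
  define b where "b = 2 *\<^sub>R fst (snd l)"
  have limp: "(\<lambda>n. fst (x n)) \<longlonglongrightarrow> p" unfolding p_def by (intro tendsto_intros lim)
  have lima: "a \<longlonglongrightarrow> b" unfolding a_def b_def by (intro tendsto_intros lim)
  have p: "p \<in> frontier \<Omega>" using closed_sequentially[OF frontier_closed x(1) limp] .
  obtain U \<rho> where ldf: "local_defining_function \<Omega> p U \<rho>"
    using \<Omega>(1) p unfolding smooth_bounded_domain_def by blast
  note U = local_defining_functionD[OF ldf]
  have ev: "\<forall>\<^sub>F n in sequentially. fst (x n) \<in> U" using limp U(1,2) by (rule topological_tendstoD)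
  have xa: "snd (x n) = vec10 (a n)" for n unfolding a_def by (rule levi_null_eq_vec10[OF x(2)])
  have null: "\<forall>\<^sub>F n in sequentially. complex_differential \<rho> (fst (x n)) (a n) = 0 \<and>
      Re (complex_hessian_form \<rho> (fst (x n)) (a n) (a n)) = 0"
    using ev
  proof eventually_elim
    case (elim n)
    then show ?case
      using levi_null_iff[OF op \<Omega>(2) x(1) local_defining_function_move[OF ldf elim], of "a n"] x(2)[of n] xa[of n] by simp
  qed
  have limpair: "(\<lambda>n. (fst (x n), a n)) \<longlonglongrightarrow> (p, b)" by (intro tendsto_Pair limp lima)
  have open': "open (U \<times> (UNIV :: (complex^'n) set))" using U(1) by (intro open_Times) auto
  have at: "isCont f (p, b)" if "continuous_on (U \<times> UNIV) f" for f :: "_ \<Rightarrow> complex"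
    using that U(2) by (simp add: continuous_on_eq_continuous_at[OF open'])
  have "(\<lambda>n. complex_differential \<rho> (fst (x n)) (a n)) \<longlonglongrightarrow> complex_differential \<rho> p b"
    using isCont_tendsto_compose[OF at[OF continuous_on_complex_differential[OF U(1,3)]] limpair] by simp
  moreover have "(\<lambda>n. complex_differential \<rho> (fst (x n)) (a n)) \<longlonglongrightarrow> 0"
    by (rule tendsto_eventually) (use null in eventually_elim, simp)
  ultimately have 1: "complex_differential \<rho> p b = 0" by (rule LIMSEQ_unique)
  have "(\<lambda>n. Re (complex_hessian_form \<rho> (fst (x n)) (a n) (a n))) \<longlonglongrightarrow> Re (complex_hessian_form \<rho> p b b)"
    using tendsto_Re[OF isCont_tendsto_compose[OF at[OF continuous_on_complex_hessian_form[OF U(1,3)]] limpair]] by simp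
  moreover have "(\<lambda>n. Re (complex_hessian_form \<rho> (fst (x n)) (a n) (a n))) \<longlonglongrightarrow> 0"
    by (rule tendsto_eventually) (use null in eventually_elim, simp)
  ultimately have 2: "Re (complex_hessian_form \<rho> p b b) = 0" by (rule LIMSEQ_unique)
  have "isCont vec10 b" using continuous_vec10 continuous_on_eq_continuous_at[OF open_UNIV] by blast
  then have "(\<lambda>n. vec10 (a n)) \<longlonglongrightarrow> vec10 b" using lima by (rule isCont_tendsto_compose)
  moreover have "(\<lambda>n. vec10 (a n)) \<longlonglongrightarrow> snd l" using tendsto_snd[OF lim] by (simp add: xa)
  ultimately have "snd l = vec10 b" using LIMSEQ_unique by blast
  then have "snd l \<in> levi_null \<Omega> p" using levi_null_iff[OF op \<Omega>(2) p ldf] 1 2 by simp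
  then show "l \<in> total_space \<Omega> (levi_null \<Omega>)" using p by (simp add: total_space_def case_prod_unfold p_def)
qed

lemma levi_null_boundary_tangent:
  assumes "X \<in> levi_null \<Omega> p"
  shows "fst X \<in> boundary_tangent \<Omega> p" "snd X \<in> boundary_tangent \<Omega> p"
proof -
  obtain a U \<rho> where X: "X = vec10 a" and ldf: "local_defining_function \<Omega> p U \<rho>" and a: "a \<in> tangential_coeffs \<rho> p"
    using assms unfolding levi_null_def by (auto split: if_splits)
  note U = local_defining_functionD[OF ldf]
  have d: "frechet_derivative \<rho> (at p) a = 0" "frechet_derivative \<rho> (at p) (\<i> *s a) = 0"
    using a complex_differential_eq_0_iff[OF U(6)[OF U(2)]] by (auto simp: tangential_coeffs_iff)
  note lin = linear_scale[OF linear_frechet_derivative[OF U(6)[OF U(2)]]]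
  have "frechet_derivative \<rho> (at p) (fst X) = 0" "frechet_derivative \<rho> (at p) (snd X) = 0"
    unfolding X vec10_eq fst_conv snd_conv lin by (simp_all add: d)
  then show "fst X \<in> boundary_tangent \<Omega> p" "snd X \<in> boundary_tangent \<Omega> p"
    using ldf by (auto simp: boundary_tangent_def)
qed

lemma levi_null_scaleR: "X \<in> levi_null \<Omega> p \<Longrightarrow> c *\<^sub>R X \<in> levi_null \<Omega> p"
proof -
  assume X: "X \<in> levi_null \<Omega> p"
  then have p: "p \<in> frontier \<Omega>" by (auto simp: levi_null_def split: if_splits)
  obtain a U \<rho> where a: "X = vec10 a" "local_defining_function \<Omega> p U \<rho>" "a \<in> tangential_coeffs \<rho> p"
      "\<forall>b\<in>tangential_coeffs \<rho> p. complex_hessian_form \<rho> p a b = 0"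
    using X p by (auto simp: levi_null_def)
  define s where "s = complex_of_real c"
  have s: "c *\<^sub>R v = s *s v" for v :: "complex^'a"
    unfolding vec_eq_iff vector_smult_component vector_scaleR_component by (simp add: s_def scaleR_conv_of_real)
  have "c *\<^sub>R X = vec10 (c *\<^sub>R a)"
    unfolding a(1) vec10_eq by (simp add: vec_eq_iff)
  moreover have "c *\<^sub>R a \<in> tangential_coeffs \<rho> p" "\<forall>b\<in>tangential_coeffs \<rho> p. complex_hessian_form \<rho> p (c *\<^sub>R a) b = 0"
    unfolding s using a(3,4) by (auto simp: tangential_coeffs_iff complex_differential_lin complex_hessian_form_lin)
  ultimately show ?thesis using p a(2) unfolding levi_null_def by auto
qed

lemma zariski_tangent_iff:
  "v \<in> zariski_tangent \<Omega> A p \<longleftrightarrow> v \<in> boundary_tangent \<Omega> p \<and>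
    (\<forall>f V F. smooth_fun_on_submanifold (frontier \<Omega>) f \<and> (\<forall>q\<in>A. f q = 0) \<and>
      smooth_extension (frontier \<Omega>) f p V F \<longrightarrow> frechet_derivative F (at p) v = 0)"
  by (auto simp: zariski_tangent_def)

lemma smooth_extensionD:
  assumes "smooth_extension M f p V F"
  shows "open V" "p \<in> V" "C_k_on k F V" "q \<in> V \<Longrightarrow> F differentiable (at q)" "z \<in> V \<Longrightarrow> z \<in> M \<Longrightarrow> F z = f z"
proof -
  show "open V" "p \<in> V" "C_k_on k F V" "z \<in> V \<Longrightarrow> z \<in> M \<Longrightarrow> F z = f z"
    using assms smooth_on_C_k_on unfolding smooth_extension_def by blast+
  have "C_k_on (Suc 0) F V" using assms smooth_on_C_k_on unfolding smooth_extension_def by blast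
  then show "q \<in> V \<Longrightarrow> F differentiable (at q)" by simp
qed

text \<open>The function sought is \<open>\<rho>\<close> plus a multiple of a finite sum of squares of smooth functions that vanish
  on \<open>A\<close> near \<open>p\<close>. Such functions detect every nonzero tangential null vector, because it is not in the
  complexified Zariski tangent space, and \<open>\<rho>\<close> itself is one of them and detects the vectors that are
  not tangential; on all other vectors the Levi form is already positive.\<close>

lemma strictly_psh_null_of_no_null_tangent:
  fixes \<Omega> :: "(complex^'n::finite) set"
  assumes \<Omega>: "smooth_bounded_domain \<Omega>" "levi_pseudoconvex \<Omega>" and A: "A \<subseteq> frontier \<Omega>" "p \<in> A"
    and null: "levi_null \<Omega> p \<inter> complexification (zariski_tangent \<Omega> A p) \<subseteq> {0}"
  shows "strictly_psh_null A p"
proof -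
  have op: "open \<Omega>" using \<Omega>(1) by (simp add: smooth_bounded_domain_def)
  have p: "p \<in> frontier \<Omega>" using A by blast
  obtain U \<rho> where ldf: "local_defining_function \<Omega> p U \<rho>"
    using \<Omega>(1) p unfolding smooth_bounded_domain_def by blast
  note U = local_defining_functionD[OF ldf]
  define I where "I = {(V, F). open V \<and> p \<in> V \<and> C_k_on 2 F V \<and> (\<forall>z\<in>A \<inter> V. F z = (0::real))}"
  have \<rho>I: "(U, \<rho>) \<in> I"
    using U(1-3) frontier_iff_defining_function_zero[OF op ldf] A(1) by (auto simp: I_def)
  \<comment> \<open>Every nonzero tangential null vector is moved by the differential of some function in \<open>I\<close>.\<close>
  have escape: "\<exists>i\<in>I. complex_differential (snd i) p t \<noteq> 0"
    if t: "t \<noteq> 0" "complex_differential \<rho> p t = 0" "Re (complex_hessian_form \<rho> p t t) = 0" for t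
  proof -
    have X: "vec10 t \<in> levi_null \<Omega> p" using levi_null_iff[OF op \<Omega>(2) p ldf] t by simp
    have "vec10 t \<noteq> 0" using t(1) vec10_coefficients[of t] by auto
    then have "vec10 t \<notin> complexification (zariski_tangent \<Omega> A p)" using X null by blast
    then obtain v where v: "v = (1/2) *\<^sub>R t \<or> v = - (1/2) *\<^sub>R (\<i> *s t)" "v \<notin> zariski_tangent \<Omega> A p"
      unfolding complexification_def vec10_eq by auto
    have "v \<in> boundary_tangent \<Omega> p"
      using v(1) levi_null_boundary_tangent[OF X] by (auto simp: vec10_eq)
    then obtain f V F where f: "\<forall>q\<in>A. f q = 0" and F: "smooth_extension (frontier \<Omega>) f p V F" "frechet_derivative F (at p) v \<noteq> 0"
      using v(2) unfolding zariski_tangent_iff by blast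
    note V = smooth_extensionD[OF F(1)]
    have "(V, F) \<in> I" using V(1-3,5) f A(1) by (auto simp: I_def subset_iff)
    moreover have "complex_differential F p t \<noteq> 0"
    proof
      assume "complex_differential F p t = 0"
      then have "frechet_derivative F (at p) t = 0" "frechet_derivative F (at p) (\<i> *s t) = 0"
        using complex_differential_eq_0_iff[OF V(4)[OF V(2)]] by auto
      then have "frechet_derivative F (at p) v = 0"
        using v(1) linear_scale[OF linear_frechet_derivative[OF V(4)[OF V(2)]]] by (metis scaleR_zero_right)
      then show False using F(2) by simp
    qed
    ultimately show ?thesis by force
  qed
  have cont: "continuous_on (sphere 0 1) (\<lambda>t. complex_hessian_form f p t t)"
    "continuous_on (sphere 0 1) (\<lambda>t. complex_differential f p t)" for f :: "complex^'n \<Rightarrow> real"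
    unfolding complex_hessian_form_def complex_differential_def by (intro continuous_intros)+
  obtain J C where J: "finite J" "J \<subseteq> I" "C \<ge> 0"
    "\<forall>t\<in>sphere 0 1. Re (complex_hessian_form \<rho> p t t) + C * (\<Sum>i\<in>J. (cmod (complex_differential (snd i) p t))\<^sup>2) > 0"
  proof (rule compact_positive_combination[of "sphere 0 1" "\<lambda>t. Re (complex_hessian_form \<rho> p t t)" I
      "\<lambda>i t. (cmod (complex_differential (snd i) p t))\<^sup>2"])
    show "continuous_on (sphere 0 1) (\<lambda>t. Re (complex_hessian_form \<rho> p t t))"
      by (intro continuous_on_Re cont)
    show "continuous_on (sphere 0 1) (\<lambda>t. (cmod (complex_differential (snd i) p t))\<^sup>2)" for i :: "(complex^'n) set \<times> (complex^'n \<Rightarrow> real)"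
      by (intro continuous_intros cont)
    show "0 < Re (complex_hessian_form \<rho> p t t) \<or> (\<exists>i\<in>I. 0 < (cmod (complex_differential (snd i) p t))\<^sup>2)"
      if t: "t \<in> sphere 0 1" for t
    proof (cases "complex_differential \<rho> p t = 0")
      case True
      have "t \<noteq> 0" using t by auto
      have "Re (complex_hessian_form \<rho> p t t) \<ge> 0"
        using \<Omega>(2) p ldf True unfolding levi_pseudoconvex_def by (simp add: tangential_coeffs_iff)
      then show ?thesis using escape[OF \<open>t \<noteq> 0\<close> True] by force
    next
      case False
      then show ?thesis using \<rho>I by (intro disjI2 bexI[of _ "(U, \<rho>)"]) auto
    qed
  qed auto
  define V where "V = U \<inter> (\<Inter>i\<in>J. fst i)"
  have V: "open V" "p \<in> V" "V \<subseteq> U" using U(1,2) J by (auto simp: V_def I_def case_prod_unfold intro!: open_Int open_INT)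
  have F: "C_k_on 2 (snd i) V" "\<And>z. z \<in> A \<inter> V \<Longrightarrow> snd i z = 0" if "i \<in> J" for i
  proof -
    have "i \<in> I" "V \<subseteq> fst i" using J(2) that by (auto simp: V_def)
    then show "C_k_on 2 (snd i) V" "\<And>z. z \<in> A \<inter> V \<Longrightarrow> snd i z = 0"
      using C_k_on_subset by (auto simp: I_def case_prod_unfold)
  qed
  define Q where "Q = (\<lambda>z. \<Sum>i\<in>J. (snd i z)\<^sup>2)"
  define \<Psi> where "\<Psi> = (\<lambda>z. \<rho> z + (C / 2) * Q z)"
  have \<rho>C: "C_k_on 2 \<rho> V" using C_k_on_subset[OF U(3) V(3)] .
  have sqC: "C_k_on 2 (\<lambda>z. (snd i z)\<^sup>2) V" if "i \<in> J" for i by (intro C_k_on_power V(1) F(1) that)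
  have QC: "C_k_on 2 Q V" unfolding Q_def by (intro C_k_on_sum V(1) sqC)
  show ?thesis unfolding strictly_psh_null_def
  proof (intro exI conjI ballI allI impI)
    show "open V" "p \<in> V" by (fact V)+
    show "C_k_on 2 \<Psi> V" unfolding \<Psi>_def by (intro C_k_on_add C_k_on_cmult \<rho>C QC V(1))
    show "\<Psi> z = 0" if "z \<in> A \<inter> V" for z
      using frontier_iff_defining_function_zero[OF op ldf, of z] that A(1) V(3) F(2)[OF _ that]
      by (auto simp: \<Psi>_def Q_def)
    show "Re (complex_hessian_form \<Psi> p t t) > 0" if t: "t \<noteq> 0" for t
    proof -
      have form: "Re (complex_hessian_form \<Psi> p t t) = Re (complex_hessian_form \<rho> p t t)
          + C * (\<Sum>i\<in>J. (cmod (complex_differential (snd i) p t))\<^sup>2)" for t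
      proof -
        have "complex_hessian_form \<Psi> p t t = complex_hessian_form \<rho> p t t
            + of_real (C / 2) * (\<Sum>i\<in>J. complex_hessian_form (\<lambda>z. (snd i z)\<^sup>2) p t t)"
          unfolding \<Psi>_def complex_hessian_form_add[OF V(1) \<rho>C C_k_on_cmult[OF V(1) QC] V(2)]
            complex_hessian_form_cmult[OF V(1) QC V(2)]
          unfolding Q_def complex_hessian_form_sum[OF V(1) sqC V(2), of J "\<lambda>i. i", simplified] by simp
        also have "(\<Sum>i\<in>J. complex_hessian_form (\<lambda>z. (snd i z)\<^sup>2) p t t)
            = (\<Sum>i\<in>J. of_real (2 * (cmod (complex_differential (snd i) p t))\<^sup>2))"
          using complex_hessian_form_power2[OF V(1) F(1) V(2) F(2)] A(2) V(2) by (intro sum.cong) auto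
        also have "\<dots> = of_real (2 * (\<Sum>i\<in>J. (cmod (complex_differential (snd i) p t))\<^sup>2))"
          by (simp add: sum_distrib_left)
        finally show ?thesis by (simp flip: of_real_power of_real_sum of_real_mult)
      qed
      have pos: "Re (complex_hessian_form \<Psi> p u u) > 0" if "u \<in> sphere 0 1" for u
        using J(4) that by (simp add: form)
      define u where "u = (1 / norm t) *\<^sub>R t"
      have u: "t = norm t *\<^sub>R u" "u \<in> sphere 0 1" using t by (auto simp: u_def)
      have "Re (complex_hessian_form \<Psi> p t t) = (norm t)\<^sup>2 * Re (complex_hessian_form \<Psi> p u u)"
        using complex_hessian_form_scaleR[of \<Psi> p "norm t" u, folded u(1)] by (simp flip: of_real_power)
      then show ?thesis using pos[OF u(2)] t by simp
    qed
  qed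
qed

section \<open>The derived sequence and the Levi core\<close>

lemma support_iff: "p \<in> support \<Omega> D \<longleftrightarrow> p \<in> frontier \<Omega> \<and> (\<exists>X\<in>D p. X \<noteq> 0)"
proof -
  have "0 < dim (D p) \<longleftrightarrow> (\<exists>X\<in>D p. X \<noteq> 0)" by (simp only: neq0_conv[symmetric] dim_eq_0) blast
  then show ?thesis by (simp add: support_def)
qed

lemma support_subset_frontier: "support \<Omega> D \<subseteq> frontier \<Omega>"
  by (auto simp: support_def)

lemma support_mono: "(\<And>p. D p \<subseteq> E p) \<Longrightarrow> support \<Omega> D \<subseteq> support \<Omega> E"
  by (fastforce simp: support_iff)

lemma zariski_tangent_mono: "A \<subseteq> B \<Longrightarrow> zariski_tangent \<Omega> A p \<subseteq> zariski_tangent \<Omega> B p"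
  unfolding zariski_tangent_def by blast

lemma complexification_mono: "S \<subseteq> T \<Longrightarrow> complexification S \<subseteq> complexification T"
  by (auto simp: complexification_def)

lemma boundary_tangent_scaleR: "v \<in> boundary_tangent \<Omega> p \<Longrightarrow> c *\<^sub>R v \<in> boundary_tangent \<Omega> p"
proof -
  assume "v \<in> boundary_tangent \<Omega> p"
  then obtain U \<rho> where ldf: "local_defining_function \<Omega> p U \<rho>" and v: "frechet_derivative \<rho> (at p) v = 0"
    unfolding boundary_tangent_def by blast
  have "frechet_derivative \<rho> (at p) (c *\<^sub>R v) = 0"
    using linear_scale[OF linear_frechet_derivative[OF local_defining_functionD(6)[OF ldf local_defining_functionD(2)[OF ldf]]]] v
    by simp
  then show ?thesis using ldf unfolding boundary_tangent_def by blast
qed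

lemma zariski_tangent_scaleR:
  assumes "v \<in> zariski_tangent \<Omega> A p" shows "c *\<^sub>R v \<in> zariski_tangent \<Omega> A p"
  unfolding zariski_tangent_iff
proof (intro conjI allI impI)
  show "c *\<^sub>R v \<in> boundary_tangent \<Omega> p"
    using assms by (simp add: zariski_tangent_iff boundary_tangent_scaleR)
  fix f V F
  assume f: "smooth_fun_on_submanifold (frontier \<Omega>) f \<and> (\<forall>q\<in>A. f q = 0) \<and> smooth_extension (frontier \<Omega>) f p V F"
  then have "frechet_derivative F (at p) v = 0" using assms unfolding zariski_tangent_iff by blast
  moreover have "F differentiable (at p)" using f smooth_extensionD(2,4) by blast
  ultimately show "frechet_derivative F (at p) (c *\<^sub>R v) = 0"
    using linear_scale[OF linear_frechet_derivative] by fastforce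
qed

text \<open>A smooth extension at \<open>p\<close> is also one at all nearby points, so the defining equations at \<open>q n\<close> pass to
  the limit by continuity of the differential.\<close>

lemma zariski_tangent_limit:
  fixes \<Omega> :: "(complex^'n::finite) set"
  assumes x: "\<And>n. v n \<in> zariski_tangent \<Omega> A (q n)" "q \<longlonglongrightarrow> p" "v \<longlonglongrightarrow> w"
    and w: "w \<in> boundary_tangent \<Omega> p"
  shows "w \<in> zariski_tangent \<Omega> A p"
  unfolding zariski_tangent_iff
proof (intro conjI allI impI)
  show "w \<in> boundary_tangent \<Omega> p" by (rule w)
  fix f V F
  assume f: "smooth_fun_on_submanifold (frontier \<Omega>) f \<and> (\<forall>q\<in>A. f q = 0) \<and> smooth_extension (frontier \<Omega>) f p V F"
  then have ext: "smooth_extension (frontier \<Omega>) f p V F" by simp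
  note V = smooth_extensionD[OF ext]
  have D: "frechet_derivative F (at z) u = 2 * Re (complex_differential F z u)" if "z \<in> V" for z u
    by (simp add: complex_differential_eq[OF V(4)[OF that]])
  have "\<forall>\<^sub>F n in sequentially. q n \<in> V" using x(2) V(1,2) by (rule topological_tendstoD)
  then have ev: "\<forall>\<^sub>F n in sequentially. 2 * Re (complex_differential F (q n) (v n)) = 0"
  proof eventually_elim
    case (elim n)
    then have "smooth_extension (frontier \<Omega>) f (q n) V F" using ext by (simp add: smooth_extension_def)
    then have "frechet_derivative F (at (q n)) (v n) = 0" using x(1)[of n] f unfolding zariski_tangent_iff by blast
    then show ?case using D[OF elim] by simp
  qed
  have "open (V \<times> (UNIV :: (complex^'n) set))" using V(1) by (intro open_Times) auto
  then have "isCont (\<lambda>x. complex_differential F (fst x) (snd x)) (p, w)"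
    using continuous_on_complex_differential[OF V(1,3)] V(2) continuous_on_eq_continuous_at by blast
  from isCont_tendsto_compose[OF this tendsto_Pair[OF x(2,3)]]
  have "(\<lambda>n. 2 * Re (complex_differential F (q n) (v n))) \<longlonglongrightarrow> 2 * Re (complex_differential F p w)"
    by (intro tendsto_intros) simp
  moreover have "(\<lambda>n. 2 * Re (complex_differential F (q n) (v n))) \<longlonglongrightarrow> 0"
    by (rule tendsto_eventually[OF ev])
  ultimately have "2 * Re (complex_differential F p w) = 0" by (rule LIMSEQ_unique)
  then show "frechet_derivative F (at p) w = 0" using D[OF V(2)] by simp
qed

text \<open>What the transfinite recursion preserves and compactness of the supports requires. Containment
  in the Levi null distribution ensures that the components of a limit vector are again tangent to
  the boundary.\<close>

definition closed_null_distribution :: "(complex^'n::finite) set \<Rightarrow> 'n distr \<Rightarrow> bool" where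
  "closed_null_distribution \<Omega> D \<longleftrightarrow> closed (total_space \<Omega> D) \<and>
     (\<forall>p X c. X \<in> D p \<longrightarrow> c *\<^sub>R X \<in> D p) \<and> (\<forall>p. D p \<subseteq> levi_null \<Omega> p)"

lemma support_unit_vector:
  assumes "closed_null_distribution \<Omega> D" "p \<in> support \<Omega> D"
  obtains X where "X \<in> D p" "norm X = 1"
proof -
  obtain X where X: "X \<in> D p" "X \<noteq> 0" using assms(2) unfolding support_iff by blast
  then have "(1 / norm X) *\<^sub>R X \<in> D p" using assms(1) unfolding closed_null_distribution_def by blast
  moreover have "norm ((1 / norm X) *\<^sub>R X) = 1" using X(2) by simp
  ultimately show thesis by (rule that)
qed

lemma compact_frontier_domain: "smooth_bounded_domain \<Omega> \<Longrightarrow> compact (frontier \<Omega>)"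
  by (simp add: compact_frontier_bounded smooth_bounded_domain_def)

text \<open>The support is the projection of the compact set of unit vectors of the distribution.\<close>

lemma compact_support:
  assumes "smooth_bounded_domain \<Omega>" and D: "closed_null_distribution \<Omega> D"
  shows "compact (support \<Omega> D)"
proof -
  have "support \<Omega> D = fst ` ((frontier \<Omega> \<times> sphere 0 1) \<inter> total_space \<Omega> D)"
  proof
    show "support \<Omega> D \<subseteq> fst ` ((frontier \<Omega> \<times> sphere 0 1) \<inter> total_space \<Omega> D)"
    proof
      fix p assume p: "p \<in> support \<Omega> D"
      obtain X where X: "X \<in> D p" "norm X = 1" using support_unit_vector[OF D p] .
      then have "(p, X) \<in> (frontier \<Omega> \<times> sphere 0 1) \<inter> total_space \<Omega> D"
        using p by (auto simp: total_space_def support_iff)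
      then show "p \<in> fst ` ((frontier \<Omega> \<times> sphere 0 1) \<inter> total_space \<Omega> D)" by force
    qed
    show "fst ` ((frontier \<Omega> \<times> sphere 0 1) \<inter> total_space \<Omega> D) \<subseteq> support \<Omega> D"
    proof
      fix p assume "p \<in> fst ` ((frontier \<Omega> \<times> sphere 0 1) \<inter> total_space \<Omega> D)"
      then obtain X where "norm X = 1" "p \<in> frontier \<Omega>" "X \<in> D p" by (auto simp: total_space_def)
      moreover from this(1) have "X \<noteq> 0" by auto
      ultimately show "p \<in> support \<Omega> D" unfolding support_iff by blast
    qed
  qed
  moreover have "compact ((frontier \<Omega> \<times> sphere 0 1) \<inter> total_space \<Omega> D)"
    using D compact_frontier_domain[OF assms(1)]
    by (intro compact_Int_closed compact_Times compact_sphere) (auto simp: closed_null_distribution_def)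
  ultimately show ?thesis by (auto intro!: compact_continuous_image continuous_intros)
qed

lemma closed_null_distribution_levi_null:
  "smooth_bounded_domain \<Omega> \<Longrightarrow> levi_pseudoconvex \<Omega> \<Longrightarrow> closed_null_distribution \<Omega> (levi_null \<Omega>)"
  by (simp add: closed_null_distribution_def closed_total_space_levi_null levi_null_scaleR)

lemma closed_null_distribution_derived:
  fixes \<Omega> :: "(complex^'n::finite) set"
  assumes D: "closed_null_distribution \<Omega> D"
  shows "closed_null_distribution \<Omega> (derived \<Omega> D)"
  unfolding closed_null_distribution_def
proof (intro conjI allI impI)
  have Dn: "D p \<subseteq> levi_null \<Omega> p" for p using D by (simp add: closed_null_distribution_def)
  show "derived \<Omega> D p \<subseteq> levi_null \<Omega> p" for p using Dn by (auto simp: derived_def)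
  show "c *\<^sub>R X \<in> derived \<Omega> D p" if "X \<in> derived \<Omega> D p" for p X c
    using that D zariski_tangent_scaleR
    by (cases X) (auto simp: derived_def complexification_def closed_null_distribution_def)
  show "closed (total_space \<Omega> (derived \<Omega> D))"
    unfolding closed_sequential_limits
  proof (intro allI impI)
    fix x :: "nat \<Rightarrow> (complex^'n) \<times> 'n ctvec" and l
    assume "(\<forall>n. x n \<in> total_space \<Omega> (derived \<Omega> D)) \<and> x \<longlonglongrightarrow> l"
    then have x: "\<And>n. x n \<in> total_space \<Omega> D"
      "\<And>n. fst (snd (x n)) \<in> zariski_tangent \<Omega> (support \<Omega> D) (fst (x n))"
      "\<And>n. snd (snd (x n)) \<in> zariski_tangent \<Omega> (support \<Omega> D) (fst (x n))" and lim: "x \<longlonglongrightarrow> l"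
      by (auto simp: total_space_def derived_def complexification_def case_prod_unfold)
    have "closed (total_space \<Omega> D)" using D by (simp add: closed_null_distribution_def)
    then have l: "l \<in> total_space \<Omega> D" using x(1) lim by (rule closed_sequentially)
    then have "snd l \<in> levi_null \<Omega> (fst l)" using Dn[of "fst l"] by (auto simp: total_space_def case_prod_unfold)
    note bt = levi_null_boundary_tangent[OF this]
    have "fst (snd l) \<in> zariski_tangent \<Omega> (support \<Omega> D) (fst l)"
      by (rule zariski_tangent_limit[of "\<lambda>n. fst (snd (x n))" \<Omega> _ "\<lambda>n. fst (x n)", OF x(2) _ _ bt(1)]) (intro tendsto_intros lim)+
    moreover have "snd (snd l) \<in> zariski_tangent \<Omega> (support \<Omega> D) (fst l)"
      by (rule zariski_tangent_limit[of "\<lambda>n. snd (snd (x n))" \<Omega> _ "\<lambda>n. fst (x n)", OF x(3) _ _ bt(2)]) (intro tendsto_intros lim)+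
    ultimately show "l \<in> total_space \<Omega> (derived \<Omega> D)"
      using l by (auto simp: total_space_def derived_def complexification_def case_prod_unfold)
  qed
qed

lemma closed_null_distribution_INT:
  assumes "I \<noteq> {}" "\<And>i. i \<in> I \<Longrightarrow> closed_null_distribution \<Omega> (D i)"
  shows "closed_null_distribution \<Omega> (\<lambda>p. \<Inter>i\<in>I. D i p)"
proof -
  have "total_space \<Omega> (\<lambda>p. \<Inter>i\<in>I. D i p) = (\<Inter>i\<in>I. total_space \<Omega> (D i))"
    using assms(1) by (auto simp: total_space_def)
  then have "closed (total_space \<Omega> (\<lambda>p. \<Inter>i\<in>I. D i p))"
    using assms(2) unfolding closed_null_distribution_def by (simp add: closed_INT)
  moreover have "c *\<^sub>R X \<in> D i p" if "i \<in> I" "X \<in> (\<Inter>i\<in>I. D i p)" for i p X c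
    using assms(2)[OF that(1)] that unfolding closed_null_distribution_def by blast
  moreover obtain i where "i \<in> I" using assms(1) by blast
  then have "(\<Inter>i\<in>I. D i p) \<subseteq> levi_null \<Omega> p" for p
    using assms(2)[of i] unfolding closed_null_distribution_def by blast
  ultimately show ?thesis unfolding closed_null_distribution_def by simp
qed

lemma derived_seq_cases:
  assumes "Well_order r"
  obtains (zero) "underS r \<alpha> = {}" "derived_seq \<Omega> r D \<alpha> = D"
  | (succ) \<delta> where "immediate_pred r \<delta> \<alpha>" "derived_seq \<Omega> r D \<alpha> = derived \<Omega> (derived_seq \<Omega> r D \<delta>)"
  | (limit) "underS r \<alpha> \<noteq> {}" "derived_seq \<Omega> r D \<alpha> = (\<lambda>p. \<Inter>\<beta>\<in>underS r \<alpha>. derived_seq \<Omega> r D \<beta> p)"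
proof (cases "underS r \<alpha> = {}")
  case True
  then show thesis using zero derived_seq_zero[OF assms] by blast
next
  case False
  show thesis
  proof (cases "\<exists>\<delta>. immediate_pred r \<delta> \<alpha>")
    case True
    then show thesis using succ derived_seq_succ[OF assms] by blast
  next
    case no: False
    have "derived_seq \<Omega> r D \<alpha> = (\<lambda>p. \<Inter>\<beta>\<in>underS r \<alpha>. derived_seq \<Omega> r D \<beta> p)"
      by (rule ext) (rule derived_seq_limit[OF assms False no])
    then show thesis using limit False by blast
  qed
qed

lemma underS_induct:
  assumes "Well_order r" and step: "\<And>\<alpha>. (\<And>\<beta>. \<beta> \<in> underS r \<alpha> \<Longrightarrow> P \<beta>) \<Longrightarrow> P \<alpha>"
  shows "P \<alpha>"
proof (rule wo_rel.well_order_induct[of r])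
  show "wo_rel r" using assms(1) by (simp add: wo_rel_def)
  show "P x" if "\<forall>y. y \<noteq> x \<and> (y, x) \<in> r \<longrightarrow> P y" for x
    by (rule step) (use that in \<open>auto simp: underS_def\<close>)
qed

lemma underS_trans:
  assumes "Well_order r" "\<gamma> \<in> underS r \<beta>" "\<beta> \<in> underS r \<alpha>"
  shows "\<gamma> \<in> underS r \<alpha>"
proof -
  have "wo_rel r" using assms(1) by (simp add: wo_rel_def)
  then have tr: "trans r" and as: "antisym r" using wo_rel.TRANS wo_rel.ANTISYM by blast+
  have *: "\<gamma> \<noteq> \<beta>" "(\<gamma>, \<beta>) \<in> r" "(\<beta>, \<alpha>) \<in> r" using assms(2,3) by (auto simp: underS_def)
  then have "(\<gamma>, \<alpha>) \<in> r" using transD[OF tr] by blast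
  moreover have "\<gamma> \<noteq> \<alpha>" using antisymD[OF as] * by blast
  ultimately show ?thesis by (simp add: underS_def)
qed

lemma derived_seq_closed_null:
  assumes r: "Well_order r" and D: "closed_null_distribution \<Omega> D"
  shows "closed_null_distribution \<Omega> (derived_seq \<Omega> r D \<alpha>)"
proof (induction rule: underS_induct[OF r])
  case (1 \<alpha>)
  show ?case
  proof (cases rule: derived_seq_cases[OF r, of \<alpha> \<Omega> D, case_names zero succ limit])
    case zero
    then show ?thesis using D by simp
  next
    case (succ \<delta>)
    then show ?thesis using 1 by (simp add: immediate_pred_def closed_null_distribution_derived)
  next
    case limit
    show ?thesis unfolding limit(2) by (rule closed_null_distribution_INT[OF limit(1) 1])
  qed
qed

text \<open>Every step of the recursion is an intersection.\<close>

lemma derived_seq_antimono: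
  assumes r: "Well_order r"
  shows "\<beta> \<in> underS r \<alpha> \<Longrightarrow> derived_seq \<Omega> r D \<alpha> p \<subseteq> derived_seq \<Omega> r D \<beta> p"
proof (induction arbitrary: \<beta> rule: underS_induct[OF r])
  case (1 \<alpha>)
  show ?case
  proof (cases rule: derived_seq_cases[OF r, of \<alpha> \<Omega> D, case_names zero succ limit])
    case zero
    then show ?thesis using 1 by simp
  next
    case (succ \<delta>)
    have \<delta>: "\<delta> \<in> underS r \<alpha>" "(\<beta>, \<delta>) \<in> r" using succ(1) 1(2) by (auto simp: immediate_pred_def)
    have "derived_seq \<Omega> r D \<alpha> p \<subseteq> derived_seq \<Omega> r D \<delta> p" by (simp add: succ(2) derived_def)
    moreover have "derived_seq \<Omega> r D \<delta> p \<subseteq> derived_seq \<Omega> r D \<beta> p"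
      using 1(1)[OF \<delta>(1), of \<beta>] \<delta>(2) by (cases "\<beta> = \<delta>") (auto simp: underS_def)
    ultimately show ?thesis by blast
  next
    case limit
    show ?thesis unfolding limit(2) using 1(2) by blast
  qed
qed

text \<open>A vector that is tangent to \<open>A\<close> is tangent to every earlier support, since these contain \<open>A\<close>, so no
  derivation step removes it.\<close>

lemma tangent_null_vector_in_derived_seq:
  assumes r: "Well_order r" and X: "X \<in> D p" "X \<in> complexification (zariski_tangent \<Omega> A p)"
  shows "(\<And>\<beta>. \<beta> \<in> underS r \<alpha> \<Longrightarrow> A \<subseteq> support \<Omega> (derived_seq \<Omega> r D \<beta>)) \<Longrightarrow> X \<in> derived_seq \<Omega> r D \<alpha> p"
proof (induction rule: underS_induct[OF r])
  case (1 \<alpha>)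
  have IH: "X \<in> derived_seq \<Omega> r D \<beta> p" if "\<beta> \<in> underS r \<alpha>" for \<beta>
    using 1(1)[OF that] 1(2) underS_trans[OF r _ that] by blast
  show ?case
  proof (cases rule: derived_seq_cases[OF r, of \<alpha> \<Omega> D, case_names zero succ limit])
    case zero
    then show ?thesis using X by simp
  next
    case (succ \<delta>)
    then have \<delta>: "\<delta> \<in> underS r \<alpha>" by (simp add: immediate_pred_def)
    show ?thesis unfolding succ(2) derived_def
      using IH[OF \<delta>] X(2) complexification_mono[OF zariski_tangent_mono[OF 1(2)[OF \<delta>]]] by blast
  next
    case limit
    show ?thesis unfolding limit(2) using IH by blast
  qed
qed

lemma finite_underS_bounded:
  assumes r: "Well_order r" and "finite B" "B \<subseteq> underS r \<alpha>" "underS r \<alpha> \<noteq> {}"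
  shows "\<exists>\<beta>\<in>underS r \<alpha>. \<forall>\<gamma>\<in>B. (\<gamma>, \<beta>) \<in> r"
  using assms(2,3)
proof (induction B rule: finite_induct)
  case empty
  then show ?case using assms(4) by blast
next
  case (insert b B)
  have wo: "wo_rel r" using r by (simp add: wo_rel_def)
  have tr: "trans r" and rf: "Refl r" using wo_rel.TRANS[OF wo] wo_rel.REFL[OF wo] by blast+
  obtain \<beta> where \<beta>: "\<beta> \<in> underS r \<alpha>" "\<forall>\<gamma>\<in>B. (\<gamma>, \<beta>) \<in> r" using insert by blast
  have b: "b \<in> underS r \<alpha>" using insert by blast
  have F: "b \<in> Field r" "\<beta> \<in> Field r" using b \<beta>(1) by (auto simp: underS_def Field_def)
  then consider "(b, \<beta>) \<in> r" | "(\<beta>, b) \<in> r" using wo_rel.TOTALS[OF wo] by blast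
  then show ?case
  proof cases
    case 1
    then show ?thesis using \<beta> by blast
  next
    case 2
    have "(b, b) \<in> r" using rf F by (simp add: refl_on_def)
    moreover have "(\<gamma>, b) \<in> r" if "\<gamma> \<in> B" for \<gamma> using \<beta>(2) that 2 tr by (meson transD)
    ultimately show ?thesis using b by blast
  qed
qed

text \<open>If no earlier support were contained in \<open>U\<close>, then the sets of unit vectors of \<open>N\<^sup>\<beta>\<close> based outside \<open>U\<close> would
  be nonempty, compact and nested; a vector in their intersection belongs to \<open>N\<^sup>\<alpha>\<close>, against the choice
  of \<open>U\<close>. Using vectors rather than base points avoids the question how supports behave under
  intersections of distributions.\<close>

lemma limit_support_neighbourhood:
  fixes \<Omega> :: "(complex^'n::finite) set"
  assumes \<Omega>: "smooth_bounded_domain \<Omega>" and r: "Well_order r" and D: "closed_null_distribution \<Omega> D"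
    and limit: "underS r \<alpha> \<noteq> {}" "derived_seq \<Omega> r D \<alpha> = (\<lambda>p. \<Inter>\<beta>\<in>underS r \<alpha>. derived_seq \<Omega> r D \<beta> p)"
    and U: "open U" "support \<Omega> (derived_seq \<Omega> r D \<alpha>) \<subseteq> U"
  shows "\<exists>\<beta>\<in>underS r \<alpha>. support \<Omega> (derived_seq \<Omega> r D \<beta>) \<subseteq> U"
proof (rule ccontr)
  assume no: "\<not> ?thesis"
  note good = derived_seq_closed_null[OF r D]
  define K where "K = (frontier \<Omega> - U) \<times> sphere (0 :: 'n ctvec) 1"
  have K: "compact K" unfolding K_def
    using compact_frontier_domain[OF \<Omega>] U(1) by (intro compact_Times compact_diff) auto
  have "K \<inter> (\<Inter>\<beta>\<in>underS r \<alpha>. total_space \<Omega> (derived_seq \<Omega> r D \<beta>)) \<noteq> {}"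
  proof (rule compact_imp_fip_image[OF K])
    show "closed (total_space \<Omega> (derived_seq \<Omega> r D \<beta>))" for \<beta>
      using good by (simp add: closed_null_distribution_def)
    fix B assume B: "finite B" "B \<subseteq> underS r \<alpha>"
    obtain \<beta> where \<beta>: "\<beta> \<in> underS r \<alpha>" "\<forall>\<gamma>\<in>B. (\<gamma>, \<beta>) \<in> r"
      using finite_underS_bounded[OF r B limit(1)] by blast
    obtain p where p: "p \<in> support \<Omega> (derived_seq \<Omega> r D \<beta>)" "p \<notin> U" using no \<beta>(1) by blast
    obtain X where X: "X \<in> derived_seq \<Omega> r D \<beta> p" "norm X = 1" using support_unit_vector[OF good p(1)] .
    have "X \<in> derived_seq \<Omega> r D \<gamma> p" if "\<gamma> \<in> B" for \<gamma>
      using derived_seq_antimono[OF r, of \<gamma> \<beta> \<Omega> D p] X(1) \<beta>(2) that by (cases "\<gamma> = \<beta>") (auto simp: underS_def)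
    then have "(p, X) \<in> K \<inter> (\<Inter>\<beta>\<in>B. total_space \<Omega> (derived_seq \<Omega> r D \<beta>))"
      using p X(2) by (auto simp: K_def total_space_def support_iff)
    then show "K \<inter> (\<Inter>\<beta>\<in>B. total_space \<Omega> (derived_seq \<Omega> r D \<beta>)) \<noteq> {}" by blast
  qed
  then obtain p X where *: "(p, X) \<in> K" "\<forall>\<beta>\<in>underS r \<alpha>. (p, X) \<in> total_space \<Omega> (derived_seq \<Omega> r D \<beta>)" by auto
  then have "X \<in> derived_seq \<Omega> r D \<alpha> p" unfolding limit(2) by (auto simp: total_space_def)
  moreover have "X \<noteq> 0" "p \<in> frontier \<Omega>" "p \<notin> U" using *(1) by (auto simp: K_def)
  ultimately have "p \<in> support \<Omega> (derived_seq \<Omega> r D \<alpha>)" unfolding support_iff by blast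
  then show False using U(2) \<open>p \<notin> U\<close> by blast
qed

text \<open>Transfinite induction on \<open>\<alpha>\<close>, for all pairs \<open>M' < M\<close> simultaneously, since a successor step uses up
  part of the gap between \<open>M'\<close> and \<open>M\<close>.\<close>

lemma property_P_at_frontier_from_derived_seq:
  fixes \<Omega> :: "(complex^'n::finite) set"
  assumes \<Omega>: "smooth_bounded_domain \<Omega>" "levi_pseudoconvex \<Omega>" and r: "Well_order r"
  shows "0 < M' \<Longrightarrow> M' < M \<Longrightarrow> property_P_at M (support \<Omega> (derived_seq \<Omega> r (levi_null \<Omega>) \<alpha>)) \<Longrightarrow>
    property_P_at M' (frontier \<Omega>)"
proof (induction arbitrary: M M' rule: underS_induct[OF r])
  case (1 \<alpha>)
  define N where "N = derived_seq \<Omega> r (levi_null \<Omega>)"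
  note prems = 1(2-4)[folded N_def] and IH = 1(1)[folded N_def]
  note D0 = closed_null_distribution_levi_null[OF \<Omega>]
  have cpt: "compact (support \<Omega> (N \<beta>))" for \<beta>
    unfolding N_def by (rule compact_support[OF \<Omega>(1) derived_seq_closed_null[OF r D0]])
  show ?case
  proof (cases rule: derived_seq_cases[OF r, of \<alpha> \<Omega> "levi_null \<Omega>", folded N_def, case_names zero succ limit])
    case zero
    show ?thesis
    proof (rule property_P_at_extend[OF compact_frontier_domain[OF \<Omega>(1)] cpt support_subset_frontier _ prems(3,1,2)])
      show "strictly_psh_null (frontier \<Omega>) p" if "p \<in> frontier \<Omega> - support \<Omega> (N \<alpha>)" for p
        using that zero(2) by (intro strictly_psh_null_of_no_null_tangent[OF \<Omega>]) (auto simp: support_iff)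
    qed
  next
    case (succ \<delta>)
    have \<delta>: "\<delta> \<in> underS r \<alpha>" using succ(1) by (simp add: immediate_pred_def)
    define M1 where "M1 = (M + M') / 2"
    have M1: "0 < M1" "M1 < M" "M' < M1" using prems(1,2) by (auto simp: M1_def)
    have sub: "support \<Omega> (N \<alpha>) \<subseteq> support \<Omega> (N \<delta>)"
      using derived_seq_antimono[OF r \<delta>] by (intro support_mono) (simp add: N_def)
    have "property_P_at M1 (support \<Omega> (N \<delta>))"
    proof (rule property_P_at_extend[OF cpt cpt sub _ prems(3) M1(1,2)])
      fix p assume p: "p \<in> support \<Omega> (N \<delta>) - support \<Omega> (N \<alpha>)"
      have "levi_null \<Omega> p \<inter> complexification (zariski_tangent \<Omega> (support \<Omega> (N \<delta>)) p) \<subseteq> N \<alpha> p"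
      proof
        fix X assume X: "X \<in> levi_null \<Omega> p \<inter> complexification (zariski_tangent \<Omega> (support \<Omega> (N \<delta>)) p)"
        have "X \<in> N \<delta> p" unfolding N_def
        proof (rule tangent_null_vector_in_derived_seq[OF r])
          show "X \<in> levi_null \<Omega> p" "X \<in> complexification (zariski_tangent \<Omega> (support \<Omega> (N \<delta>)) p)" using X by auto
          show "support \<Omega> (N \<delta>) \<subseteq> support \<Omega> (derived_seq \<Omega> r (levi_null \<Omega>) \<beta>)" if "\<beta> \<in> underS r \<delta>" for \<beta>
            using derived_seq_antimono[OF r that] by (intro support_mono) (simp add: N_def)
        qed
        then show "X \<in> N \<alpha> p" using X unfolding succ(2) derived_def by blast
      qed
      moreover have "N \<alpha> p \<subseteq> {0}" using p by (auto simp: support_iff)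
      ultimately show "strictly_psh_null (support \<Omega> (N \<delta>)) p"
        using p support_subset_frontier by (intro strictly_psh_null_of_no_null_tangent[OF \<Omega>]) blast+
    qed
    then show ?thesis using IH[OF \<delta> prems(1) M1(3)] by blast
  next
    case limit
    \<comment> \<open>A function for the smaller support already serves an earlier one, with the same constant.\<close>
    obtain U l where U: "open U" "support \<Omega> (N \<alpha>) \<subseteq> U" "C_k_on 2 l U" "\<forall>z\<in>U. 0 \<le> l z \<and> l z \<le> 1"
      "\<forall>z\<in>U. \<forall>w. Re (complex_hessian_form l z w w) \<ge> M * (norm w)\<^sup>2"
      using prems(3) unfolding property_P_at_def by blast
    obtain \<beta> where \<beta>: "\<beta> \<in> underS r \<alpha>" "support \<Omega> (N \<beta>) \<subseteq> U"
      using limit_support_neighbourhood[OF \<Omega>(1) r D0, of \<alpha>, folded N_def, OF limit U(1,2)] by blast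
    have "property_P_at M (support \<Omega> (N \<beta>))"
      unfolding property_P_at_def using U \<beta>(2) by blast
    then show ?thesis using IH[OF \<beta>(1) prems(1,2)] by blast
  qed
qed

text \<open>The core is a member of the derived sequence, and the previous lemma holds at every index, so in
  particular at the one chosen in the definition of the core.\<close>

theorem theorem1:
  fixes \<Omega> :: "(complex^'n::finite) set"
  assumes "smooth_bounded_domain \<Omega>" and "levi_pseudoconvex \<Omega>"
  shows "property_P (frontier \<Omega>) \<longleftrightarrow> property_P (support \<Omega> (levi_core \<Omega>))"
proof
  assume "property_P (frontier \<Omega>)"
  then show "property_P (support \<Omega> (levi_core \<Omega>))"
    unfolding property_P_iff by (intro allI impI property_P_at_subset[OF _ support_subset_frontier]) simp
next
  have r: "Well_order omega1"
    unfolding omega1_def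
    by (rule card_order_on_well_order_on[OF cardSuc_Card_order[OF natLeq_Card_order]])
  assume P: "property_P (support \<Omega> (levi_core \<Omega>))"
  show "property_P (frontier \<Omega>)"
    unfolding property_P_iff
  proof (intro allI impI)
    fix M :: real assume M: "M > 0"
    show "property_P_at M (frontier \<Omega>)"
    proof (rule property_P_at_frontier_from_derived_seq[OF assms r M])
      show "M < M + 1" by simp
      show "property_P_at (M + 1) (support \<Omega> (derived_seq \<Omega> omega1 (levi_null \<Omega>)
          (SOME \<gamma>. \<gamma> \<in> Field omega1 \<and> (\<forall>\<eta>. (\<gamma>, \<eta>) \<in> omega1 \<longrightarrow> levi_seq \<Omega> \<eta> = levi_seq \<Omega> \<gamma>))))"
        using P M unfolding property_P_iff levi_core_def levi_seq_def by simp
    qed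
  qed
qed

end
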